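(* Let $d\in\{0,1\}$, let $\left(P_{2N+d}\right)_{N=1}^\infty\in\mathbb{P}_d(\beta,\gamma,\delta)$, and let $x_k=x_{k,N,d}$, $1\le k\le N$, be the positive zeros of $P_{2N+d}$. Let $(u_N)_{N=1}^\infty$ be a sequence of positive numbers such that $u_N\notin\{x_{1,N,d},\ldots,x_{N,N,d}\}$ and $\lim_{N\to\infty}\beta_N u_N=\infty$. Let $\Omega_{N+2,d}:=\{0,\,u_N^2,\,x_{1,N,d}^2,\ldots,x_{N,N,d}^2\}$. Assume in addition that, for some $r>0$, the sequence $\left(z^{-d}P_{2N+d}(z)/P_{2N+d}^{(d)}(0)\right)_{N=1}^\infty$ satisfies the $(r,\beta)$-Condition (with respect to the sequences $(u_N)$ and $(\beta_N)$). Then $$\lim_{N\to\infty}\left[\frac{u_N^2\prod_{k=1}^N x_{k,N,d}^2}{N}\,B_N^*\left(\frac{N}{\beta_N^2}t,\Omega_{N+2,d}\right)\right]=\varTheta_d(t),\qquad t\in[0,\infty).$$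
   Context: Notation: $h_0(z)=\cosh z$, $h_1(z)=\sinh z$. Class $\mathbb{P}_d(\beta,\gamma,\delta)$ ($d\in\{0,1\}$): let $\beta=(\beta_N)_{N\ge1}$ and $\gamma=(\gamma_N)_{N\ge1}$ be increasing sequences of positive numbers and $\delta=(\delta_N)_{N\ge1}$ a decreasing sequence of positive numbers with $\lim\beta_N=\lim\gamma_N=\lim\delta_N^{-1}=\infty$. Let $\Pi_d=(P_{2N+d})_{N=1}^\infty$ be a sequence of even (if $d=0$) or odd (if $d=1$) polynomials with real coefficients, $P_{2N+d}(z)=z^{2N+d}+\ldots$ of degree $2N+d$, having only real zeros, all of multiplicity 1: the zeros are $\pm x_{k,N,d}$, $1\le k\le N$, with $x_{k,N,d}>0$, together with $x_0=0$ if $d=1$. Then $\Pi_d\in\mathbb{P}_d(\beta,\gamma,\delta)$ means that there is a constant $C$ depending only on $\Pi_d$ such that for all $N$ and all $z\in\mathbb{C}$ with $|z|\le\gamma_N$, $$\left|\frac{\beta_N^d P_{2N+d}(z/\beta_N)}{P_{2N+d}^{(d)}(0)}-\cos(z-d\pi/2)\right|\le C\,\delta_N\min(|z|^2,1)\,h_d(|z|).$$ $(r,\beta)$-Condition: let $(u_N)$ be a sequence of positive numbers, $(\beta_N)$ an increasing sequence of positive numbers tending to $\infty$, and $(G_{2N})_{N=1}^\infty$ a sequence of even real polynomials of degree at most $2N$ having $2N$ real zeros of multiplicity 1, with $G_{2N}(0)\ne0$. For a given $r>0$, $(G_{2N})$ satisfies the $(r,\beta)$-Condition if there exist constants $N_0=N_0(r)$,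 $\mu=\mu(r)$ and $C$ (independent of $N$ and $s$) such that for all $s\in\mathbb{C}$ with $\mathrm{Re}\,s=r$, $$\sup_{N\in\mathbb{N},\,N\ge N_0}\beta_N^{r}\left|\int_0^\infty\frac{t^{s-1}}{\left(1+(t/u_N)^2\right)G_{2N}(it)}\,dt\right|\le C\,(1+|\mathrm{Im}\,s|)^\mu e^{-(\pi/2)|\mathrm{Im}\,s|}.$$ $B$-spline of degree $N$ with a set $\Omega\subset\mathbb{R}$ of $N+2$ distinct knots: $B_N(t,\Omega):=(N+1)\sum_{v\in\Omega}\frac{(v-t)_+^N}{W'(v)}$, $t\in\mathbb{R}$, where $W(u)=\prod_{v\in\Omega}(u-v)$ and $x_+=\max(x,0)$. Associated $B$-spline, for $\Omega\subset[0,\infty)$: $B_N^*(t,\Omega):=t^{-N}B_N(t,\Omega)$, with $B_N^*(0,\Omega):=\lim_{t\to0+}B_N^*(t,\Omega)$. Theta-like functions, for $t>0$: $$\varTheta_0(t)=1-\frac4\pi\sum_{k=0}^\infty(-1)^k\frac{\exp\left(-(\pi^2/4)(2k+1)^2t^{-1}\right)}{2k+1},\qquad \varTheta_1(t)=1+2\sum_{k=1}^\infty(-1)^k\exp\left(-(\pi k)^2t^{-1}\right),$$ and $\varTheta_d(0):=\lim_{t\to0+}\varTheta_d(t)=1$. *)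

theory Defs
  imports "HOL-Analysis.Analysis" "HOL-Computational_Algebra.Polynomial"
begin

text \<open>
  All sequences are indexed by \<open>N \<ge> 1\<close>; the value at \<open>N = 0\<close> is never constrained.
  Monotonicity of sequences is understood in the weak sense.
\<close>

abbreviation cpoly :: "real poly \<Rightarrow> complex \<Rightarrow> complex" where
  "cpoly p z \<equiv> poly (map_poly complex_of_real p) z"

definition hyp :: "nat \<Rightarrow> real \<Rightarrow> real" where
  "hyp d x = (if d = 0 then cosh x else sinh x)"

text \<open>\<open>P N\<close> is the polynomial of degree \<open>2N + d\<close> in the sequence.\<close>

definition class_P ::
  "nat \<Rightarrow> (nat \<Rightarrow> real) \<Rightarrow> (nat \<Rightarrow> real) \<Rightarrow> (nat \<Rightarrow> real) \<Rightarrow> (nat \<Rightarrow> real poly) \<Rightarrow> bool" where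
  "class_P d \<beta> \<gamma> \<delta> P \<longleftrightarrow>
     (\<forall>N\<ge>1. \<beta> N > 0 \<and> \<gamma> N > 0 \<and> \<delta> N > 0) \<and>
     mono_on {1..} \<beta> \<and> mono_on {1..} \<gamma> \<and> antimono_on {1..} \<delta> \<and>
     filterlim \<beta> at_top sequentially \<and> filterlim \<gamma> at_top sequentially \<and>
     filterlim (\<lambda>N. inverse (\<delta> N)) at_top sequentially \<and>
     (\<forall>N\<ge>1. degree (P N) = 2 * N + d \<and> lead_coeff (P N) = 1 \<and>
        (\<forall>x. poly (P N) (- x) = (- 1) ^ d * poly (P N) x) \<and>
        (\<forall>z. cpoly (P N) z = 0 \<longrightarrow>
           z \<in> \<real> \<and> order z (map_poly complex_of_real (P N)) = 1)) \<and>
     (\<exists>C. \<forall>N\<ge>1. \<forall>z. cmod z \<le> \<gamma> N \<longrightarrow>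
        cmod (of_real (\<beta> N) ^ d * cpoly (P N) (z / of_real (\<beta> N))
                / of_real (poly ((pderiv ^^ d) (P N)) 0)
              - cos (z - of_real (real d * pi / 2)))
        \<le> C * \<delta> N * min ((cmod z)\<^sup>2) 1 * hyp d (cmod z))"

text \<open>
  \<open>G N\<close> is the polynomial \<open>G\<^bsub>2N\<^esub>\<close>.  The integral converges absolutely iff \<open>r < 2N + 2\<close>;
  since \<open>N0\<close> may be enlarged freely, the finitely many other \<open>N\<close> do not matter.
\<close>

definition rbeta_condition ::
  "real \<Rightarrow> (nat \<Rightarrow> real) \<Rightarrow> (nat \<Rightarrow> real) \<Rightarrow> (nat \<Rightarrow> real poly) \<Rightarrow> bool" where
  "rbeta_condition r \<beta> u G \<longleftrightarrow>
     (\<forall>N\<ge>1. u N > 0) \<and>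
     (\<forall>N\<ge>1. \<beta> N > 0) \<and> mono_on {1..} \<beta> \<and> filterlim \<beta> at_top sequentially \<and>
     (\<forall>N\<ge>1. (\<forall>x. poly (G N) (- x) = poly (G N) x) \<and> degree (G N) \<le> 2 * N \<and>
        card {x. poly (G N) x = 0 \<and> order x (G N) = 1} = 2 * N \<and> poly (G N) 0 \<noteq> 0) \<and>
     (\<exists>N0\<ge>1. \<exists>\<mu> C. \<forall>s. Re s = r \<longrightarrow> (\<forall>N\<ge>N0.
        \<beta> N powr r *
          cmod (LBINT t:{0<..}. of_real t powr (s - 1)
                  / (of_real (1 + (t / u N)\<^sup>2) * cpoly (G N) (\<i> * of_real t)))
        \<le> C * (1 + \<bar>Im s\<bar>) powr \<mu> * exp (- (pi / 2) * \<bar>Im s\<bar>)))"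

definition bspline :: "nat \<Rightarrow> real \<Rightarrow> real set \<Rightarrow> real" where
  "bspline N t \<Omega> = real (N + 1) *
     (\<Sum>v\<in>\<Omega>. (max (v - t) 0) ^ N / deriv (\<lambda>y. \<Prod>w\<in>\<Omega>. y - w) v)"

definition assoc_bspline :: "nat \<Rightarrow> real \<Rightarrow> real set \<Rightarrow> real" where
  "assoc_bspline N t \<Omega> =
     (if t = 0 then Lim (at_right 0) (\<lambda>\<tau>. bspline N \<tau> \<Omega> / \<tau> ^ N)
      else bspline N t \<Omega> / t ^ N)"

definition theta_pos :: "nat \<Rightarrow> real \<Rightarrow> real" where
  "theta_pos d t =
     (if d = 0 then
        1 - 4 / pi * (\<Sum>k. (- 1) ^ k *
          exp (- (pi\<^sup>2 / 4) * (2 * real k + 1)\<^sup>2 * inverse t) / (2 * real k + 1))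
      else
        1 + 2 * (\<Sum>k. (- 1) ^ Suc k * exp (- (pi * real (Suc k))\<^sup>2 * inverse t)))"

definition theta_like :: "nat \<Rightarrow> real \<Rightarrow> real" where
  "theta_like d t = (if t = 0 then Lim (at_right 0) (theta_pos d) else theta_pos d t)"

end

theory Submission
  imports Defs "HOL-Complex_Analysis.Complex_Analysis" "HOL-Probability.Sinc_Integral" "HOL-Real_Asymp.Real_Asymp"
begin

text \<open>
  Rescale the nonzero knots to \<open>\<lambda> = \<beta>\<^sub>N\<^sup>2 v\<close> and let \<open>A\<^sub>\<lambda>\<close> be the coefficients of the partial
  fraction expansion of \<open>1 / \<Prod>(1 + z/\<lambda>)\<close>. By Lagrange interpolation the normalised spline is
  \<open>(N+1)/N (1 - \<Sum> A\<^sub>\<lambda> (1 - \<lambda>/(N t))\<^sub>+\<^sup>N)\<close>. Each \<open>A\<^sub>\<lambda>\<close> and each \<open>\<lambda>\<close> converges because the rescaled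
  polynomials converge to a cosine or sine together with their zeros, so only a bound uniform in \<open>N\<close>
  is missing. The \<open>(r,\<beta>)\<close>-condition is a bound on the Mellin transform of the partial fraction
  expansion, hence says that \<open>\<Sum> A\<^sub>\<lambda> \<lambda>\<^sup>w\<close> has polynomial growth on \<open>Re w = r/2\<close>. Integrating it against
  the Mellin transform of \<open>\<kappa>(x) = x\<^sup>n (1 - x)\<^sub>+\<^sup>k\<close> bounds the finite sums \<open>R\<^sub>N(X) = \<Sum> A\<^sub>\<lambda> \<kappa>(\<lambda>/X)\<close> uniformly
  in \<open>N\<close> and \<open>X\<close>. They converge pointwise, and \<open>\<Sum> A\<^sub>\<lambda> (1 - \<lambda>/(N t))\<^sub>+\<^sup>N\<close> is an integral of \<open>R\<^sub>N\<close> against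
  a positive weight dominated by \<open>exp (- X/(2t))\<close>, so dominated convergence applies.
\<close>

section \<open>Partial fractions and the B-spline\<close>

text \<open>Only cancellation makes the limit possible. Closeness to a cosine or sine, with an error
  growing like \<open>cosh\<close>, locates the zeros in each fixed bounded range but gives no
  uniform bound on the coefficients at far zeros; for \<open>d = 1\<close> even their limits all
  have absolute value 2. The sums over the knots must therefore be bounded as a whole. The
  exponential in the condition is exactly what this needs: writing \<open>y\<close> for the square
  of the variable, the Mellin transform of \<open>1 / (1 + y/v)\<close> at \<open>z = s/2\<close> is
  \<open>v^z pi / sin (pi z)\<close>, and \<open>sin (pi s/2)\<close> grows at most like
  \<open>exp ((pi/2) |Im s|)\<close>. Multiplying by the sine cancels the exponential and leaves
  polynomial growth. Its exponent dictates the smoothness of the kernel: the transform of the kernel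
  has \<open>k + 1\<close> linear factors in its denominator, so \<open>k = p + 1\<close> against
  growth of order \<open>p\<close> leaves two powers for absolute convergence. The power
  \<open>(1 - x)^N\<close> is a kernel that changes with \<open>N\<close>; writing it as an average
  of one fixed kernel keeps the bound independent of \<open>N\<close>.\<close>

definition pf_coeff :: "real set \<Rightarrow> real \<Rightarrow> real" where
  "pf_coeff V v = 1 / (\<Prod>w\<in>V - {v}. 1 - v / w)"

lemma lagrange_interpolation:
  fixes p :: "'a::field poly"
  assumes "finite S" "degree p < card S"
  shows "p = (\<Sum>v\<in>S. smult (poly p v / (\<Prod>w\<in>S - {v}. v - w)) (\<Prod>w\<in>S - {v}. [:- w, 1:]))"
    (is "p = ?q")
proof (rule poly_eqI_degree[of S])
  fix x assume x: "x \<in> S"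
  have "poly ?q x = (\<Sum>v\<in>S. poly p v / (\<Prod>w\<in>S - {v}. v - w) * (\<Prod>w\<in>S - {v}. x - w))"
    by (simp add: poly_sum poly_prod)
  also have "\<dots> = (\<Sum>v\<in>S. if v = x then poly p x else 0)"
  proof (rule sum.cong[OF refl])
    fix v assume v: "v \<in> S"
    show "poly p v / (\<Prod>w\<in>S - {v}. v - w) * (\<Prod>w\<in>S - {v}. x - w) = (if v = x then poly p x else 0)"
      using x v assms by (auto intro!: prod_zero)
  qed
  finally show "poly p x = poly ?q x" using x assms by simp
next
  have "degree ?q \<le> card S - 1"
  proof (rule degree_sum_le[OF assms(1)])
    fix v assume "v \<in> S"
    have "degree (\<Prod>w\<in>S - {v}. [:- w, 1:]) \<le> (\<Sum>w\<in>S - {v}. degree [:- w, 1:])"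
      by (rule degree_prod_sum_le[unfolded o_def]) (use assms in auto)
    also have "\<dots> = card S - 1" using \<open>v \<in> S\<close> assms by simp
    finally show "degree (smult (poly p v / (\<Prod>w\<in>S - {v}. v - w)) (\<Prod>w\<in>S - {v}. [:- w, 1:])) \<le> card S - 1"
      using degree_smult_le le_trans by blast
  qed
  then show "card S > degree ?q" using assms(2) by linarith
qed (use assms in auto)

text \<open>The sum is the divided difference of \<open>p\<close> on \<open>S\<close>, that is, the
  coefficient of order \<open>card S - 1\<close> in the Lagrange form of \<open>p\<close>; it
  vanishes because the degree of \<open>p\<close> is smaller.\<close>

lemma sum_div_node_products_eq_0:
  fixes p :: "'a::field poly"
  assumes "finite S" "Suc (degree p) < card S"
  shows "(\<Sum>v\<in>S. poly p v / (\<Prod>w\<in>S - {v}. v - w)) = 0"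
proof -
  have c: "coeff (\<Prod>w\<in>S - {v}. [:- w, 1:]) (card S - 1) = 1" if "v \<in> S" for v
  proof -
    have "degree (\<Prod>w\<in>S - {v}. [:- w, 1:]) = (\<Sum>w\<in>S - {v}. degree [:- w, 1:])"
      by (rule degree_prod_eq_sum_degree) auto
    also have "\<dots> = card S - 1" using that assms by simp
    finally have "coeff (\<Prod>w\<in>S - {v}. [:- w, 1:]) (card S - 1) = lead_coeff (\<Prod>w\<in>S - {v}. [:- w, 1:])"
      by simp
    then show ?thesis by (simp add: lead_coeff_prod)
  qed
  have "0 = coeff p (card S - 1)" using assms by (intro coeff_eq_0[symmetric]) auto
  also have "p = (\<Sum>v\<in>S. smult (poly p v / (\<Prod>w\<in>S - {v}. v - w)) (\<Prod>w\<in>S - {v}. [:- w, 1:]))"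
    by (rule lagrange_interpolation) (use assms in auto)
  also have "coeff \<dots> (card S - 1) = (\<Sum>v\<in>S. poly p v / (\<Prod>w\<in>S - {v}. v - w))"
    by (simp add: coeff_sum c[unfolded One_nat_def])
  finally show ?thesis by simp
qed

text \<open>Lagrange interpolation of \<open>x^m\<close> on the nodes \<open>V\<close>, evaluated at
  \<open>-y\<close> and divided by the product. It is exact because \<open>m < card V\<close>; the
  case \<open>m = 0\<close> is the plain partial fraction expansion.\<close>

lemma partial_fraction_power:
  fixes y :: real
  assumes "finite V" "m < card V" "\<And>v. v \<in> V \<Longrightarrow> v > 0" "y \<ge> 0"
  shows "y ^ m / (\<Prod>v\<in>V. 1 + y / v) = (\<Sum>v\<in>V. pf_coeff V v * (- v) ^ m / (1 + y / v))"
proof -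
  have pos: "v > 0" "1 + y / v > 0" "-y - v \<noteq> 0" if "v \<in> V" for v
    using assms(3)[OF that] assms(4) by (auto simp: field_simps add_nonneg_pos add_pos_nonneg)
  have "poly (monom 1 m) (- y)
      = (\<Sum>v\<in>V. v ^ m / (\<Prod>w\<in>V - {v}. v - w) * (\<Prod>w\<in>V - {v}. - w - y))"
    by (subst lagrange_interpolation[of V "monom 1 m"])
       (use assms in \<open>simp_all add: degree_monom_eq poly_sum poly_prod poly_monom\<close>)
  then have "(-1) ^ m * (-y) ^ m / (\<Prod>v\<in>V. 1 + y / v) 
      = (-1) ^ m * (\<Sum>v\<in>V. v ^ m / (\<Prod>w\<in>V - {v}. v - w) * (\<Prod>w\<in>V - {v}. - w - y)) / (\<Prod>v\<in>V. 1 + y / v)"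
    by (simp add: poly_monom)
  also have "\<dots> = (\<Sum>v\<in>V. pf_coeff V v * (- v) ^ m / (1 + y / v))"
    unfolding sum_distrib_left sum_divide_distrib
  proof (rule sum.cong[OF refl])
    fix v assume v: "v \<in> V"
    have "(\<Prod>w\<in>V - {v}. - w - y) / (\<Prod>w\<in>V - {v}. v - w)
       = (\<Prod>w\<in>V - {v}. (1 + y / w) / (1 - v / w))"
      unfolding prod_dividef[symmetric]
    proof (rule prod.cong[OF refl])
      fix w assume "w \<in> V - {v}"
      then have "w > 0" "v \<noteq> w" using pos by auto
      then show "(- w - y) / (v - w) = (1 + y / w) / (1 - v / w)" by (simp add: field_simps)
    qed
    also have "\<dots> = (\<Prod>w\<in>V - {v}. 1 + y / w) * pf_coeff V v"
      by (simp add: pf_coeff_def prod_dividef)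
    finally have 1: "(\<Prod>w\<in>V - {v}. - w - y) / (\<Prod>w\<in>V - {v}. v - w) = (\<Prod>w\<in>V - {v}. 1 + y / w) * pf_coeff V v" .
    have 2: "(\<Prod>w\<in>V. 1 + y / w) = (1 + y / v) * (\<Prod>w\<in>V - {v}. 1 + y / w)"
      using v assms by (simp add: prod.remove)
    have 3: "(\<Prod>w\<in>V - {v}. 1 + y / w) \<noteq> 0"
      using pos assms(1) by force
    have "(- 1) ^ m * (v ^ m / (\<Prod>w\<in>V - {v}. v - w) * (\<Prod>w\<in>V - {v}. - w - y)) / (\<Prod>v\<in>V. 1 + y / v)
       = (-v) ^ m * ((\<Prod>w\<in>V - {v}. - w - y) / (\<Prod>w\<in>V - {v}. v - w)) / (\<Prod>v\<in>V. 1 + y / v)"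
      by (simp add: power_minus[of v])
    also have "\<dots> = pf_coeff V v * (- v) ^ m / (1 + y / v)"
      unfolding 1 2 using 3 by simp
    finally show "(- 1) ^ m * (v ^ m / (\<Prod>w\<in>V - {v}. v - w) * (\<Prod>w\<in>V - {v}. - w - y)) / (\<Prod>v\<in>V. 1 + y / v)
       = pf_coeff V v * (- v) ^ m / (1 + y / v)" .
  qed
  also have "(-1) ^ m * (-y) ^ m = y ^ m" by (simp flip: power_mult_distrib)
  finally show ?thesis .
qed

lemma deriv_prod_linear:
  fixes v :: real
  assumes "finite S" "v \<in> S"
  shows "deriv (\<lambda>y. \<Prod>w\<in>S. y - w) v = (\<Prod>w\<in>S - {v}. v - w)"
proof (rule DERIV_imp_deriv)
  have "(\<lambda>y. \<Prod>w\<in>S. y - w) = (\<lambda>y. (y - v) * (\<Prod>w\<in>S - {v}. y - w))"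
    using assms by (simp add: prod.remove)
  moreover have "((\<lambda>y. (y - v) * poly (\<Prod>w\<in>S - {v}. [:- w, 1:]) y) has_field_derivative
      poly (\<Prod>w\<in>S - {v}. [:- w, 1:]) v) (at v)"
    by (rule derivative_eq_intros poly_DERIV refl)+ simp
  then have "((\<lambda>y. (y - v) * (\<Prod>w\<in>S - {v}. y - w)) has_field_derivative (\<Prod>w\<in>S - {v}. v - w)) (at v)"
    by (simp add: poly_prod)
  ultimately show "((\<lambda>y. \<Prod>w\<in>S. y - w) has_field_derivative (\<Prod>w\<in>S - {v}. v - w)) (at v)" by simp
qed

text \<open>The spline is a divided difference of \<open>(v - s)_+^N\<close>. Exchanging it for
  \<open>(s - v)_+^N\<close> leaves only knots below \<open>s\<close>; the knot 0 then supplies the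
  leading 1 and the others the partial fraction coefficients.\<close>

lemma bspline_eq_pf_sum:
  fixes s :: real
  assumes "finite V" "card V = Suc N" "\<And>v. v \<in> V \<Longrightarrow> v > 0" "s > 0" "N \<ge> 1"
  shows "(\<Prod>V) * (bspline N s (insert 0 V) / s ^ N)
    = real (N + 1) * (1 - (\<Sum>v\<in>V. pf_coeff V v * max (1 - v / s) 0 ^ N))"
proof -
  define S where "S = insert 0 V"
  define D where "D v = (\<Prod>w\<in>S - {v}. v - w)" for v
  have 0: "0 \<notin> V" using assms(3) by force
  have S: "finite S" "card S = N + 2" using assms 0 by (auto simp: S_def)
  have D: "D v \<noteq> 0" for v using S by (auto simp: D_def)
  have D0: "D 0 = (-1) ^ Suc N * \<Prod>V"
  proof -
    have "S - {0} = V" using 0 by (auto simp: S_def)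
    then have "D 0 = (\<Prod>w\<in>V. (-1) * w)" by (simp add: D_def)
    also have "\<dots> = (-1) ^ Suc N * \<Prod>V" by (simp only: prod.distrib prod_constant assms)
    finally show ?thesis .
  qed
  \<comment> \<open>Dividing by the weight of the knot 0 normalises that knot to 1. The factor
    \<open>v\<close> that the knot 0 contributes to \<open>D v\<close> cancels the factor for the
    knot \<open>v\<close> in \<open>D 0\<close>.\<close>
  have pf: "D 0 / D v = - pf_coeff V v" if v: "v \<in> V" for v
  proof -
    have "S - {v} = insert 0 (V - {v})" "0 \<notin> V - {v}" using v assms(3)[of v] 0 by (auto simp: S_def)
    then have "D v = v * (\<Prod>w\<in>V - {v}. v - w)" using assms by (simp add: D_def)
    moreover have "D 0 = - v * (\<Prod>w\<in>V - {v}. - w)"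
    proof -
      have "S - {0} = V" using 0 by (auto simp: S_def)
      then show ?thesis using v assms by (simp add: D_def prod.remove)
    qed
    ultimately have "D 0 / D v = - ((\<Prod>w\<in>V - {v}. - w) / (\<Prod>w\<in>V - {v}. v - w))"
      using assms(3)[OF v] by simp
    also have "(\<Prod>w\<in>V - {v}. - w) / (\<Prod>w\<in>V - {v}. v - w) = (\<Prod>w\<in>V - {v}. 1 / (1 - v / w))"
      unfolding prod_dividef[symmetric]
    proof (rule prod.cong[OF refl])
      fix w assume "w \<in> V - {v}"
      then have "w > 0" "v \<noteq> w" using assms(3) by auto
      then show "- w / (v - w) = 1 / (1 - v / w)" by (simp add: field_simps)
    qed
    also have "\<dots> = pf_coeff V v" by (simp add: pf_coeff_def prod_dividef)
    finally show ?thesis .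
  qed
  \<comment> \<open>There are \<open>N + 2\<close> nodes and the polynomial \<open>(s - v)^N\<close>
    has degree only \<open>N\<close>, so its divided difference vanishes.\<close>
  have "(\<Sum>v\<in>S. poly ([:s, -1:] ^ N) v / D v) = 0"
    unfolding D_def by (rule sum_div_node_products_eq_0) (use S in \<open>simp_all add: degree_power_eq\<close>)
  then have "0 = (\<Sum>v\<in>S. (s - v) ^ N / D v)" by simp
  also have "\<dots> = (\<Sum>v\<in>S. max (s - v) 0 ^ N / D v + (-1) ^ N * (max (v - s) 0 ^ N / D v))"
  proof (rule sum.cong[OF refl])
    fix v
    \<comment> \<open>For \<open>N = 0\<close> this split would fail, because
      \<open>0 ^ 0 = 1\<close> would count both truncated parts.\<close>
    have "(s - v) ^ N = max (s - v) 0 ^ N + (-1) ^ N * max (v - s) 0 ^ N"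
      using assms(5) by (cases "v \<le> s") (auto simp: max_def simp flip: power_mult_distrib)
    then show "(s - v) ^ N / D v = max (s - v) 0 ^ N / D v + (-1) ^ N * (max (v - s) 0 ^ N / D v)"
      by (simp add: add_divide_distrib)
  qed
  finally have "0 = (\<Sum>v\<in>S. max (s - v) 0 ^ N / D v) + (-1) ^ N * (\<Sum>v\<in>S. max (v - s) 0 ^ N / D v)"
    by (simp only: sum.distrib sum_distrib_left)
  then have *: "(\<Sum>v\<in>S. max (v - s) 0 ^ N / D v) = (-1) ^ Suc N * (\<Sum>v\<in>S. max (s - v) 0 ^ N / D v)"
    by (cases "even N") auto
  have "bspline N s S = real (N + 1) * (\<Sum>v\<in>S. max (v - s) 0 ^ N / D v)"
    unfolding bspline_def by (simp add: deriv_prod_linear[OF S(1)] D_def)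
  then have "(\<Prod>V) * (bspline N s S / s ^ N)
     = real (N + 1) * (\<Sum>v\<in>S. (D 0 / D v) * (max (s - v) 0 ^ N / s ^ N))"
    unfolding * D0 by (simp add: sum_distrib_left sum_divide_distrib mult_ac)
  also have "(\<Sum>v\<in>S. (D 0 / D v) * (max (s - v) 0 ^ N / s ^ N))
      = (\<Sum>v\<in>S. (D 0 / D v) * max (1 - v / s) 0 ^ N)"
  proof (rule sum.cong[OF refl])
    fix v
    have "max (s - v) 0 / s = max (1 - v / s) 0" using assms(4) by (auto simp: max_def field_simps)
    then show "(D 0 / D v) * (max (s - v) 0 ^ N / s ^ N) = (D 0 / D v) * max (1 - v / s) 0 ^ N"
      by (metis power_divide)
  qed
  also have "\<dots> = 1 + (\<Sum>v\<in>V. (D 0 / D v) * max (1 - v / s) 0 ^ N)"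
    using 0 assms D[of 0] by (simp add: S_def)
  also have "\<dots> = 1 - (\<Sum>v\<in>V. pf_coeff V v * max (1 - v / s) 0 ^ N)"
    using pf by (simp add: sum_negf)
  finally show ?thesis by (simp add: S_def)
qed

text \<open>For \<open>s\<close> below the smallest positive knot every truncated power vanishes, so
  the quotient is constant near 0 and its limit is that constant.\<close>

lemma assoc_bspline_0:
  assumes "finite V" "card V = Suc N" "\<And>v. v \<in> V \<Longrightarrow> v > 0" "N \<ge> 1"
  shows "(\<Prod>V) * assoc_bspline N 0 (insert 0 V) = real (N + 1)"
proof -
  define c where "c = Min V"
  have V: "V \<noteq> {}" using assms by auto
  have c: "c > 0" "\<And>v. v \<in> V \<Longrightarrow> c \<le> v" using assms V by (auto simp: c_def)
  have P: "\<Prod>V > 0" using assms by (simp add: prod_pos)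
  have "eventually (\<lambda>s. s \<in> {0<..<c}) (at_right 0)"
    by (rule eventually_at_right_real[OF c(1)])
  then have "eventually (\<lambda>s. bspline N s (insert 0 V) / s ^ N = real (N + 1) / \<Prod>V) (at_right 0)"
  proof eventually_elim
    case (elim s)
    have "(\<Prod>V) * (bspline N s (insert 0 V) / s ^ N)
       = real (N + 1) * (1 - (\<Sum>v\<in>V. pf_coeff V v * max (1 - v / s) 0 ^ N))"
      by (rule bspline_eq_pf_sum) (use assms elim in auto)
    also have "(\<Sum>v\<in>V. pf_coeff V v * max (1 - v / s) 0 ^ N) = 0"
    proof (rule sum.neutral, rule ballI)
      fix v assume "v \<in> V"
      then have "v / s \<ge> 1" using c(2)[of v] elim by (simp add: field_simps)
      then show "pf_coeff V v * max (1 - v / s) 0 ^ N = 0" using assms by (simp add: max_def)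
    qed
    finally show ?case using P by (simp add: field_simps)
  qed
  then have "((\<lambda>s. bspline N s (insert 0 V) / s ^ N) \<longlongrightarrow> real (N + 1) / \<Prod>V) (at_right 0)"
    by (rule tendsto_eventually)
  then have "Lim (at_right 0) (\<lambda>s. bspline N s (insert 0 V) / s ^ N) = real (N + 1) / \<Prod>V"
    by (intro tendsto_Lim) auto
  then show ?thesis using P by (simp add: assoc_bspline_def)
qed

section \<open>Mellin inversion for a truncated power\<close>

text \<open>A weak form of Jordan's inequality, from \<open>sin x = 2 sin (x/2) cos (x/2)\<close>,
  \<open>x/2 \<le> tan (x/2)\<close> and \<open>cos (x/2) ^ 2 \<ge> 1/2\<close>.\<close>

lemma sin_ge_half:
  fixes x :: real
  assumes "0 \<le> x" "x \<le> pi / 2"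
  shows "x / 2 \<le> sin x"
proof -
  have c: "cos (x / 2) > 0" by (intro cos_gt_zero_pi; use assms pi_gt_zero in linarith)
  moreover have "sin (x / 2) \<ge> 0" using assms by (intro sin_ge_zero) auto
  ultimately have "tan (x / 2) \<ge> 0" by (simp add: tan_def)
  then have "x / 2 \<le> tan (x / 2)"
    using arctan_le_self[of "tan (x / 2)"] assms pi_gt_zero
    by (simp add: arctan_tan)
  moreover note c
  ultimately have s: "x / 2 * cos (x / 2) \<le> sin (x / 2)" by (simp add: tan_def field_simps)
  have "cos x \<ge> 0" using assms by (intro cos_ge_zero) auto
  then have "1 / 2 \<le> cos (x / 2) ^ 2" using cos_double_cos[of "x / 2"] by simp
  then have "x * (1 / 2) \<le> x * cos (x / 2) ^ 2" using assms by (intro mult_left_mono) auto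
  also have "\<dots> = 2 * (x / 2 * cos (x / 2)) * cos (x / 2)" by (simp add: power2_eq_square)
  also have "\<dots> \<le> 2 * sin (x / 2) * cos (x / 2)"
    using s c by (intro mult_right_mono) auto
  also have "\<dots> = sin x" using sin_double[of "x / 2"] by simp
  finally show ?thesis by simp
qed

text \<open>The left side is, up to sign, the \<open>k\<close>-th finite difference of
  \<open>1/z\<close>. By Pascal's rule the sum for \<open>k + 1\<close> at \<open>z\<close> is the
  sum for \<open>k\<close> at \<open>z\<close> minus the one at \<open>z + 1\<close>, which drives
  the induction.\<close>

lemma partial_fractions_binomial:
  fixes z :: "'a::field_char_0"
  assumes "\<And>j. j \<le> k \<Longrightarrow> z + of_nat j \<noteq> 0"
  shows "(\<Sum>j\<le>k. (- 1) ^ j * of_nat (k choose j) / (z + of_nat j)) = fact k / (\<Prod>j\<le>k. z + of_nat j)"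
  using assms
proof (induction k arbitrary: z)
  case (Suc k)
  define p where "p z = (\<Prod>j\<le>k. z + of_nat j)" for z :: 'a
  have p1: "(\<Prod>j\<le>Suc k. z + of_nat j) = z * p (z + 1)"
    unfolding prod.atMost_Suc_shift p_def by (simp add: add_ac)
  have p2: "(\<Prod>j\<le>Suc k. z + of_nat j) = p z * (z + of_nat (Suc k))"
    by (simp add: p_def)
  have nz: "(\<Prod>j\<le>Suc k. z + of_nat j) \<noteq> 0" using Suc.prems by (simp only: prod_zero_iff finite_atMost) auto
  have "(\<Sum>j\<le>Suc k. (- 1) ^ j * of_nat (Suc k choose j) / (z + of_nat j))
     = 1 / z - (\<Sum>j\<le>k. (- 1) ^ j * of_nat (Suc k choose Suc j) / (z + 1 + of_nat j))"
    unfolding sum.atMost_Suc_shift by (simp add: sum_negf add_ac)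
  also have "\<dots> = (1 / z - (\<Sum>j\<le>k. (- 1) ^ j * of_nat (k choose Suc j) / (z + of_nat (Suc j))))
       - (\<Sum>j\<le>k. (- 1) ^ j * of_nat (k choose j) / (z + 1 + of_nat j))"
    by (simp add: sum.distrib[symmetric] algebra_simps add_divide_distrib flip: sum_negf sum_subtractf)
  also have "1 / z - (\<Sum>j\<le>k. (- 1) ^ j * of_nat (k choose Suc j) / (z + of_nat (Suc j)))
      = (\<Sum>j\<le>Suc k. (- 1) ^ j * of_nat (k choose j) / (z + of_nat j))"
    unfolding sum.atMost_Suc_shift by (simp add: sum_negf)
  also have "\<dots> = (\<Sum>j\<le>k. (- 1) ^ j * of_nat (k choose j) / (z + of_nat j))" by simp
  also have "\<dots> = fact k / p z" unfolding p_def by (rule Suc.IH) (use Suc.prems in auto)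
  also have "(\<Sum>j\<le>k. (- 1) ^ j * of_nat (k choose j) / (z + 1 + of_nat j)) = fact k / p (z + 1)"
    unfolding p_def
  proof (rule Suc.IH)
    fix j assume "j \<le> k"
    then show "z + 1 + of_nat j \<noteq> 0" using Suc.prems[of "Suc j"] by (simp add: add_ac)
  qed
  also have "fact k / p z - fact k / p (z + 1) = fact k * (z + of_nat (Suc k)) / (\<Prod>j\<le>Suc k. z + of_nat j)
       - fact k * z / (\<Prod>j\<le>Suc k. z + of_nat j)"
    using nz p1 p2 by (metis mult_divide_mult_cancel_right mult_divide_mult_cancel_left mult.commute mult_eq_0_iff)
  also have "\<dots> = fact (Suc k) / (\<Prod>j\<le>Suc k. z + of_nat j)"
    by (simp add: algebra_simps flip: diff_divide_distrib)
  finally show ?case .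
qed simp

text \<open>
  The Mellin transform of the kernel has its poles at \<open>n, \<dots>, n + k\<close>. The factor \<open>x\<^sup>n\<close> pushes them to the
  right of the line \<open>Re w = a\<close> of the inversion integral, so that no residues have to be removed
  and \<open>a\<close> may be an integer.
\<close>

definition kernel :: "nat \<Rightarrow> nat \<Rightarrow> real \<Rightarrow> real" where
  "kernel n k x = x ^ n * max (1 - x) 0 ^ k"

text \<open>For \<open>Re w < n\<close>, \<open>fact k / kernel_den n k w\<close> is the Beta
  integral of \<open>x^(n - w - 1) (1 - x)^k\<close> over the unit interval, so it is the Mellin
  transform of \<open>kernel n k\<close> at \<open>-w\<close>.\<close>

definition kernel_den :: "nat \<Rightarrow> nat \<Rightarrow> complex \<Rightarrow> complex" where
  "kernel_den n k w = (\<Prod>j\<le>k. of_nat n + of_nat j - w)"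

lemma integrable_1_plus_abs_power:
  "integrable lborel (\<lambda>t::real. 1 / (1 + \<bar>t\<bar>) ^ 2)"
proof (rule Bochner_Integration.integrable_bound)
  show "integrable lborel (\<lambda>t::real. inverse (1 + t ^ 2))"
    using integrable_inverse_1_plus_square by (simp add: set_integrable_def)
  show "AE x in lborel. norm (1 / (1 + \<bar>x\<bar>) ^ 2) \<le> norm (inverse (1 + x ^ 2 :: real))"
  proof (intro AE_I2)
    fix x :: real
    have "1 + x ^ 2 \<le> (1 + \<bar>x\<bar>) ^ 2" by (simp add: power2_sum)
    moreover have "0 < 1 + x ^ 2" by (simp add: add_pos_nonneg)
    ultimately show "norm (1 / (1 + \<bar>x\<bar>) ^ 2) \<le> norm (inverse (1 + x ^ 2 :: real))"
      by (simp add: divide_simps)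
  qed
qed simp

text \<open>
  The circle of radius \<open>\<bar>r\<bar>\<close> tangent at \<open>a\<close> to the line \<open>Re w = a\<close>, on its right if \<open>r > 0\<close> and on its left
  if \<open>r < 0\<close>, parametrised by arc length; it tends to the line as \<open>\<bar>r\<bar> \<rightarrow> \<infinity>\<close>. Integrals over the line are
  limits of integrals over these circles, which Cauchy's formula evaluates exactly; \<open>\<bar>x\<^sup>w\<bar>\<close> stays
  bounded on the right circles if \<open>x \<le> 1\<close> and on the left ones if \<open>x \<ge> 1\<close>.
\<close>

definition tcircle :: "real \<Rightarrow> real \<Rightarrow> real \<Rightarrow> complex" where
  "tcircle a r s = of_real a + of_real r * (1 - exp (- \<i> * of_real (s / r)))"

text \<open>The factor \<open>exp (- i s / r)\<close> is the derivative of \<open>tcircle\<close>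
  divided by the imaginary unit. For \<open>r > 0\<close> the arc runs clockwise, opposite to
  \<open>circlepath\<close>, so that it passes upwards through the point of tangency; this is the
  origin of \<open>sgn r\<close>.\<close>

lemma tcircle_has_integral:
  assumes "r \<noteq> 0" "(f has_contour_integral I) (circlepath (of_real (a + r)) r)"
  shows "((\<lambda>s. f (tcircle a r s) * exp (- \<i> * of_real (s / r))) has_integral \<i> * of_real (sgn r) * I)
           {- (pi * \<bar>r\<bar>)..pi * \<bar>r\<bar>}"
proof -
  define g where "g = circlepath (of_real (a + r)) r"
  \<comment> \<open>The point \<open>a\<close> lies opposite the start of \<open>circlepath\<close>,
    at parameter 1/2; the affine map \<open>m s + 1/2\<close> sends \<open>s = 0\<close>
    there.\<close>
  define m where "m = - 1 / (2 * pi * r)"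
  have m: "m \<noteq> 0" using assms by (simp add: m_def)
  have "((\<lambda>t. f (g t) * (2 * pi * \<i> * r * exp (2 * of_real pi * \<i> * t))) has_integral I) (cbox 0 1)"
    using assms(2) unfolding has_contour_integral g_def cbox_interval
    by (rule has_integral_eq[rotated]) (simp add: vector_derivative_circlepath)
  from has_integral_affinity[OF this m, of "1 / 2"]
  have "((\<lambda>s. f (g (m * s + 1 / 2)) * (2 * pi * \<i> * r * exp (2 * of_real pi * \<i> * of_real (m * s + 1 / 2))))
      has_integral (1 / \<bar>m\<bar>) *\<^sub>R I) ((\<lambda>x. (1 / m) *\<^sub>R x + - ((1 / m) *\<^sub>R (1 / 2))) ` cbox 0 1)"
    by simp
  also have "(\<lambda>x. (1 / m) *\<^sub>R x + - ((1 / m) *\<^sub>R (1 / 2))) ` cbox 0 1 = {- (pi * \<bar>r\<bar>)..pi * \<bar>r\<bar>}"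
  proof -
    have m': "1 / m = - (2 * pi * r)" using assms(1) by (simp add: m_def)
    have "(\<lambda>x. (1 / m) *\<^sub>R x + - ((1 / m) *\<^sub>R (1 / 2))) = (\<lambda>x. - (2 * pi * r) * x + pi * r)"
      unfolding m' by auto
    then show ?thesis
      using assms(1) by (simp only: cbox_interval image_affinity_atLeastAtMost) (auto simp: abs_if mult_le_0_iff not_le zero_le_mult_iff pi_gt_zero)
  qed
  also have "(\<lambda>s. f (g (m * s + 1 / 2)) * (2 * pi * \<i> * r * exp (2 * of_real pi * \<i> * of_real (m * s + 1 / 2))))
     = (\<lambda>s. (- (2 * pi * \<i> * r)) * (f (tcircle a r s) * exp (- \<i> * of_real (s / r))))"
  proof
    fix s
    have e: "exp (2 * of_real pi * \<i> * of_real (m * s + 1 / 2)) = - exp (- \<i> * of_real (s / r))"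
    proof -
      have "2 * of_real pi * \<i> * of_real (m * s + 1 / 2) = - \<i> * of_real (s / r) + \<i> * of_real pi"
        using assms(1) by (simp add: m_def field_simps)
      then show ?thesis by (simp only: exp_add) simp
    qed
    have "g (m * s + 1 / 2) = tcircle a r s"
      unfolding g_def circlepath using e by (simp add: tcircle_def algebra_simps)
    then show "f (g (m * s + 1 / 2)) * (2 * pi * \<i> * r * exp (2 * of_real pi * \<i> * of_real (m * s + 1 / 2)))
     = (- (2 * pi * \<i> * r)) * (f (tcircle a r s) * exp (- \<i> * of_real (s / r)))"
      by (simp only: e) (simp add: algebra_simps)
  qed
  finally have "((\<lambda>s. 1 / (- (2 * pi * \<i> * r)) * ((- (2 * pi * \<i> * r)) * (f (tcircle a r s) * exp (- \<i> * of_real (s / r)))))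
      has_integral 1 / (- (2 * pi * \<i> * r)) * ((1 / \<bar>m\<bar>) *\<^sub>R I)) {- (pi * \<bar>r\<bar>)..pi * \<bar>r\<bar>}"
    by (intro has_integral_mult_right)
  moreover have "1 / (- (2 * pi * \<i> * r)) * ((1 / \<bar>m\<bar>) *\<^sub>R I) = \<i> * of_real (sgn r) * I"
    using assms(1) by (cases "r > 0") (auto simp: m_def scaleR_conv_of_real field_simps sgn_if abs_mult)
  ultimately show ?thesis using assms(1) by simp
qed

lemma Re_tcircle: "Re (tcircle a r s) = a + r * (1 - cos (s / r))"
  by (simp add: tcircle_def Re_exp)

text \<open>The chord from the point of tangency has length
  \<open>2 |r| sin (|s| / (2 |r|))\<close>, and \<open>sin_ge_half\<close> bounds it below by half
  the arc length.\<close>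

lemma cmod_tcircle_ge:
  assumes "\<bar>s\<bar> \<le> pi * \<bar>r\<bar>" "r \<noteq> 0"
  shows "\<bar>s\<bar> / 2 \<le> cmod (tcircle a r s - of_real a)"
proof -
  have "exp (- \<i> * of_real (s / r)) = exp (\<i> * of_real (- (s / r)))" by simp
  then have "cmod (1 - exp (- \<i> * of_real (s / r))) = 2 * \<bar>sin (- (s / r) / 2)\<bar>"
    using dist_exp_i_1[of "- (s / r)"] by (simp only: norm_minus_commute)
  moreover have "\<bar>sin (- (s / r) / 2)\<bar> = sin (\<bar>s\<bar> / \<bar>r\<bar> / 2)"
  proof -
    define t where "t = \<bar>s\<bar> / \<bar>r\<bar>"
    have "0 \<le> t" "t \<le> pi" using assms by (auto simp: t_def field_simps)
    then have "sin (t / 2) \<ge> 0" by (intro sin_ge_zero) auto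
    then have "sin (\<bar>s\<bar> / \<bar>r\<bar> / 2) \<ge> 0" by (simp add: t_def)
    then show ?thesis by (auto simp: abs_if split: if_splits)
  qed
  moreover have "\<bar>s\<bar> / \<bar>r\<bar> / 2 / 2 \<le> sin (\<bar>s\<bar> / \<bar>r\<bar> / 2)"
    using assms by (intro sin_ge_half) (auto simp: field_simps)
  ultimately have "\<bar>r\<bar> * (2 * (\<bar>s\<bar> / \<bar>r\<bar> / 2 / 2)) \<le> \<bar>r\<bar> * cmod (1 - exp (- \<i> * of_real (s / r)))"
    by (intro mult_left_mono) auto
  then show ?thesis using assms by (simp add: tcircle_def norm_mult)
qed

text \<open>With \<open>h = - i s / r\<close> the displacement from \<open>a\<close> is
  \<open>i s (exp h - 1) / h\<close>, so the limit is the derivative of \<open>exp\<close> at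
  0.\<close>

lemma tcircle_tendsto:
  assumes "filterlim (\<lambda>m. r m) at_infinity F"
  shows "((\<lambda>m. tcircle a (r m) s) \<longlongrightarrow> of_real a + \<i> * of_real s) F"
proof (cases "s = 0")
  case True
  then show ?thesis by (simp add: tcircle_def)
next
  case False
  define h where "h m = - \<i> * of_real (s / r m)" for m
  have nz: "eventually (\<lambda>m. r m \<noteq> 0) F"
    using assms by (rule filterlim_at_infinity_imp_eventually_ne)
  have "((\<lambda>m. s / r m) \<longlongrightarrow> 0) F"
    by (rule tendsto_divide_0[OF tendsto_const assms])
  then have "((\<lambda>m. - \<i> * of_real (s / r m)) \<longlongrightarrow> - \<i> * of_real 0) F"
    by (intro tendsto_intros)
  then have "(h \<longlongrightarrow> 0) F" by (simp add: h_def[abs_def])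
  then have "filterlim h (at 0) F"
    using nz by (intro filterlim_atI) (auto simp: h_def False elim: eventually_mono)
  moreover have "((\<lambda>z. (exp z - 1) / z) \<longlongrightarrow> 1) (at (0::complex))"
    using DERIV_exp[of "0::complex"] by (simp add: DERIV_def)
  ultimately have "((\<lambda>m. (exp (h m) - 1) / h m) \<longlongrightarrow> 1) F"
    by (rule filterlim_compose[rotated])
  then have "((\<lambda>m. of_real a + \<i> * of_real s * ((exp (h m) - 1) / h m)) \<longlongrightarrow> of_real a + \<i> * of_real s * 1) F"
    by (intro tendsto_intros)
  then show ?thesis
  proof (rule Lim_transform_eventually[THEN tendsto_eq_rhs])
    show "eventually (\<lambda>m. of_real a + \<i> * of_real s * ((exp (h m) - 1) / h m) = tcircle a (r m) s) F"
      using nz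
    proof eventually_elim
      case (elim m)
      have "\<i> * of_real s / h m = - of_real (r m)" using False elim by (simp add: h_def field_simps)
      then have "\<i> * of_real s * ((exp (h m) - 1) / h m) = of_real (r m) * (1 - exp (h m))"
        by (metis (no_types, opaque_lifting) minus_diff_eq mult_minus_left mult_minus_right times_divide_eq_left times_divide_eq_right)
      then show ?case by (simp add: tcircle_def h_def)
    qed
  qed simp
qed

lemma kernel_den_nonzero:
  assumes "Re w < real n"
  shows "kernel_den n k w \<noteq> 0"
proof -
  have "of_nat n + of_nat j - w \<noteq> 0" for j using assms by (auto simp: complex_eq_iff)
  then show ?thesis by (simp add: kernel_den_def)
qed

lemma kernel_den_lower_bound:
  assumes "L \<ge> 0" "\<And>j. j \<le> k \<Longrightarrow> L \<le> cmod (of_nat n + of_nat j - w)"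
  shows "L ^ Suc k \<le> cmod (kernel_den n k w)"
proof -
  have "(\<Prod>j\<le>k. L) \<le> (\<Prod>j\<le>k. cmod (of_nat n + of_nat j - w))"
    using assms by (intro prod_mono) auto
  then show ?thesis by (simp add: kernel_den_def prod_norm)
qed

text \<open>A lower bound that does not depend on \<open>r\<close>, as required for dominated
  convergence. A pole \<open>b\<close> has distance at least 1 from the circle: for
  \<open>r > 0\<close> it lies inside, between \<open>a\<close> and the centre, because
  \<open>b - a \<le> B \<le> r\<close>; for \<open>r < 0\<close> it lies to the right of the
  circle.\<close>

lemma kernel_den_tcircle:
  assumes "a + 1 \<le> real n" "B = real n + real k - a" "B \<le> \<bar>r\<bar>" "\<bar>s\<bar> \<le> pi * \<bar>r\<bar>"
  shows "((1 + \<bar>s\<bar>) / (2 * (2 + B))) ^ Suc k \<le> cmod (kernel_den n k (tcircle a r s))"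
proof (rule kernel_den_lower_bound)
  have B: "B \<ge> 1" using assms by simp
  then show "0 \<le> (1 + \<bar>s\<bar>) / (2 * (2 + B))" by simp
  fix j assume j: "j \<le> k"
  define b where "b = real n + real j"
  have b: "1 \<le> b - a" "b - a \<le> B" using assms j by (auto simp: b_def)
  define w where "w = tcircle a r s"
  have r0: "r \<noteq> 0" using assms B by auto
  have 1: "1 \<le> cmod (of_real b - w)"
  proof (cases "r > 0")
    case True
    have "r = cmod (w - of_real (a + r))"
      using True by (simp add: w_def tcircle_def algebra_simps norm_mult)
    also have "\<dots> = cmod ((w - of_real b) + of_real (b - a - r))" by (simp add: algebra_simps)
    also have "\<dots> \<le> cmod (w - of_real b) + cmod (of_real (b - a - r))" by (rule norm_triangle_ineq)
    also have "cmod (of_real (b - a - r)) = r - (b - a)"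
      unfolding norm_of_real using b assms True by auto
    finally show ?thesis using b by (simp add: norm_minus_commute)
  next
    case False
    then have "r * (1 - cos (s / r)) \<le> 0" by (intro mult_nonpos_nonneg) auto
    then have "1 \<le> Re (of_real b - w)" using b by (simp add: w_def Re_tcircle)
    then show ?thesis using complex_Re_le_cmod order_trans by blast
  qed
  have "\<bar>s\<bar> / 2 \<le> cmod (w - of_real a)"
    unfolding w_def by (rule cmod_tcircle_ge) (use assms r0 in auto)
  also have "w - of_real a = of_real (b - a) - (of_real b - w)" by simp
  also have "cmod \<dots> \<le> cmod (of_real (b - a)) + cmod (of_real b - w)" by (rule norm_triangle_ineq4)
  also have "cmod (of_real (b - a)) \<le> B" unfolding norm_of_real using b by auto
  finally have 2: "\<bar>s\<bar> / 2 - B \<le> cmod (of_real b - w)" by simp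
  \<comment> \<open>The bound 1 is used near the pole and \<open>|s|/2 - B\<close> far from it; the
    weight \<open>1 + B\<close> on the first turns their sum into \<open>1 + |s|/2\<close>.\<close>
  have "(1 + B) * 1 + (\<bar>s\<bar> / 2 - B) \<le> (1 + B) * cmod (of_real b - w) + cmod (of_real b - w)"
    using 1 2 B by (intro add_mono mult_left_mono) auto
  then have "(1 + \<bar>s\<bar>) \<le> cmod (of_real b - w) * (2 * (2 + B))" by (simp add: algebra_simps)
  then have "(1 + \<bar>s\<bar>) / (2 * (2 + B)) \<le> cmod (of_real b - w)" using B by (simp add: divide_le_eq)
  then show "(1 + \<bar>s\<bar>) / (2 * (2 + B)) \<le> cmod (of_nat n + of_nat j - tcircle a r s)"
    by (simp add: b_def w_def)
qed

lemma kernel_den_line: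
  fixes s :: real
  assumes "a + 1 \<le> real n"
  shows "((1 + \<bar>s\<bar>) / 2) ^ Suc k \<le> cmod (kernel_den n k (of_real a + \<i> * of_real s))"
proof -
  have key: "(1 + \<bar>s\<bar>) / 2 \<le> cmod (of_nat n + of_nat j - (of_real a + \<i> * of_real s))" for j
  proof -
    define z where "z = of_nat n + of_nat j - (of_real a + \<i> * of_real s)"
    have "1 \<le> \<bar>Re z\<bar>" "\<bar>s\<bar> = \<bar>Im z\<bar>" using assms by (auto simp: z_def)
    then have "1 \<le> cmod z" "\<bar>s\<bar> \<le> cmod z"
      using abs_Re_le_cmod[of z] abs_Im_le_cmod[of z] by auto
    then have "(1 + \<bar>s\<bar>) / 2 \<le> cmod z" by simp
    then show ?thesis by (simp only: z_def)
  qed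
  show ?thesis by (rule kernel_den_lower_bound) (use key in auto)
qed

text \<open>All poles \<open>n, ..., n + k\<close> lie inside this circle. Cauchy's formula is
  applied to each partial fraction, and the binomial theorem reassembles the residues into
  \<open>x^n (1 - x)^k\<close>. The minus sign comes from the variable \<open>n - w\<close> in the
  partial fractions.\<close>

lemma contour_integral_kernel_right:
  assumes x: "x > 0" and a: "a < real n" and R: "real n + real k - a < R"
  shows "((\<lambda>w. of_real x powr w / kernel_den n k w) has_contour_integral
           - (2 * of_real pi * \<i> / fact k * of_real (x ^ n * (1 - x) ^ k))) (circlepath (of_real (a + R)) R)"
proof -
  define T where "T = (\<lambda>j (w::complex). - ((-1) ^ j * of_nat (k choose j) / fact k) * (of_real x powr w / (w - of_nat (n + j))))"
  have R0: "R > 0" using a R by auto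
  have "((\<lambda>w. \<Sum>j\<le>k. T j w)
     has_contour_integral (\<Sum>j\<le>k. - ((-1) ^ j * of_nat (k choose j) / fact k) * (2 * of_real pi * \<i> * of_real x powr of_nat (n + j))))
     (circlepath (of_real (a + R)) R)"
  proof (rule has_contour_integral_sum)
    fix j assume "j \<in> {..k}"
    then have j: "j \<le> k" by simp
    have "\<bar>a + R - real (n + j)\<bar> < R" using a R j by auto
    moreover have "cmod (of_nat (n + j) - of_real (a + R)) = \<bar>a + R - real (n + j)\<bar>"
      by (metis norm_minus_commute norm_of_real of_real_diff of_real_of_nat_eq)
    ultimately have mem: "cmod (of_nat (n + j) - of_real (a + R)) < R" by simp
    have "(\<lambda>w. of_real x powr w) holomorphic_on cball (complex_of_real (a + R)) R"
      using x by (intro holomorphic_intros) auto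
    from Cauchy_integral_circlepath_simple[OF this mem]
    show "(T j
      has_contour_integral - ((-1) ^ j * of_nat (k choose j) / fact k) * (2 * of_real pi * \<i> * of_real x powr of_nat (n + j)))
      (circlepath (of_real (a + R)) R)"
      unfolding T_def by (intro has_contour_integral_lmul) simp
  qed auto
  also have "(\<Sum>j\<le>k. - ((-1) ^ j * of_nat (k choose j) / fact k) * (2 * of_real pi * \<i> * of_real x powr of_nat (n + j)))
     = - (2 * of_real pi * \<i> / fact k * (of_real x ^ n * (\<Sum>j\<le>k. of_nat (k choose j) * (- of_real x) ^ j)))"
    using x unfolding sum_distrib_left sum_negf[symmetric]
    by (intro sum.cong) (auto simp: powr_nat' power_add power_minus[of "of_real x"] simp del: of_nat_add)
  also have "(\<Sum>j\<le>k. of_nat (k choose j) * (- of_real x) ^ j) = (1 - complex_of_real x) ^ k"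
    using binomial_ring[of "- complex_of_real x" 1 k] by (simp add: add.commute)
  finally have "((\<lambda>w. \<Sum>j\<le>k. T j w)
     has_contour_integral - (2 * of_real pi * \<i> / fact k * of_real (x ^ n * (1 - x) ^ k))) (circlepath (of_real (a + R)) R)"
    by simp
  then show ?thesis
  proof (rule has_contour_integral_eq)
    fix w assume w: "w \<in> path_image (circlepath (complex_of_real (a + R)) R)"
    have nz: "of_nat n - w + of_nat j \<noteq> 0" if "j \<le> k" for j
    proof
      assume "of_nat n - w + of_nat j = 0"
      then have "w = of_real (real (n + j))" by (simp add: algebra_simps)
      moreover have "cmod (w - of_real (a + R)) = R"
        using w R0 by (simp add: dist_norm norm_minus_commute)
      ultimately have "\<bar>real (n + j) - (a + R)\<bar> = R"
        by (metis norm_of_real of_real_diff)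
      then show False using that a R by auto
    qed
    have "of_real x powr w / kernel_den n k w = of_real x powr w / fact k * (fact k / (\<Prod>j\<le>k. (of_nat n - w) + of_nat j))"
      unfolding kernel_den_def by (simp add: algebra_simps)
    also have "fact k / (\<Prod>j\<le>k. (of_nat n - w) + of_nat j) = (\<Sum>j\<le>k. (- 1) ^ j * of_nat (k choose j) / (of_nat n - w + of_nat j))"
      by (rule partial_fractions_binomial[symmetric]) (use nz in auto)
    also have "of_real x powr w / fact k * \<dots> = (\<Sum>j\<le>k. T j w)"
      unfolding sum_distrib_left
    proof (rule sum.cong[OF refl])
      fix j
      have "w - of_nat (n + j) = - (of_nat n - w + of_nat j)" by simp
      then show "of_real x powr w / fact k * ((- 1) ^ j * of_nat (k choose j) / (of_nat n - w + of_nat j))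
        = T j w"
        unfolding T_def by (simp only: divide_minus_right) simp
    qed
    finally show "(\<Sum>j\<le>k. T j w)
        = of_real x powr w / kernel_den n k w" ..
  qed
qed

lemma contour_integral_kernel_left:
  assumes x: "x > 0" and a: "a < real n" and R: "R > 0"
  shows "((\<lambda>w. of_real x powr w / kernel_den n k w) has_contour_integral 0) (circlepath (of_real (a - R)) (- R))"
proof (rule Cauchy_theorem_convex_simple[of _ "{w. Re w < real n}"])
  show "(\<lambda>w. of_real x powr w / kernel_den n k w) holomorphic_on {w. Re w < real n}"
  proof -
    have "of_nat n + of_nat j - w \<noteq> 0" if "Re w < real n" for j w
      using that by (auto simp: complex_eq_iff)
    then show ?thesis unfolding kernel_den_def using x by (intro holomorphic_intros) auto
  qed
  show "convex {w. Re w < real n}" by (rule convex_halfspace_Re_lt)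
  show "path_image (circlepath (of_real (a - R)) (- R)) \<subseteq> {w. Re w < real n}"
  proof
    fix w assume "w \<in> path_image (circlepath (of_real (a - R)) (- R))"
    then have "cmod (w - of_real (a - R)) = R"
      using R by (simp add: path_image_circlepath_minus dist_norm norm_minus_commute)
    then have "Re (w - of_real (a - R)) \<le> R" using complex_Re_le_cmod by metis
    then show "w \<in> {w. Re w < real n}" using a by simp
  qed
qed auto

lemma kernel_inversion:
  assumes x: "x > 0" and k: "k \<ge> 1" and a: "a + 1 \<le> real n"
  shows "integrable lborel (\<lambda>s. of_real x powr (of_real a + \<i> * of_real s) / kernel_den n k (of_real a + \<i> * of_real s))"
    and "(LINT s|lborel. of_real x powr (of_real a + \<i> * of_real s) / kernel_den n k (of_real a + \<i> * of_real s))
          = 2 * of_real pi / fact k * of_real (kernel n k x)"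
proof -
  define f where "f w = of_real x powr w / kernel_den n k w" for w
  define B where "B = real n + real k - a"
  have B: "B \<ge> 1" using a by (simp add: B_def)
  define \<sigma> :: real where "\<sigma> = (if x \<le> 1 then 1 else - 1)"
  \<comment> \<open>The radius exceeds the distance \<open>B\<close> from \<open>a\<close> to the
    last pole \<open>n + k\<close>, so every right circle encloses all poles.\<close>
  define r where "r m = \<sigma> * (B + 1 + real m)" for m :: nat
  have r: "\<bar>r m\<bar> = B + 1 + real m" "r m \<noteq> 0" "sgn (r m) = \<sigma>" for m
    using B by (auto simp: r_def \<sigma>_def abs_mult sgn_mult)
  define q where "q = (\<lambda>m s. f (tcircle a (r m) s) * exp (- \<i> * of_real (s / r m)))"
  define h where "h m s = indicator {- (pi * \<bar>r m\<bar>)..pi * \<bar>r m\<bar>} s *\<^sub>R q m s" for m s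
  define I where "I = 2 * of_real pi / fact k * complex_of_real (kernel n k x)"
  define c where "c = 1 / (2 * (2 + B))"
  have c: "c > 0" using B by (simp add: c_def)
  have den: "(c * (1 + \<bar>s\<bar>)) ^ Suc k \<le> cmod (kernel_den n k (tcircle a (r m) s))"
    if "\<bar>s\<bar> \<le> pi * \<bar>r m\<bar>" for m s
    using kernel_den_tcircle[OF a B_def, of "r m" s] that r(1)[of m] by (simp add: c_def)
  have den0: "kernel_den n k (tcircle a (r m) s) \<noteq> 0" if "\<bar>s\<bar> \<le> pi * \<bar>r m\<bar>" for m s
  proof -
    have "0 < (c * (1 + \<bar>s\<bar>)) ^ Suc k" using c by (intro zero_less_power mult_pos_pos) auto
    then show ?thesis using den[OF that] by auto
  qed
  have cont: "continuous_on {- (pi * \<bar>r m\<bar>)..pi * \<bar>r m\<bar>} (q m)" for m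
  proof -
    have "kernel_den n k (tcircle a (r m) s) \<noteq> 0" if "s \<in> {- (pi * \<bar>r m\<bar>)..pi * \<bar>r m\<bar>}" for s
      using that by (intro den0) auto
    then show ?thesis
      unfolding q_def f_def using x r(2)[of m] unfolding kernel_den_def tcircle_def
      by (intro continuous_intros) auto
  qed
  have int_h: "(LINT s|lborel. h m s) = I" for m
  proof -
    have "(q m has_integral I) {- (pi * \<bar>r m\<bar>)..pi * \<bar>r m\<bar>}"
    proof (cases "x \<le> 1")
      case True
      then have s: "\<sigma> = 1" by (simp add: \<sigma>_def)
      have "(f has_contour_integral - (2 * of_real pi * \<i> / fact k * of_real (x ^ n * (1 - x) ^ k))) (circlepath (of_real (a + r m)) (r m))"
        unfolding f_def by (rule contour_integral_kernel_right) (use x a in \<open>auto simp: r_def s B_def\<close>)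
      from tcircle_has_integral[OF r(2) this] show ?thesis
        using True by (simp add: q_def r(3) s I_def kernel_def algebra_simps)
    next
      case False
      then have s: "\<sigma> = -1" by (simp add: \<sigma>_def)
      have "(f has_contour_integral 0) (circlepath (of_real (a - (B + 1 + real m))) (- (B + 1 + real m)))"
        unfolding f_def by (rule contour_integral_kernel_left) (use x a B in auto)
      moreover have "a - (B + 1 + real m) = a + r m" "- (B + 1 + real m) = r m" by (auto simp: r_def s)
      ultimately have "(f has_contour_integral 0) (circlepath (of_real (a + r m)) (r m))" by (simp only:)
      from tcircle_has_integral[OF r(2) this] show ?thesis
        using False k by (simp add: q_def I_def kernel_def power_0_left)
    qed
    moreover have si: "set_integrable lborel {- (pi * \<bar>r m\<bar>)..pi * \<bar>r m\<bar>} (q m)"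
      by (rule borel_integrable_atLeastAtMost'[OF cont])
    ultimately show ?thesis
      using set_borel_integral_eq_integral(2)[OF si] by (simp add: h_def set_lebesgue_integral_def integral_unique)
  qed
  have meas: "h m \<in> borel_measurable lborel" for m
    using borel_integrable_atLeastAtMost'[OF cont[of m]] unfolding set_integrable_def h_def by auto
  have ffm: "(\<lambda>s. f (of_real a + \<i> * of_real s)) \<in> borel_measurable lborel"
  proof -
    have "of_nat n + of_nat j - (of_real a + \<i> * of_real s) \<noteq> 0" for j s
      using a by (auto simp: complex_eq_iff)
    then have "continuous_on UNIV (\<lambda>s. f (of_real a + \<i> * of_real s))"
      unfolding f_def kernel_den_def using x by (intro continuous_intros) auto
    then show ?thesis by (simp add: borel_measurable_continuous_onI)
  qed
  have lim: "(\<lambda>m. h m s) \<longlonglongrightarrow> f (of_real a + \<i> * of_real s)" for s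
  proof -
    have limr: "filterlim r at_infinity sequentially"
    proof (rule filterlim_norm_at_top_imp_at_infinity)
      show "filterlim (\<lambda>m. norm (r m)) at_top sequentially"
        unfolding real_norm_def r(1)
        by (rule filterlim_tendsto_add_at_top[OF tendsto_const filterlim_real_sequentially])
    qed
    have d: "kernel_den n k (of_real a + \<i> * of_real s) \<noteq> 0"
      using a by (intro kernel_den_nonzero) auto
    have "isCont f (of_real a + \<i> * of_real s)"
      unfolding f_def using d x by (intro continuous_intros) (auto simp: kernel_den_def[abs_def] intro!: continuous_intros)
    then have 1: "(\<lambda>m. f (tcircle a (r m) s)) \<longlonglongrightarrow> f (of_real a + \<i> * of_real s)"
      by (rule isCont_tendsto_compose) (rule tcircle_tendsto[OF limr])
    have "(\<lambda>m. s / r m) \<longlonglongrightarrow> 0"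
      by (rule tendsto_divide_0[OF tendsto_const limr])
    then have "(\<lambda>m. exp (- \<i> * of_real (s / r m))) \<longlonglongrightarrow> exp (- \<i> * of_real 0)"
      by (intro tendsto_intros)
    with 1 have 2: "(\<lambda>m. q m s) \<longlonglongrightarrow> f (of_real a + \<i> * of_real s)"
      unfolding q_def using tendsto_mult by fastforce
    have "eventually (\<lambda>m. real m \<ge> \<bar>s\<bar>) sequentially" by (rule eventually_ge_at_top[THEN filterlim_real_sequentially[THEN filterlim_iff[THEN iffD1], rule_format]])
    then have "eventually (\<lambda>m. q m s = h m s) sequentially"
    proof eventually_elim
      case (elim m)
      have "1 * \<bar>s\<bar> \<le> pi * \<bar>r m\<bar>" unfolding r(1) using elim B pi_ge_two by (intro mult_mono) auto
      then have "s \<in> {- (pi * \<bar>r m\<bar>)..pi * \<bar>r m\<bar>}" by (auto simp: abs_le_iff)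
      then show ?case by (simp add: h_def)
    qed
    then show ?thesis using 2 by (rule Lim_transform_eventually[rotated])
  qed
  \<comment> \<open>On the chosen side of the line \<open>x^w\<close> has modulus at most
    \<open>x^a\<close>, and the \<open>k + 1 \<ge> 2\<close> factors of the denominator give at
    least quadratic decay, uniformly in \<open>m\<close>.\<close>
  define W where "W s = x powr a * (1 / c ^ Suc k) * (1 / (1 + \<bar>s\<bar>) ^ 2)" for s
  have W: "integrable lborel W" unfolding W_def by (intro integrable_mult_right integrable_1_plus_abs_power)
  have dom: "norm (h m s) \<le> W s" for m s
  proof (cases "\<bar>s\<bar> \<le> pi * \<bar>r m\<bar>")
    case True
    have e: "cmod (exp (- \<i> * of_real (s / r m))) = 1" by simp
    have num: "cmod (of_real x powr tcircle a (r m) s) \<le> x powr a"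
    proof -
      have "cmod (of_real x powr tcircle a (r m) s) = x powr Re (tcircle a (r m) s)"
        using x by (subst norm_powr_real) (auto simp: powr_def)
      also have "\<dots> \<le> x powr a"
      proof (cases "x \<le> 1")
        case True
        then have "r m \<ge> 0" using B by (simp add: r_def \<sigma>_def)
        then show ?thesis using True x unfolding Re_tcircle by (intro powr_mono') auto
      next
        case False
        then have "r m \<le> 0" using B by (simp add: r_def \<sigma>_def)
        then have "r m * (1 - cos (s / r m)) \<le> 0" by (intro mult_nonpos_nonneg) auto
        then show ?thesis using False x unfolding Re_tcircle by (intro powr_mono) auto
      qed
      finally show ?thesis .
    qed
    have "norm (h m s) \<le> cmod (f (tcircle a (r m) s))"
      unfolding h_def q_def by (simp add: norm_mult e indicator_def)
    also have "\<dots> \<le> x powr a / (c * (1 + \<bar>s\<bar>)) ^ Suc k"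
      unfolding f_def norm_divide using c
      by (intro frac_le num den True zero_less_power mult_pos_pos) auto
    also have "\<dots> = x powr a / c ^ Suc k / (1 + \<bar>s\<bar>) ^ Suc k" by (simp add: power_mult_distrib)
    also have "\<dots> \<le> x powr a / c ^ Suc k / (1 + \<bar>s\<bar>) ^ 2"
      using k c by (intro divide_left_mono power_increasing mult_pos_pos) auto
    finally show ?thesis by (simp add: W_def)
  next
    case False
    then have "s \<notin> {- (pi * \<bar>r m\<bar>)..pi * \<bar>r m\<bar>}" by (auto simp: abs_le_iff)
    then show ?thesis using c by (simp add: h_def W_def)
  qed
  have "integrable lborel (\<lambda>s. f (of_real a + \<i> * of_real s))"
    by (rule integrable_dominated_convergence[where s = h and w = W]) (use ffm meas W lim dom in auto)
  then show "integrable lborel (\<lambda>s. of_real x powr (of_real a + \<i> * of_real s) / kernel_den n k (of_real a + \<i> * of_real s))"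
    by (simp add: f_def)
  have "(\<lambda>m. LINT s|lborel. h m s) \<longlonglongrightarrow> (LINT s|lborel. f (of_real a + \<i> * of_real s))"
    by (rule integral_dominated_convergence[where w = W]) (use ffm meas W lim dom in auto)
  then have "(LINT s|lborel. f (of_real a + \<i> * of_real s)) = I"
    unfolding int_h by (simp add: LIMSEQ_const_iff)
  then show "(LINT s|lborel. of_real x powr (of_real a + \<i> * of_real s) / kernel_den n k (of_real a + \<i> * of_real s))
          = 2 * of_real pi / fact k * of_real (kernel n k x)"
    by (simp add: f_def I_def)
qed

section \<open>The Gamma integral and the Mellin transform of 1 / (1 + t)\<close>

lemma Gamma_set_integrable:
  assumes "Re z > 0" "a > 0"
  shows "set_integrable lborel {0<..} (\<lambda>t. of_real t powr (z - 1) * of_real (exp (- a * t)) :: complex)"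
proof -
  have 1: "set_integrable lebesgue {0<..} (\<lambda>t. of_real t powr (z - 1) * of_real (exp (- a * t)) :: complex)"
  proof -
    have "of_real t powr (z - 1) * of_real (exp (- a * t)) = of_real t powr (z - 1) / (of_real (exp (a * t)) :: complex)" for t
      by (simp add: exp_minus of_real_inverse field_simps)
    then show ?thesis using absolutely_integrable_Gamma_integral[OF assms] by simp
  qed
  have m: "(\<lambda>t. indicator {0<..} t *\<^sub>R (of_real t powr (z - 1) * of_real (exp (- a * t)) :: complex)) \<in> borel_measurable lborel"
    by measurable
  show ?thesis using 1 unfolding set_integrable_def integrable_completion[OF m] .
qed

lemma Gamma_set_integral:
  assumes "Re z > 0" "a > 0"
  shows "(LBINT t:{0<..}. of_real t powr (z - 1) * of_real (exp (- a * t))) = Gamma z / of_real a powr z"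
proof -
  have i1: "set_integrable lborel {0<..} (\<lambda>t. of_real t powr (z - 1) * of_real (exp (- 1 * t)) :: complex)"
    using Gamma_set_integrable[OF assms(1), of 1] by simp
  have "((\<lambda>t. of_real t powr (z - 1) * of_real (exp (- 1 * t))) has_integral Gamma z) {0..}"
    using Gamma_integral_complex[OF assms(1)]
    by (rule has_integral_eq[rotated]) (simp add: exp_minus field_simps)
  then have "((\<lambda>t. of_real t powr (z - 1) * of_real (exp (- 1 * t))) has_integral Gamma z) {0<..}"
    by (rule has_integral_spike_set_eq[THEN iffD1, rotated 2]) (auto intro!: negligible_subset[OF negligible_sing[of 0]])
  then have G: "(LBINT t:{0<..}. of_real t powr (z - 1) * of_real (exp (- 1 * t))) = Gamma z"
    using set_borel_integral_eq_integral(2)[OF i1] by (simp add: integral_unique)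
  have "(LBINT t:{0<..}. of_real t powr (z - 1) * of_real (exp (- 1 * t)) :: complex)
     = (LINT t|lborel. indicator {0<..} t *\<^sub>R (of_real t powr (z - 1) * of_real (exp (- 1 * t))))"
    by (simp add: set_lebesgue_integral_def)
  also have "\<dots> = \<bar>a\<bar> *\<^sub>R (LINT t|lborel. indicator {0<..} (0 + a * t) *\<^sub>R (of_real (0 + a * t) powr (z - 1) * of_real (exp (- 1 * (0 + a * t)))))"
    using assms(2) by (intro lborel_integral_real_affine) auto
  also have "(\<lambda>t. indicator {0<..} (0 + a * t) *\<^sub>R (of_real (0 + a * t) powr (z - 1) * of_real (exp (- 1 * (0 + a * t)))) :: complex)
      = (\<lambda>t. of_real a powr (z - 1) * (indicator {0<..} t *\<^sub>R (of_real t powr (z - 1) * of_real (exp (- a * t)))))"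
  proof
    fix t
    show "indicator {0<..} (0 + a * t) *\<^sub>R (of_real (0 + a * t) powr (z - 1) * of_real (exp (- 1 * (0 + a * t))))
       = of_real a powr (z - 1) * (indicator {0<..} t *\<^sub>R (of_real t powr (z - 1) * of_real (exp (- a * t))))"
    proof (cases "t > 0")
      case True
      then have "complex_of_real (a * t) powr (z - 1) = of_real a powr (z - 1) * of_real t powr (z - 1)"
        unfolding of_real_mult using assms(2) by (intro powr_times_real) auto
      then show ?thesis using True assms(2) by simp
    next
      case False
      then show ?thesis using assms(2) by (simp add: zero_less_mult_iff)
    qed
  qed
  finally have "Gamma z = \<bar>a\<bar> *\<^sub>R (of_real a powr (z - 1) * (LBINT t:{0<..}. of_real t powr (z - 1) * of_real (exp (- a * t))))"
    using G unfolding set_lebesgue_integral_def by (simp only: integral_mult_right_zero)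
  also have "\<dots> = of_real a powr z * (LBINT t:{0<..}. of_real t powr (z - 1) * of_real (exp (- a * t)))"
    using assms(2) by (simp add: scaleR_conv_of_real powr_diff)
  finally show ?thesis using assms(2) by simp
qed

text \<open>Write \<open>1 / (1 + t)\<close> as the integral of \<open>exp (- x (1 + t))\<close>
  over \<open>x > 0\<close> and exchange the integrals. The inner integral gives
  \<open>Gamma z x^(-z)\<close>, the outer one \<open>Gamma (1 - z)\<close>, and the reflection
  formula finishes. The two strip bounds are the convergence conditions of the two Gamma
  integrals.\<close>

lemma Mellin_inverse_1_plus:
  assumes z: "0 < Re z" "Re z < 1"
  shows "set_integrable lborel {0<..} (\<lambda>t. of_real t powr (z - 1) / of_real (1 + t) :: complex)"
    and "(LBINT t:{0<..}. of_real t powr (z - 1) / of_real (1 + t)) = of_real pi / sin (of_real pi * z)"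
proof -
  define F :: "real \<Rightarrow> real \<Rightarrow> complex" where
    "F x t = indicator {0<..} x *\<^sub>R indicator {0<..} t *\<^sub>R (of_real t powr (z - 1) * of_real (exp (- x * (1 + t))))" for x t
  have F1: "F x t = (indicator {0<..} x * exp (- x)) *\<^sub>R (indicator {0<..} t *\<^sub>R (of_real t powr (z - 1) * of_real (exp (- x * t))))" for x t
  proof -
    have "exp (- x * (1 + t)) = exp (- x) * exp (- x * t)" by (simp add: algebra_simps flip: exp_add)
    then show ?thesis by (simp add: F_def indicator_def scaleR_conv_of_real)
  qed
  \<comment> \<open>The trivial power \<open>x powr (1 - 1)\<close> brings the
    \<open>x\<close>-integral into the form of the Gamma integral at 1.\<close>
  have F2: "F x t = (indicator {0<..} t *\<^sub>R (of_real t powr (z - 1))) * (indicator {0<..} x *\<^sub>R (of_real x powr (1 - 1) * of_real (exp (- (1 + t) * x))))" for x t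
    by (simp add: F_def indicator_def scaleR_conv_of_real algebra_simps)
  have int1: "integrable lborel (F x)" for x
  proof (cases "x > 0")
    case True
    then show ?thesis
      unfolding F1 by (intro integrable_scaleR_right Gamma_set_integrable[unfolded set_integrable_def] z)
  qed (simp add: F_def[abs_def])
  have meas: "(\<lambda>(x, t). F x t) \<in> borel_measurable (lborel \<Otimes>\<^sub>M lborel)"
    unfolding F_def by measurable
  \<comment> \<open>Taking norms replaces \<open>z\<close> by \<open>Re z\<close>, so the absolute
    integrability required for Fubini is again a pair of Gamma integrals.\<close>
  have nF: "complex_of_real (norm (F x t)) = (indicator {0<..} x * exp (- x)) *\<^sub>R (indicator {0<..} t *\<^sub>R (of_real t powr (of_real (Re z) - 1) * of_real (exp (- x * t))))" for x t
  proof -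
    have "complex_of_real t powr (of_real (Re z) - 1) = of_real (t powr (Re z - 1))" if "t > 0"
      using powr_of_real[of t "Re z - 1"] that by simp
    then show ?thesis
      unfolding F1
      by (cases "x > 0"; cases "t > 0") (simp_all add: norm_mult norm_powr_real_powr scaleR_conv_of_real)
  qed
  have nint: "complex_of_real (LINT t|lborel. norm (F x t)) = indicator {0<..} x *\<^sub>R (Gamma (of_real (Re z)) * (of_real x powr ((1 - of_real (Re z)) - 1) * of_real (exp (- 1 * x))))" for x
  proof (cases "x > 0")
    case True
    have "complex_of_real (LINT t|lborel. norm (F x t)) = (LINT t|lborel. complex_of_real (norm (F x t)))"
      by (rule integral_complex_of_real[symmetric])
    also have "\<dots> = exp (- x) *\<^sub>R (LBINT t:{0<..}. of_real t powr (of_real (Re z) - 1) * of_real (exp (- x * t)))"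
      unfolding nF set_lebesgue_integral_def integral_scaleR_right using True by simp
    also have "\<dots> = exp (- x) *\<^sub>R (Gamma (of_real (Re z)) / of_real x powr (of_real (Re z)))"
      using z True by (subst Gamma_set_integral) auto
    finally show ?thesis using True by (simp add: scaleR_conv_of_real powr_minus_divide powr_minus field_simps)
  qed (simp add: F_def)
  have int2: "integrable lborel (\<lambda>x. LINT t|lborel. norm (F x t))"
  proof -
    have "integrable lborel (\<lambda>x. Gamma (complex_of_real (Re z)) * (indicator {0<..} x *\<^sub>R (of_real x powr ((1 - of_real (Re z)) - 1) * of_real (exp (- 1 * x)))))"
      using z by (intro integrable_mult_right Gamma_set_integrable[unfolded set_integrable_def]) auto
    then have "integrable lborel (\<lambda>x. complex_of_real (LINT t|lborel. norm (F x t)))"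
      unfolding nint by simp
    then show ?thesis by (simp only: complex_of_real_integrable_eq)
  qed
  have int: "integrable (lborel \<Otimes>\<^sub>M lborel) (case_prod F)"
    by (rule lborel_pair.Fubini_integrable) (use meas int1 int2 in auto)
  have inner2: "(LINT x|lborel. F x t) = indicator {0<..} t *\<^sub>R (of_real t powr (z - 1) / of_real (1 + t))" for t
  proof (cases "t > 0")
    case True
    have "(LINT x|lborel. F x t) = of_real t powr (z - 1) * (LBINT x:{0<..}. of_real x powr (1 - 1) * of_real (exp (- (1 + t) * x)))"
      unfolding F2 set_lebesgue_integral_def integral_mult_right_zero using True by simp
    also have "\<dots> = of_real t powr (z - 1) * (Gamma 1 / of_real (1 + t) powr 1)"
      using True by (subst Gamma_set_integral) auto
    finally show ?thesis using True by (simp add: powr_one)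
  qed (simp add: F_def)
  have "integrable lborel (\<lambda>t. LINT x|lborel. F x t)"
    using lborel_pair.integrable_snd[OF int] .
  then show "set_integrable lborel {0<..} (\<lambda>t. of_real t powr (z - 1) / of_real (1 + t) :: complex)"
    unfolding inner2 set_integrable_def .
  have inner1: "(LINT t|lborel. F x t) = Gamma z * (indicator {0<..} x *\<^sub>R (of_real x powr ((1 - z) - 1) * of_real (exp (- 1 * x))))" for x
  proof (cases "x > 0")
    case True
    have "(LINT t|lborel. F x t) = exp (- x) *\<^sub>R (LBINT t:{0<..}. of_real t powr (z - 1) * of_real (exp (- x * t)))"
      unfolding F1 set_lebesgue_integral_def integral_scaleR_right using True by simp
    also have "\<dots> = exp (- x) *\<^sub>R (Gamma z / of_real x powr z)"
      using z True by (subst Gamma_set_integral) auto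
    finally show ?thesis using True by (simp add: scaleR_conv_of_real powr_minus field_simps)
  qed (simp add: F_def)
  have "(LBINT t:{0<..}. of_real t powr (z - 1) / of_real (1 + t)) = (LINT t|lborel. LINT x|lborel. F x t)"
    unfolding inner2 set_lebesgue_integral_def ..
  also have "\<dots> = (LINT x|lborel. LINT t|lborel. F x t)"
    by (rule lborel_pair.Fubini_integral[OF int])
  also have "\<dots> = Gamma z * (LBINT x:{0<..}. of_real x powr ((1 - z) - 1) * of_real (exp (- 1 * x)))"
    unfolding inner1 set_lebesgue_integral_def by (simp only: integral_mult_right_zero)
  also have "\<dots> = Gamma z * (Gamma (1 - z) / of_real 1 powr (1 - z))"
    using z by (subst Gamma_set_integral) auto
  also have "\<dots> = of_real pi / sin (of_real pi * z)"
    using Gamma_reflection_complex[of z] by simp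
  finally show "(LBINT t:{0<..}. of_real t powr (z - 1) / of_real (1 + t)) = of_real pi / sin (of_real pi * z)" .
qed

lemma Mellin_inverse_1_plus_scaled:
  assumes z: "0 < Re z" "Re z < 1" and v: "v > 0"
  shows "set_integrable lborel {0<..} (\<lambda>t. of_real t powr (z - 1) / of_real (1 + t / v) :: complex)"
    and "(LBINT t:{0<..}. of_real t powr (z - 1) / of_real (1 + t / v)) = of_real v powr z * (of_real pi / sin (of_real pi * z))"
proof -
  define f where "f t = indicator {0<..} t *\<^sub>R (of_real t powr (z - 1) / of_real (1 + t) :: complex)" for t
  define g where "g t = indicator {0<..} t *\<^sub>R (of_real t powr (z - 1) / of_real (1 + t / v) :: complex)" for t
  have c: "1 / v \<noteq> 0" using v by simp
  have fg: "g t = of_real v powr (z - 1) * f (0 + 1 / v * t)" for t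
  proof (cases "t > 0")
    case True
    have "of_real (t * v / v) powr (z - 1) = complex_of_real v powr (z - 1) * of_real (t / v) powr (z - 1)"
      using True v by (subst powr_times_real[symmetric]) (auto simp flip: of_real_mult of_real_divide)
    then show ?thesis using True v by (simp add: f_def g_def)
  next
    case False
    then show ?thesis using v by (simp add: f_def g_def zero_less_divide_iff)
  qed
  have intf: "integrable lborel f" using Mellin_inverse_1_plus(1)[OF z] by (simp add: f_def[abs_def] set_integrable_def)
  then have "integrable lborel (\<lambda>t. f (0 + 1 / v * t))" by (rule lborel_integrable_real_affine[OF _ c])
  then have "integrable lborel g" unfolding fg by (intro integrable_mult_right)
  then show "set_integrable lborel {0<..} (\<lambda>t. of_real t powr (z - 1) / of_real (1 + t / v) :: complex)"
    by (simp add: g_def[abs_def] set_integrable_def)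
  have "(LINT t|lborel. f t) = \<bar>1 / v\<bar> *\<^sub>R (LINT t|lborel. f (0 + 1 / v * t))"
    by (rule lborel_integral_real_affine[OF c])
  then have 1: "(LINT t|lborel. f (0 + 1 / v * t)) = of_real v * (LINT t|lborel. f t)"
    using v by (simp add: scaleR_conv_of_real)
  have "(LINT t|lborel. g t) = of_real v powr (z - 1) * (of_real v * (LINT t|lborel. f t))"
    unfolding fg 1[symmetric] by (rule integral_mult_right_zero)
  also have "\<dots> = of_real v powr z * (LINT t|lborel. f t)"
    using v by (simp add: powr_diff)
  also have "(LINT t|lborel. f t) = of_real pi / sin (of_real pi * z)"
    using Mellin_inverse_1_plus(2)[OF z] by (simp add: f_def set_lebesgue_integral_def)
  finally show "(LBINT t:{0<..}. of_real t powr (z - 1) / of_real (1 + t / v)) = of_real v powr z * (of_real pi / sin (of_real pi * z))"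
    by (simp add: g_def set_lebesgue_integral_def)
qed

section \<open>Powers and exponentials as averages of the kernel\<close>

text \<open>The families \<open>F\<close> and \<open>G\<close> stand for successive derivatives of
  \<open>F 0\<close> and \<open>G 0\<close>, so the displayed sum is the \<open>m\<close>-th
  derivative of their product.\<close>

lemma Leibniz_higher_derivative:
  fixes F G :: "nat \<Rightarrow> real \<Rightarrow> real"
  assumes "\<And>i. (F i has_real_derivative F (Suc i) x) (at x within S)"
    and "\<And>i. (G i has_real_derivative G (Suc i) x) (at x within S)"
  shows "((\<lambda>x. \<Sum>j\<le>m. real (m choose j) * (F j x * G (m - j) x)) has_real_derivative
          (\<Sum>j\<le>Suc m. real (Suc m choose j) * (F j x * G (Suc m - j) x))) (at x within S)"
proof -
  have "((\<lambda>x. \<Sum>j\<le>m. real (m choose j) * (F j x * G (m - j) x)) has_real_derivative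
          (\<Sum>j\<le>m. real (m choose j) * (F (Suc j) x * G (m - j) x + F j x * G (Suc (m - j)) x))) (at x within S)"
    by (auto intro!: derivative_eq_intros assms simp: algebra_simps)
  also have "(\<Sum>j\<le>m. real (m choose j) * (F (Suc j) x * G (m - j) x + F j x * G (Suc (m - j)) x))
     = (\<Sum>j\<le>m. real (m choose j) * (F (Suc j) x * G (m - j) x)) + (\<Sum>j\<le>m. real (m choose j) * (F j x * G (Suc m - j) x))"
    by (simp add: distrib_left sum.distrib Suc_diff_le)
  also have "(\<Sum>j\<le>m. real (m choose j) * (F j x * G (Suc m - j) x)) = (\<Sum>j\<le>Suc m. real (m choose j) * (F j x * G (Suc m - j) x))"
    by simp
  also have "\<dots> = F 0 x * G (Suc m) x + (\<Sum>j\<le>m. real (m choose Suc j) * (F (Suc j) x * G (m - j) x))"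
    unfolding sum.atMost_Suc_shift by simp
  also have "(\<Sum>j\<le>m. real (m choose j) * (F (Suc j) x * G (m - j) x)) + (F 0 x * G (Suc m) x + (\<Sum>j\<le>m. real (m choose Suc j) * (F (Suc j) x * G (m - j) x)))
     = (\<Sum>j\<le>Suc m. real (Suc m choose j) * (F j x * G (Suc m - j) x))"
    unfolding sum.atMost_Suc_shift by (simp add: sum.distrib[symmetric] algebra_simps)
  finally show ?thesis .
qed

text \<open>The falling factorial. The product is taken in the reals so that it vanishes for
  \<open>j > N\<close>, which keeps the derivative formulas valid despite truncated subtraction in
  \<open>N - j\<close>.\<close>

definition falling :: "nat \<Rightarrow> nat \<Rightarrow> real" where
  "falling N j = (\<Prod>i<j. real N - real i)"

text \<open>
  This is \<open>X\<^sup>n\<^sup>+\<^sup>k (-1)\<^sup>k\<^sup>+\<^sup>1 / k!\<close> times the \<open>(k+1)\<close>-st derivative of \<open>(1 - X/T)\<^sup>N X\<^sup>-\<^sup>n\<close>, expanded by the Leibniz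
  rule; Taylor's formula with integral remainder at \<open>T\<close> then represents \<open>(1 - y/T)\<^sup>N\<close>. All terms are
  nonnegative.
\<close>

definition weight :: "nat \<Rightarrow> nat \<Rightarrow> nat \<Rightarrow> real \<Rightarrow> real \<Rightarrow> real" where
  "weight n k N T X = (\<Sum>j\<le>Suc k. real (Suc k choose j) * (falling N j / T ^ j * (1 - X / T) ^ (N - j)
       * (pochhammer (real n) (Suc k - j) * X ^ j))) / (fact k * X)"

text \<open>The variable is \<open>z = - X\<close>: Taylor's formula is applied from the left
  endpoint of an interval, while the point of expansion \<open>T\<close> lies to the right. The
  reflection also removes all alternating signs.\<close>

lemma has_derivative_power_reflected:
  fixes T :: real
  assumes "T > 0"
  shows "((\<lambda>z. falling N j / T ^ j * (1 + z / T) ^ (N - j)) has_real_derivative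
          falling N (Suc j) / T ^ Suc j * (1 + z / T) ^ (N - Suc j)) (at z within S)"
proof (cases "j < N")
  case True
  then have "falling N (Suc j) = falling N j * real (N - j)" by (simp add: falling_def of_nat_diff)
  moreover have "N - j - 1 = N - Suc j" by simp
  ultimately show ?thesis
    using assms by (auto intro!: derivative_eq_intros)
next
  case False
  then have "falling N (Suc j) = 0" unfolding falling_def by (simp add: prod_zero_iff) (metis lessThan_iff le_neq_implies_less less_Suc_eq not_less of_nat_eq_iff order_refl)
  then show ?thesis using False by simp
qed

lemma has_derivative_inverse_power_reflected:
  fixes z :: real
  assumes "z < 0" "n \<ge> 1"
  shows "((\<lambda>z. pochhammer (real n) j / (- z) ^ (n + j)) has_real_derivative
          pochhammer (real n) (Suc j) / (- z) ^ (n + Suc j)) (at z within S)"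
proof -
  define m where "m = n + j"
  have m: "m > 0" using assms by (simp add: m_def)
  then obtain p where p: "m = Suc p" by (cases m) auto
  have "((\<lambda>z. pochhammer (real n) j * inverse ((- z) ^ m)) has_real_derivative
          pochhammer (real n) j * (real m * (- z) ^ p * inverse ((- z) ^ m) ^ 2)) (at z within S)"
  proof -
    have "((\<lambda>z. (- z) ^ Suc p) has_real_derivative (1 + of_nat p) * (- 1 * (- z) ^ p)) (at z within S)"
      by (rule DERIV_power_Suc) (auto intro!: derivative_eq_intros)
    then have "((\<lambda>z. (- z) ^ m) has_real_derivative - (real m * (- z) ^ p)) (at z within S)"
      by (simp add: p)
    moreover have "(- z) ^ m \<noteq> 0" using assms(1) by simp
    ultimately have "((\<lambda>z. pochhammer (real n) j * inverse ((- z) ^ m)) has_real_derivative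
          pochhammer (real n) j * (- (inverse ((- z) ^ m) * - (real m * (- z) ^ p) * inverse ((- z) ^ m)))) (at z within S)"
      by (intro DERIV_cmult DERIV_inverse')
    moreover have "- (inverse ((- z) ^ m) * - (real m * (- z) ^ p) * inverse ((- z) ^ m)) = real m * (- z) ^ p * inverse ((- z) ^ m) ^ 2"
      by (simp only: power2_eq_square mult_ac mult_minus_left mult_minus_right minus_minus)
    ultimately show ?thesis by (simp only:)
  qed
  also have "real m * (- z) ^ p * inverse ((- z) ^ m) ^ 2 = real m / (- z) ^ Suc m"
  proof -
    define y where "y = - z"
    have y: "y > 0" using assms(1) by (simp add: y_def)
    have "(y ^ m) ^ 2 = y ^ p * y ^ Suc m" by (simp add: p power2_eq_square mult_ac)
    then have "real m * y ^ p * inverse (y ^ m) ^ 2 = real m * y ^ p * (inverse (y ^ p) * inverse (y ^ Suc m))"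
      by (simp only: power_inverse inverse_mult_distrib)
    also have "\<dots> = real m / y ^ Suc m" using y by (simp add: divide_inverse)
    finally show ?thesis by (simp only: y_def)
  qed
  finally have "((\<lambda>z. pochhammer (real n) j / (- z) ^ m) has_real_derivative
          pochhammer (real n) j * (real m / (- z) ^ Suc m)) (at z within S)"
    by (simp only: divide_inverse)
  then show ?thesis by (simp only: m_def pochhammer_Suc of_nat_add add_Suc_right times_divide_eq_right)
qed

text \<open>Taylor's formula of order \<open>k + 1\<close> for \<open>(1 + z/T)^N (-z)^(-n)\<close>
  at \<open>-T\<close>, evaluated at \<open>-y\<close>. After multiplication by \<open>y^n\<close>,
  the remainder factor \<open>(X - y)^k\<close> becomes \<open>kernel n k (y / X)\<close> up to a
  power of \<open>X\<close> that is absorbed in the weight.\<close>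

lemma weight_representation:
  assumes y: "0 < y" "y < T" and n: "n \<ge> 1" and N: "N > Suc k"
  shows "((\<lambda>X. weight n k N T X * kernel n k (y / X)) has_integral (1 - y / T) ^ N) {y..T}"
proof -
  have T: "T > 0" using y by simp
  define F where "F = (\<lambda>j z. falling N j / T ^ j * (1 + z / T) ^ (N - j))"
  define G where "G = (\<lambda>j (z::real). pochhammer (real n) j / (- z) ^ (n + j))"
  define H where "H = (\<lambda>m z. \<Sum>j\<le>m. real (m choose j) * (F j z * G (m - j) z))"
  have dH: "(H m has_vector_derivative H (Suc m) z) (at z within {- T..- y})" if "z \<in> {- T..- y}" for m z
  proof -
    have "(F i has_real_derivative F (Suc i) z) (at z within {- T..- y})" for i
      unfolding F_def by (rule has_derivative_power_reflected[OF T])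
    moreover have "(G i has_real_derivative G (Suc i) z) (at z within {- T..- y})" for i
      unfolding G_def by (rule has_derivative_inverse_power_reflected) (use that y n in auto)
    ultimately show ?thesis
      unfolding H_def has_real_derivative_iff_has_vector_derivative[symmetric]
      by (rule Leibniz_higher_derivative)
  qed
  \<comment> \<open>Here \<open>N - j\<close> is positive, so the power vanishes at
    \<open>-T\<close>. Every Leibniz term of order at most \<open>k\<close> contains such a factor,
    hence the whole Taylor polynomial drops out.\<close>
  have F0: "F j (- T) = 0" if "j \<le> k" for j
    using that N T by (simp add: F_def)
  have "((\<lambda>x. ((- y - x) ^ (Suc k - 1) / fact (Suc k - 1)) *\<^sub>R H (Suc k) x) has_integral
      H 0 (- y) - (\<Sum>i<Suc k. ((- y - - T) ^ i / fact i) *\<^sub>R H i (- T))) {- T..- y}"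
    by (rule Taylor_has_integral) (use dH y in auto)
  moreover have "(\<Sum>i<Suc k. ((- y - - T) ^ i / fact i) *\<^sub>R H i (- T)) = 0"
    by (intro sum.neutral) (auto simp: H_def F0)
  moreover have "H 0 (- y) = (1 - y / T) ^ N / y ^ n"
    by (simp add: H_def F_def G_def falling_def)
  ultimately have "((\<lambda>x. ((- y - x) ^ k / fact k) * H (Suc k) x) has_integral (1 - y / T) ^ N / y ^ n) {- T..- y}"
    by simp
  then have "((\<lambda>x. (- y - (- x)) ^ k / fact k * H (Suc k) (- x)) has_integral (1 - y / T) ^ N / y ^ n) {y..T}"
    using has_integral_reflect_real[of "\<lambda>x. (- y - (- x)) ^ k / fact k * H (Suc k) (- x)" _ T y] by simp
  from has_integral_mult_right[OF this, of "y ^ n"]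
  have "((\<lambda>x. y ^ n * ((- y - (- x)) ^ k / fact k * H (Suc k) (- x))) has_integral (1 - y / T) ^ N) {y..T}"
    using y by simp
  then show ?thesis
  proof (rule has_integral_eq[rotated])
    fix X assume "X \<in> {y..T}"
    then have X: "X \<ge> y" "X > 0" using y by auto
    have G: "G (Suc k - j) (- X) = pochhammer (real n) (Suc k - j) * X ^ j / X ^ (n + Suc k)" if "j \<le> Suc k" for j
    proof -
      have "n + Suc k = n + (Suc k - j) + j" using that by simp
      then have "X ^ (n + Suc k) = X ^ (n + (Suc k - j)) * X ^ j" by (metis power_add)
      then show ?thesis using X by (simp add: G_def)
    qed
    have "H (Suc k) (- X) = (\<Sum>j\<le>Suc k. real (Suc k choose j) * (falling N j / T ^ j * (1 - X / T) ^ (N - j)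
       * (pochhammer (real n) (Suc k - j) * X ^ j))) / X ^ (n + Suc k)"
      unfolding H_def sum_divide_distrib
      by (intro sum.cong refl) (simp only: F_def G atMost_iff, simp)
    then have H: "H (Suc k) (- X) = weight n k N T X * fact k / X ^ (n + k)"
      using X by (simp add: weight_def)
    have K: "kernel n k (y / X) = y ^ n * (X - y) ^ k / X ^ (n + k)"
    proof -
      have "max (1 - y / X) 0 = (X - y) / X" using X y by (simp add: max_def field_simps)
      then show ?thesis by (simp add: kernel_def power_divide power_add)
    qed
    show "y ^ n * ((- y - (- X)) ^ k / fact k * H (Suc k) (- X)) = weight n k N T X * kernel n k (y / X)"
      unfolding H K by simp
  qed
qed

lemma falling_bounds: "j \<le> N \<Longrightarrow> 0 \<le> falling N j" "j \<le> N \<Longrightarrow> falling N j \<le> real N ^ j"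
proof -
  show "j \<le> N \<Longrightarrow> 0 \<le> falling N j" unfolding falling_def by (intro prod_nonneg) auto
  show "j \<le> N \<Longrightarrow> falling N j \<le> real N ^ j"
    using prod_mono[of "{..<j}" "\<lambda>i. real N - real i" "\<lambda>_. real N"] by (auto simp: falling_def)
qed

definition weight_lim :: "nat \<Rightarrow> nat \<Rightarrow> real \<Rightarrow> real \<Rightarrow> real" where
  "weight_lim n k t X = (\<Sum>j\<le>Suc k. real (Suc k choose j) * (exp (- X / t) / t ^ j
       * (pochhammer (real n) (Suc k - j) * X ^ j))) / (fact k * X)"

definition weight_bound :: "nat \<Rightarrow> nat \<Rightarrow> real \<Rightarrow> real \<Rightarrow> real" where
  "weight_bound n k t X = (\<Sum>j\<le>Suc k. real (Suc k choose j) * (exp (- X / (2 * t)) / t ^ j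
       * (pochhammer (real n) (Suc k - j) * X ^ j))) / (fact k * X)"

lemma pochhammer_of_nat_nonneg: "0 \<le> pochhammer (real n) m"
  by (simp add: pochhammer_of_nat)

lemma weight_nonneg:
  assumes "N \<ge> Suc k" "0 < X" "X \<le> T"
  shows "0 \<le> weight n k N T X"
  unfolding weight_def using assms
  by (intro divide_nonneg_nonneg sum_nonneg mult_nonneg_nonneg falling_bounds pochhammer_of_nat_nonneg zero_le_power)
     (auto intro!: falling_bounds)

text \<open>The assumption on \<open>N\<close> gives \<open>2 j \<le> N\<close>, so at least half of
  the \<open>N\<close> factors \<open>1 - X/(N t) \<le> exp (- X/(N t))\<close> remain; this is the
  2 in the exponent of \<open>weight_bound\<close>.\<close>

lemma weight_le_bound:
  assumes "N \<ge> 2 * Suc k" "0 < X" "X \<le> real N * t" "t > 0"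
  shows "weight n k N (real N * t) X \<le> weight_bound n k t X"
  unfolding weight_def weight_bound_def
proof (intro divide_right_mono sum_mono mult_left_mono mult_right_mono)
  fix j assume "j \<in> {..Suc k}"
  then have j: "2 * j \<le> N" "j \<le> N" using assms by auto
  have N: "real N > 0" using assms by auto
  have "falling N j / (real N * t) ^ j \<le> real N ^ j / (real N * t) ^ j"
    using falling_bounds(2)[OF j(2)] N assms by (intro divide_right_mono) auto
  also have "\<dots> = 1 / t ^ j" using N by (simp add: power_mult_distrib)
  finally have 1: "falling N j / (real N * t) ^ j \<le> 1 / t ^ j" .
  have "1 - X / (real N * t) \<le> exp (- X / (real N * t))"
    using exp_ge_add_one_self[of "- X / (real N * t)"] by simp
  moreover have "0 \<le> 1 - X / (real N * t)" using assms N by simp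
  ultimately have "(1 - X / (real N * t)) ^ (N - j) \<le> exp (- X / (real N * t)) ^ (N - j)"
    by (rule power_mono)
  also have "\<dots> = exp (real (N - j) * (- X / (real N * t)))" by (simp only: exp_of_nat_mult)
  also have "\<dots> \<le> exp (- X / (2 * t))"
  proof -
    have "X * (real N / 2) \<le> X * real (N - j)" using j assms by (intro mult_left_mono) (auto simp: of_nat_diff)
    then have "real (N - j) * (- X / (real N * t)) \<le> - X / (2 * t)" using N assms by (simp add: field_simps)
    then show ?thesis by simp
  qed
  finally have "falling N j / (real N * t) ^ j * (1 - X / (real N * t)) ^ (N - j) \<le> 1 / t ^ j * exp (- X / (2 * t))"
    using 1 falling_bounds(1)[OF j(2)] N assms by (intro mult_mono) auto
  then show "falling N j / (real N * t) ^ j * (1 - X / (real N * t)) ^ (N - j) \<le> exp (- X / (2 * t)) / t ^ j" by simp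
qed (use assms in \<open>auto intro!: mult_nonneg_nonneg pochhammer_of_nat_nonneg\<close>)

lemma weight_tendsto:
  assumes "X > 0" "t > 0"
  shows "(\<lambda>N. weight n k N (real N * t) X) \<longlonglongrightarrow> weight_lim n k t X"
  unfolding weight_def weight_lim_def
proof (intro tendsto_intros)
  fix j
  have pe: "(\<lambda>N. (1 + (- X / t) / real N) ^ N) \<longlonglongrightarrow> exp (- X / t)"
    by (rule tendsto_exp_limit_sequentially)
  have z: "(\<lambda>N. (- X / t) / real N) \<longlonglongrightarrow> 0"
    by (rule tendsto_divide_0[OF tendsto_const]) (simp add: filterlim_at_top_imp_at_infinity filterlim_real_sequentially)
  have "(\<lambda>N. (1 + (- X / t) / real N) ^ N / (1 + (- X / t) / real N) ^ j) \<longlonglongrightarrow> exp (- X / t) / (1 + 0) ^ j"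
    by (intro tendsto_intros pe z) simp
  moreover have "eventually (\<lambda>N. (1 + (- X / t) / real N) ^ N / (1 + (- X / t) / real N) ^ j = (1 - X / (real N * t)) ^ (N - j)) sequentially"
  proof -
    have "eventually (\<lambda>N. real N > X / t) sequentially"
      using filterlim_real_sequentially by (simp add: filterlim_at_top_dense)
    then show ?thesis using eventually_ge_at_top[of "Suc j"]
    proof eventually_elim
      case (elim N)
      then have "1 + (- X / t) / real N \<noteq> 0" using assms by (simp add: field_simps)
      then have "(1 + (- X / t) / real N) ^ N / (1 + (- X / t) / real N) ^ j = (1 + (- X / t) / real N) ^ (N - j)"
        using elim by (simp add: power_diff)
      then show ?case by (simp add: mult.commute)
    qed
  qed
  ultimately have 1: "(\<lambda>N. (1 - X / (real N * t)) ^ (N - j)) \<longlonglongrightarrow> exp (- X / t)"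
    by (simp add: Lim_transform_eventually)
  have "(\<lambda>N. (\<Prod>i<j. 1 - real i / real N) / t ^ j) \<longlonglongrightarrow> (\<Prod>i<j. 1 - 0) / t ^ j"
    using assms by (intro tendsto_intros tendsto_divide_0[OF tendsto_const] filterlim_at_top_imp_at_infinity filterlim_real_sequentially) auto
  moreover have "eventually (\<lambda>N. (\<Prod>i<j. 1 - real i / real N) / t ^ j = falling N j / (real N * t) ^ j) sequentially"
    using eventually_ge_at_top[of 1]
  proof eventually_elim
    case (elim N)
    have "falling N j = (\<Prod>i<j. real N * (1 - real i / real N))"
      unfolding falling_def using elim by (intro prod.cong) (auto simp: field_simps)
    also have "\<dots> = real N ^ j * (\<Prod>i<j. 1 - real i / real N)" by (simp add: prod.distrib)
    finally show ?case using elim by (simp add: power_mult_distrib)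
  qed
  ultimately have 2: "(\<lambda>N. falling N j / (real N * t) ^ j) \<longlonglongrightarrow> 1 / t ^ j"
    by (simp add: Lim_transform_eventually)
  show "(\<lambda>N. falling N j / (real N * t) ^ j * (1 - X / (real N * t)) ^ (N - j)) \<longlonglongrightarrow> exp (- X / t) / t ^ j"
    using tendsto_mult[OF 2 1] by simp
qed (use assms in auto)

text \<open>Each term is an integrand of \<open>Gamma (j + 1)\<close> divided by \<open>X\<close>,
  and \<open>X \<ge> c\<close> bounds that quotient. Staying away from 0 matters for the term
  \<open>j = 0\<close>.\<close>

lemma weight_bound_integrable:
  assumes "c > 0" "t > 0"
  shows "set_integrable lborel {c..} (weight_bound n k t)"
proof -
  have *: "set_integrable lborel {c..} (\<lambda>X. X ^ j * exp (- X / (2 * t)) / X)" for j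
  proof -
    have "set_integrable lborel {0<..} (\<lambda>X. complex_of_real X powr (of_nat (Suc j) - 1) * of_real (exp (- (1 / (2 * t)) * X)))"
      by (rule Gamma_set_integrable) (use assms in auto)
    then have "integrable lborel (\<lambda>X. 1 / c * norm (indicator {0<..} X *\<^sub>R (complex_of_real X powr (of_nat (Suc j) - 1) * of_real (exp (- (1 / (2 * t)) * X)))))"
      unfolding set_integrable_def by (intro integrable_mult_right integrable_norm)
    then show ?thesis
      unfolding set_integrable_def
    proof (rule Bochner_Integration.integrable_bound)
      show "AE X in lborel. norm (indicator {c..} X *\<^sub>R (X ^ j * exp (- X / (2 * t)) / X))
         \<le> norm (1 / c * norm (indicator {0<..} X *\<^sub>R (complex_of_real X powr (of_nat (Suc j) - 1) * of_real (exp (- (1 / (2 * t)) * X)))))"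
      proof (intro AE_I2)
        fix X :: real
        have "norm (complex_of_real X powr (of_nat (Suc j) - 1) * of_real (exp (- (1 / (2 * t)) * X))) = X ^ j * exp (- X / (2 * t))"
          if "X > 0" using that by (simp add: norm_mult norm_power powr_nat')
        moreover have "X ^ j * exp (- X / (2 * t)) / X \<le> X ^ j * exp (- X / (2 * t)) / c" if "X \<ge> c"
          using that assms by (intro divide_left_mono) auto
        ultimately show "norm (indicator {c..} X *\<^sub>R (X ^ j * exp (- X / (2 * t)) / X))
         \<le> norm (1 / c * norm (indicator {0<..} X *\<^sub>R (complex_of_real X powr (of_nat (Suc j) - 1) * of_real (exp (- (1 / (2 * t)) * X)))))"
          using assms by (cases "X \<ge> c") auto
      qed
    qed measurable
  qed
  have "set_integrable lborel {c..} (\<lambda>X. \<Sum>j\<le>Suc k. real (Suc k choose j) / t ^ j * pochhammer (real n) (Suc k - j) / fact k * (X ^ j * exp (- X / (2 * t)) / X))"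
    
    unfolding set_integrable_def scaleR_sum_right
    by (intro Bochner_Integration.integrable_sum) (rule set_integrable_mult_right[OF *, unfolded set_integrable_def])
  also have "(\<lambda>X. \<Sum>j\<le>Suc k. real (Suc k choose j) / t ^ j * pochhammer (real n) (Suc k - j) / fact k * (X ^ j * exp (- X / (2 * t)) / X)) = weight_bound n k t"
    unfolding weight_bound_def sum_divide_distrib by (intro ext sum.cong) (auto simp: mult_ac)
  finally show ?thesis .
qed

section \<open>Limits of sums of truncated powers\<close>

lemma kernel_nonneg: "0 \<le> x \<Longrightarrow> 0 \<le> kernel n k x"
  by (simp add: kernel_def)

lemma kernel_eq_0: "1 \<le> x \<Longrightarrow> k \<ge> 1 \<Longrightarrow> kernel n k x = 0"
  by (simp add: kernel_def power_0_left)

lemma kernel_le_1: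
  assumes "0 \<le> x" "k \<ge> 1"
  shows "kernel n k x \<le> 1"
proof (cases "x \<le> 1")
  case True
  then have "x ^ n * (1 - x) ^ k \<le> 1" using assms by (intro mult_le_one power_le_one) auto
  then show ?thesis using True by (simp add: kernel_def)
qed (use assms in \<open>simp add: kernel_eq_0\<close>)

lemma isCont_kernel: "isCont (kernel n k) x"
  unfolding kernel_def by (intro continuous_intros)

text \<open>Inserting \<open>kernel_inversion\<close> for every knot turns the sum into one line
  integral whose numerator is the given sum of complex powers. Growth of order \<open>p\<close>
  meets \<open>p + 2\<close> linear factors in the denominator, which leaves the integrable square
  in \<open>J\<close>; \<open>X^(-a)\<close> is the modulus of \<open>(1/X)^w\<close> on the
  line.\<close>

lemma kernel_sum_bound:
  fixes c :: "real \<Rightarrow> real"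
  assumes a: "a + 1 \<le> real n"
    and bound: "\<And>\<tau>. cmod (\<Sum>v\<in>S. of_real (c v) * of_real v powr (of_real a + \<i> * of_real \<tau>)) \<le> C * (1 + \<bar>\<tau>\<bar>) ^ p"
    and S: "finite S" "\<And>v. v \<in> S \<Longrightarrow> v > 0" and X: "X > 0"
  defines "J \<equiv> LINT \<tau>|lborel. 1 / (1 + \<bar>\<tau>\<bar>) ^ 2"
  shows "\<bar>\<Sum>v\<in>S. c v * kernel n (Suc p) (v / X)\<bar> \<le> fact (Suc p) * C * 2 ^ Suc (Suc p) * J * X powr (- a)"
proof -
  define k where "k = Suc p"
  define D where "D \<tau> = (\<Sum>v\<in>S. of_real (c v) * of_real v powr (of_real a + \<i> * of_real \<tau>))" for \<tau>
  define w where "w \<tau> = of_real a + \<i> * of_real \<tau>" for \<tau>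
  define f where "f v \<tau> = of_real (v / X) powr w \<tau> / kernel_den n k (w \<tau>)" for v \<tau>
  have k: "k \<ge> 1" by (simp add: k_def)
  have f_int: "integrable lborel (f v)" "(LINT \<tau>|lborel. f v \<tau>) = 2 * of_real pi / fact k * of_real (kernel n k (v / X))" if "v \<in> S" for v
    unfolding f_def w_def using kernel_inversion[OF _ k a, of "v / X"] S(2)[OF that] X by auto
  define g where "g \<tau> = (\<Sum>v\<in>S. of_real (c v) * f v \<tau>)" for \<tau>
  have g_int: "integrable lborel g"
    unfolding g_def by (intro Bochner_Integration.integrable_sum integrable_mult_right f_int)
  have g_val: "(LINT \<tau>|lborel. g \<tau>) = 2 * of_real pi / fact k * of_real (\<Sum>v\<in>S. c v * kernel n k (v / X))"
  proof -
    have "(LINT \<tau>|lborel. g \<tau>) = (\<Sum>v\<in>S. LINT \<tau>|lborel. of_real (c v) * f v \<tau>)"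
      unfolding g_def by (intro Bochner_Integration.integral_sum integrable_mult_right f_int)
    also have "\<dots> = (\<Sum>v\<in>S. of_real (c v) * (2 * of_real pi / fact k * of_real (kernel n k (v / X))))"
      by (intro sum.cong refl) (simp only: integral_mult_right_zero f_int)
    finally show ?thesis by (simp add: sum_distrib_left mult_ac)
  qed
  have g_eq: "g \<tau> = of_real (1 / X) powr w \<tau> * D \<tau> / kernel_den n k (w \<tau>)" for \<tau>
  proof -
    have "f v \<tau> = of_real (1 / X) powr w \<tau> * of_real v powr w \<tau> / kernel_den n k (w \<tau>)" if "v \<in> S" for v
    proof -
      have "complex_of_real (1 / X * v) powr w \<tau> = of_real (1 / X) powr w \<tau> * of_real v powr w \<tau>"
        unfolding of_real_mult using S(2)[OF that] X by (intro powr_times_real) (auto simp: less_imp_le)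
      then show ?thesis by (simp add: f_def)
    qed
    then show ?thesis unfolding g_def D_def w_def[symmetric] sum_distrib_left sum_divide_distrib
      by (intro sum.cong) (auto simp: mult_ac)
  qed
  have C: "C * (1 + \<bar>\<tau>\<bar>) ^ p \<ge> 0" for \<tau> using order_trans[OF norm_ge_zero bound] .
  have C0: "C \<ge> 0" using C[of 0] by simp
  have g_bound: "norm (g \<tau>) \<le> X powr (- a) * C * 2 ^ Suc k * (1 / (1 + \<bar>\<tau>\<bar>) ^ 2)" for \<tau>
  proof -
    have n1: "cmod (of_real (1 / X) powr w \<tau>) = X powr (- a)"
      using X by (simp add: norm_powr_real_powr w_def powr_divide powr_minus_divide)
    have n2: "((1 + \<bar>\<tau>\<bar>) / 2) ^ Suc k \<le> cmod (kernel_den n k (w \<tau>))"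
      unfolding w_def by (rule kernel_den_line[OF a])
    have n3: "0 < ((1 + \<bar>\<tau>\<bar>) / 2) ^ Suc k" by (intro zero_less_power) auto
    have "norm (g \<tau>) = X powr (- a) * cmod (D \<tau>) / cmod (kernel_den n k (w \<tau>))"
      unfolding g_eq norm_divide norm_mult n1 ..
    also have "\<dots> \<le> X powr (- a) * (C * (1 + \<bar>\<tau>\<bar>) ^ p) / ((1 + \<bar>\<tau>\<bar>) / 2) ^ Suc k"
      using C0 by (intro frac_le mult_left_mono n2 n3 mult_nonneg_nonneg) (auto simp: D_def bound)
    also have "\<dots> = X powr (- a) * C * 2 ^ Suc k * (1 / (1 + \<bar>\<tau>\<bar>) ^ 2)"
    proof -
      have "(1 + \<bar>\<tau>\<bar>) ^ Suc k = (1 + \<bar>\<tau>\<bar>) ^ p * (1 + \<bar>\<tau>\<bar>) ^ 2" by (simp add: k_def power2_eq_square)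
      moreover have "(1 + \<bar>\<tau>\<bar>) ^ p > 0" by (intro zero_less_power) auto
      ultimately show ?thesis by (simp add: power_divide)
    qed
    finally show ?thesis .
  qed
  have "norm (LINT \<tau>|lborel. g \<tau>) \<le> (LINT \<tau>|lborel. X powr (- a) * C * 2 ^ Suc k * (1 / (1 + \<bar>\<tau>\<bar>) ^ 2))"
    by (rule order_trans[OF integral_norm_bound integral_mono])
       (intro integrable_norm g_int integrable_mult_right integrable_1_plus_abs_power g_bound)+
  also have "\<dots> = X powr (- a) * C * 2 ^ Suc k * J" unfolding J_def by (rule integral_mult_right_zero)
  finally have "2 * pi / fact k * \<bar>\<Sum>v\<in>S. c v * kernel n k (v / X)\<bar> \<le> X powr (- a) * C * 2 ^ Suc k * J"
    unfolding g_val norm_mult norm_of_real by (simp add: norm_divide norm_mult)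
  then have *: "2 * pi * \<bar>\<Sum>v\<in>S. c v * kernel n k (v / X)\<bar> \<le> fact k * C * 2 ^ Suc k * J * X powr (- a)"
    by (simp add: field_simps)
  have "1 * \<bar>\<Sum>v\<in>S. c v * kernel n k (v / X)\<bar> \<le> 2 * pi * \<bar>\<Sum>v\<in>S. c v * kernel n k (v / X)\<bar>"
    using pi_ge_two by (intro mult_right_mono) auto
  with * show ?thesis unfolding k_def by linarith
qed

lemma continuous_on_weight:
  assumes "0 < c"
  shows "continuous_on {c..T} (weight n k N T)"
proof -
  have "X \<noteq> 0" if "X \<in> {c..T}" for X using that assms by auto
  then show ?thesis
    unfolding weight_def divide_inverse[of _ T] divide_inverse[of _ "T ^ _"]
    by (intro continuous_intros) auto
qed

text \<open>Because the kernel vanishes for \<open>X \<le> v\<close>, the range can start at a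
  common \<open>c\<close> for all knots, so that finite sums over knots can be taken under the
  integral. If \<open>v \<ge> T\<close>, both sides are 0.\<close>

lemma weight_representation_lebesgue:
  assumes c: "0 < c" "c \<le> v" and k: "k \<ge> 1" and n: "n \<ge> 1" and N: "N > Suc k" and T: "T > 0"
  shows "integrable lborel (\<lambda>X. indicator {c..T} X * (weight n k N T X * kernel n k (v / X)))"
    and "(LINT X|lborel. indicator {c..T} X * (weight n k N T X * kernel n k (v / X))) = max (1 - v / T) 0 ^ N"
proof -
  have v: "v > 0" using c by simp
  have "integrable lborel (\<lambda>X. indicator {c..T} X * (weight n k N T X * kernel n k (v / X))) \<and>
     (LINT X|lborel. indicator {c..T} X * (weight n k N T X * kernel n k (v / X))) = max (1 - v / T) 0 ^ N"
  proof (cases "v < T")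
    case False
    then have "indicator {c..T} X * (weight n k N T X * kernel n k (v / X)) = 0" for X
      using c k by (auto simp: indicator_def intro!: kernel_eq_0)
    moreover have "max (1 - v / T) 0 ^ N = 0" using False T N by simp
    ultimately show ?thesis by (simp only:) simp
  next
    case True
    have "continuous_on {v..T} (\<lambda>X. weight n k N T X * kernel n k (v / X))"
      using v by (intro continuous_on_mult continuous_on_weight continuous_at_imp_continuous_on ballI
          continuous_at_compose[OF _ isCont_kernel, unfolded o_def] continuous_intros) auto
    then have si: "set_integrable lborel {v..T} (\<lambda>X. weight n k N T X * kernel n k (v / X))"
      by (rule borel_integrable_atLeastAtMost')
    have eq: "indicator {v..T} X *\<^sub>R (weight n k N T X * kernel n k (v / X)) = indicator {c..T} X * (weight n k N T X * kernel n k (v / X))" for X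
      using c k by (auto simp: indicator_def intro!: kernel_eq_0)
    have "(LBINT X:{v..T}. weight n k N T X * kernel n k (v / X)) = (1 - v / T) ^ N"
      using set_borel_integral_eq_integral(2)[OF si] weight_representation[OF v True n N] by (simp add: integral_unique)
    moreover have "max (1 - v / T) 0 = 1 - v / T" using True T by simp
    ultimately show ?thesis
      using si unfolding set_integrable_def set_lebesgue_integral_def eq by simp
  qed
  then show "integrable lborel (\<lambda>X. indicator {c..T} X * (weight n k N T X * kernel n k (v / X)))"
    "(LINT X|lborel. indicator {c..T} X * (weight n k N T X * kernel n k (v / X))) = max (1 - v / T) 0 ^ N" by auto
qed

lemma indicator_weight_bound:
  assumes "N \<ge> 2 * Suc k" "c > 0" "t > 0"
  shows "\<bar>indicator {c..real N * t} X * weight n k N (real N * t) X\<bar> \<le> indicator {c..} X * weight_bound n k t X"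
proof (cases "X \<in> {c..real N * t}")
  case True
  then show ?thesis
    using weight_nonneg[of k N X "real N * t" n] weight_le_bound[of k N X t n] assms by auto
next
  case False
  have "0 \<le> weight_bound n k t X" if "X \<ge> c"
    unfolding weight_bound_def using that assms
    by (intro divide_nonneg_nonneg sum_nonneg mult_nonneg_nonneg pochhammer_of_nat_nonneg zero_le_power) auto
  then show ?thesis using False by (auto simp: indicator_def)
qed

lemma indicator_weight_tendsto:
  assumes "c > 0" "t > 0"
  shows "(\<lambda>N. indicator {c..real N * t} X * weight n k N (real N * t) X) \<longlonglongrightarrow> indicator {c..} X * weight_lim n k t X"
proof (cases "X \<ge> c")
  case True
  have "eventually (\<lambda>N. real N > X / t) sequentially"
    using filterlim_real_sequentially by (simp add: filterlim_at_top_dense)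
  then have "eventually (\<lambda>N. weight n k N (real N * t) X = indicator {c..real N * t} X * weight n k N (real N * t) X) sequentially"
  proof eventually_elim
    case (elim N)
    then have "X \<in> {c..real N * t}" using True assms by (simp add: field_simps)
    then show ?case by simp
  qed
  moreover have "(\<lambda>N. weight n k N (real N * t) X) \<longlonglongrightarrow> indicator {c..} X * weight_lim n k t X"
    using weight_tendsto[of X t n k] True assms by simp
  ultimately show ?thesis by (rule Lim_transform_eventually[rotated])
qed simp

lemma measurable_kernel [measurable]: "kernel n k \<in> borel_measurable borel"
  unfolding kernel_def[abs_def] by measurable

lemma measurable_weight [measurable]: "weight n k N T \<in> borel_measurable borel"
  unfolding weight_def[abs_def] by measurable

lemma measurable_weight_lim [measurable]: "weight_lim n k t \<in> borel_measurable borel"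
  unfolding weight_lim_def[abs_def] by measurable

text \<open>The limit of the preceding representation with \<open>T = N t\<close>, by dominated
  convergence: the weights converge and \<open>(1 - v/(N t))_+^N\<close> tends to
  \<open>exp (- v/t)\<close>.\<close>

lemma exp_representation:
  assumes c: "0 < c" "c \<le> v" and k: "k \<ge> 1" and n: "n \<ge> 1" and t: "t > 0"
  shows "integrable lborel (\<lambda>X. indicator {c..} X * weight_lim n k t X * kernel n k (v / X))"
    and "(LINT X|lborel. indicator {c..} X * weight_lim n k t X * kernel n k (v / X)) = exp (- v / t)"
proof -
  define s where "s i X = indicator {c..real (i + 2 * Suc k) * t} X * weight n k (i + 2 * Suc k) (real (i + 2 * Suc k) * t) X * kernel n k (v / X)" for i X
  have v: "v > 0" using c by simp
  have lim: "(\<lambda>i. s i X) \<longlonglongrightarrow> indicator {c..} X * weight_lim n k t X * kernel n k (v / X)" for X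
    unfolding s_def by (intro tendsto_intros LIMSEQ_ignore_initial_segment[OF indicator_weight_tendsto[OF c(1) t]])
  have dom: "norm (s i X) \<le> indicator {c..} X * weight_bound n k t X" for i X
  proof (cases "X \<ge> c")
    case True
    then have "\<bar>kernel n k (v / X)\<bar> \<le> 1"
      using kernel_le_1[of "v / X" k n] kernel_nonneg[of "v / X" n k] k v c by simp
    then have "norm (s i X) \<le> \<bar>indicator {c..real (i + 2 * Suc k) * t} X * weight n k (i + 2 * Suc k) (real (i + 2 * Suc k) * t) X\<bar> * 1"
      unfolding s_def real_norm_def abs_mult by (intro mult_left_mono) auto
    also have "\<dots> \<le> indicator {c..} X * weight_bound n k t X"
      using indicator_weight_bound[of k "i + 2 * Suc k" c t X n] c t by simp
    finally show ?thesis .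
  qed (simp add: s_def)
  have W: "integrable lborel (\<lambda>X. indicator {c..} X * weight_bound n k t X)"
    using weight_bound_integrable[OF c(1) t, of n k] by (simp add: set_integrable_def)
  have meas: "s i \<in> borel_measurable lborel" for i unfolding s_def by measurable
  have val: "(LINT X|lborel. s i X) = max (1 - v / (real (i + 2 * Suc k) * t)) 0 ^ (i + 2 * Suc k)" for i
    unfolding s_def mult.assoc[of "indicator _ _"]
    by (rule weight_representation_lebesgue) (use c k n t in \<open>auto intro!: mult_pos_pos\<close>)
  show "integrable lborel (\<lambda>X. indicator {c..} X * weight_lim n k t X * kernel n k (v / X))"
    by (rule integrable_dominated_convergence[where s = s and w = "\<lambda>X. indicator {c..} X * weight_bound n k t X"])
       (use meas W lim dom in auto)
  have "(\<lambda>i. LINT X|lborel. s i X) \<longlonglongrightarrow> (LINT X|lborel. indicator {c..} X * weight_lim n k t X * kernel n k (v / X))"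
    by (rule integral_dominated_convergence[where w = "\<lambda>X. indicator {c..} X * weight_bound n k t X"])
       (use meas W lim dom in auto)
  moreover have "(\<lambda>i. LINT X|lborel. s i X) \<longlonglongrightarrow> exp (- v / t)"
    unfolding val
  proof (rule LIMSEQ_ignore_initial_segment)
    have "eventually (\<lambda>N. real N > v / t) sequentially"
      using filterlim_real_sequentially by (simp add: filterlim_at_top_dense)
    then have "eventually (\<lambda>N. (1 + (- v / t) / real N) ^ N = max (1 - v / (real N * t)) 0 ^ N) sequentially"
    proof eventually_elim
      case (elim N)
      have "real N > 0" using elim v t by (metis divide_pos_pos order_less_trans)
      then have "1 - v / (real N * t) \<ge> 0" using elim t by (simp add: field_simps)
      then show ?case by (simp add: mult.commute)
    qed
    then show "(\<lambda>N. max (1 - v / (real N * t)) 0 ^ N) \<longlonglongrightarrow> exp (- v / t)"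
      by (rule Lim_transform_eventually[OF tendsto_exp_limit_sequentially])
  qed
  ultimately show "(LINT X|lborel. indicator {c..} X * weight_lim n k t X * kernel n k (v / X)) = exp (- v / t)"
    by (rule LIMSEQ_unique)
qed

text \<open>The analytic core, free of any reference to polynomials. The limit passes through the
  averaged kernel sums, and the resulting integral is expanded again, term by term, with
  \<open>exp_representation\<close>.\<close>

theorem truncated_power_sum_tendsto:
  fixes S :: "nat \<Rightarrow> real set" and A :: "nat \<Rightarrow> real \<Rightarrow> real" and \<alpha> \<xi> :: "nat \<Rightarrow> real"
  assumes t: "t > 0" and c: "c > 0" and a: "a \<ge> 0" "a + 1 \<le> real n"
    and S: "\<forall>\<^sub>F N in sequentially. finite (S N) \<and> (\<forall>v\<in>S N. c \<le> v)"
    and bound: "\<forall>\<^sub>F N in sequentially. \<forall>\<tau>. cmod (\<Sum>v\<in>S N. of_real (A N v) * of_real v powr (of_real a + \<i> * of_real \<tau>)) \<le> C * (1 + \<bar>\<tau>\<bar>) ^ p"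
    and lim: "\<And>X. X > 0 \<Longrightarrow> (\<lambda>N. \<Sum>v\<in>S N. A N v * kernel n (Suc p) (v / X)) \<longlonglongrightarrow> (\<Sum>j. \<alpha> j * kernel n (Suc p) (\<xi> j / X))"
    and \<xi>: "\<And>j. c \<le> \<xi> j" "\<And>X. finite {j. \<xi> j < X}"
    and summ: "summable (\<lambda>j. \<bar>\<alpha> j\<bar> * exp (- \<xi> j / t))"
  shows "(\<lambda>N. \<Sum>v\<in>S N. A N v * max (1 - v / (real N * t)) 0 ^ N) \<longlonglongrightarrow> (\<Sum>j. \<alpha> j * exp (- \<xi> j / t))"
proof -
  define k where "k = Suc p"
  have k: "k \<ge> 1" by (simp add: k_def)
  have n: "n \<ge> 1" using a by simp
  define R where "R N X = (\<Sum>v\<in>S N. A N v * kernel n k (v / X))" for N X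
  define R' where "R' X = (\<Sum>j. \<alpha> j * kernel n k (\<xi> j / X))" for X
  define J where "J = (LINT \<tau>|lborel. 1 / (1 + \<bar>\<tau>\<bar>) ^ 2 :: real)"
  \<comment> \<open>Since \<open>a \<ge> 0\<close>, the factor \<open>X^(-a)\<close> of
    \<open>kernel_sum_bound\<close> is largest at \<open>X = c\<close>; below \<open>c\<close> the
    kernel sees no knot.\<close>
  define B where "B = \<bar>fact (Suc p) * C * 2 ^ Suc (Suc p) * J\<bar> * c powr (- a)"
  obtain N1 where N1: "\<And>N. N \<ge> N1 \<Longrightarrow> finite (S N)" "\<And>N v. N \<ge> N1 \<Longrightarrow> v \<in> S N \<Longrightarrow> c \<le> v"
    "\<And>N \<tau>. N \<ge> N1 \<Longrightarrow> cmod (\<Sum>v\<in>S N. of_real (A N v) * of_real v powr (of_real a + \<i> * of_real \<tau>)) \<le> C * (1 + \<bar>\<tau>\<bar>) ^ p"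
    using eventually_conj[OF S bound] unfolding eventually_sequentially by blast
  define M where "M = N1 + 2 * Suc k"
  have M: "i + M \<ge> N1" "i + M \<ge> 2 * Suc k" "i + M > Suc k" for i by (auto simp: M_def)
  define s where "s i X = indicator {c..real (i + M) * t} X * weight n k (i + M) (real (i + M) * t) X * R (i + M) X" for i X
  have RB: "\<bar>R N X\<bar> \<le> B" if "N \<ge> N1" "X \<ge> c" for N X
  proof -
    have "\<bar>R N X\<bar> \<le> fact (Suc p) * C * 2 ^ Suc (Suc p) * J * X powr (- a)"
      unfolding R_def k_def J_def
      by (rule kernel_sum_bound[OF a(2) N1(3)]) (use N1(1)[OF that(1)] N1(2)[OF that(1)] that c in force)+
    also have "\<dots> \<le> \<bar>fact (Suc p) * C * 2 ^ Suc (Suc p) * J\<bar> * X powr (- a)"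
      by (intro mult_right_mono) auto
    also have "\<dots> \<le> B" unfolding B_def using that c a by (intro mult_left_mono powr_mono2') auto
    finally show ?thesis .
  qed
  have lim': "(\<lambda>i. s i X) \<longlonglongrightarrow> indicator {c..} X * weight_lim n k t X * R' X" for X
  proof (cases "X \<ge> c")
    case True
    then have "R' X = (\<Sum>j. \<alpha> j * kernel n (Suc p) (\<xi> j / X))" "X > 0" using c by (auto simp: R'_def k_def)
    then show ?thesis
      unfolding s_def R_def k_def
      by (intro tendsto_mult LIMSEQ_ignore_initial_segment[OF indicator_weight_tendsto[OF c t]])
         (simp only: LIMSEQ_ignore_initial_segment[OF lim])
  qed (simp add: s_def)
  have dom: "norm (s i X) \<le> B * (indicator {c..} X * weight_bound n k t X)" for i X
  proof (cases "X \<ge> c")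
    case True
    have "norm (s i X) = \<bar>R (i + M) X\<bar> * \<bar>indicator {c..real (i + M) * t} X * weight n k (i + M) (real (i + M) * t) X\<bar>"
      by (simp add: s_def abs_mult)
    also have "\<dots> \<le> B * (indicator {c..} X * weight_bound n k t X)"
      using RB[OF M(1) True] by (intro mult_mono indicator_weight_bound M c t) (auto simp: B_def)
    finally show ?thesis .
  qed (simp add: s_def)
  have W: "integrable lborel (\<lambda>X. B * (indicator {c..} X * weight_bound n k t X))"
    using weight_bound_integrable[OF c t, of n k] by (intro integrable_mult_right) (simp add: set_integrable_def)
  have meas: "s i \<in> borel_measurable lborel" for i unfolding s_def R_def by measurable
  have val: "(LINT X|lborel. s i X) = (\<Sum>v\<in>S (i + M). A (i + M) v * max (1 - v / (real (i + M) * t)) 0 ^ (i + M))" for i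
  proof -
    define T where "T = real (i + M) * t"
    have T: "T > 0" using t M(3)[of i] by (auto simp: T_def intro!: mult_pos_pos)
    have "s i X = (\<Sum>v\<in>S (i + M). A (i + M) v * (indicator {c..T} X * (weight n k (i + M) T X * kernel n k (v / X))))" for X
      unfolding s_def R_def T_def sum_distrib_left by (intro sum.cong) auto
    then have "(LINT X|lborel. s i X) = (\<Sum>v\<in>S (i + M). LINT X|lborel. A (i + M) v * (indicator {c..T} X * (weight n k (i + M) T X * kernel n k (v / X))))"
      by (simp only:) (intro Bochner_Integration.integral_sum integrable_mult_right weight_representation_lebesgue(1) c k n T M N1(2)[OF M(1)])
    also have "\<dots> = (\<Sum>v\<in>S (i + M). A (i + M) v * max (1 - v / T) 0 ^ (i + M))"
    proof (rule sum.cong[OF refl])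
      fix v assume "v \<in> S (i + M)"
      then have "c \<le> v" using N1(2)[OF M(1)] by simp
      then show "(LINT X|lborel. A (i + M) v * (indicator {c..T} X * (weight n k (i + M) T X * kernel n k (v / X)))) = A (i + M) v * max (1 - v / T) 0 ^ (i + M)"
        by (simp only: integral_mult_right_zero weight_representation_lebesgue(2)[OF c _ k n M(3) T])
    qed
    finally show ?thesis by (simp only: T_def)
  qed
  have fin: "\<alpha> j * kernel n k (\<xi> j / X) = 0" if "j \<notin> {j. \<xi> j < X}" "X \<ge> c" for j X
    using that c k by (simp add: kernel_eq_0)
  have R'_sums: "(\<lambda>j. \<alpha> j * kernel n k (\<xi> j / X)) sums R' X" if "X \<ge> c" for X
    unfolding R'_def by (rule summable_sums, rule summable_finite[OF \<xi>(2)[of X]]) (rule fin[OF _ that])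
  define F where "F j X = \<alpha> j * (indicator {c..} X * weight_lim n k t X * kernel n k (\<xi> j / X))" for j X
  have F_int: "integrable lborel (F j)" for j
    unfolding F_def by (intro integrable_mult_right exp_representation c \<xi> k n t)
  have wl: "0 \<le> weight_lim n k t X" if "X \<ge> c" for X
    unfolding weight_lim_def using that c t
    by (intro divide_nonneg_nonneg sum_nonneg mult_nonneg_nonneg pochhammer_of_nat_nonneg zero_le_power) auto
  have F_norm: "norm (F j X) = \<bar>\<alpha> j\<bar> * (indicator {c..} X * weight_lim n k t X * kernel n k (\<xi> j / X))" for j X
  proof (cases "X \<ge> c")
    case True
    have "0 \<le> kernel n k (\<xi> j / X)" using True c \<xi>(1)[of j] by (intro kernel_nonneg) auto
    then show ?thesis using wl[OF True] by (simp add: F_def abs_mult)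
  qed (simp add: F_def)
  \<comment> \<open>Weight and kernel are nonnegative, so the norm of each term integrates exactly
    to \<open>|\<alpha> j| exp (- \<xi> j / t)\<close>; the summability assumption is thus what the
    interchange of sum and integral asks for.\<close>
  have F_norm_int: "(LINT X|lborel. norm (F j X)) = \<bar>\<alpha> j\<bar> * exp (- \<xi> j / t)" for j
    unfolding F_norm by (simp only: integral_mult_right_zero exp_representation(2)[OF c \<xi>(1) k n t])
  have F_val: "(LINT X|lborel. F j X) = \<alpha> j * exp (- \<xi> j / t)" for j
    unfolding F_def by (simp only: integral_mult_right_zero exp_representation(2)[OF c \<xi>(1) k n t])
  have F_sums: "(\<lambda>j. F j X) sums (indicator {c..} X * weight_lim n k t X * R' X)" for X
  proof (cases "X \<ge> c")
    case True
    have "(\<lambda>j. indicator {c..} X * weight_lim n k t X * (\<alpha> j * kernel n k (\<xi> j / X))) sums (indicator {c..} X * weight_lim n k t X * R' X)"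
      by (rule sums_mult[OF R'_sums[OF True]])
    then show ?thesis by (simp only: F_def mult_ac)
  qed (simp add: F_def)
  have F_summ: "summable (\<lambda>j. norm (F j X))" for X
  proof (cases "X \<ge> c")
    case True
    show ?thesis
      by (rule summable_finite[OF \<xi>(2)[of X]]) (use True c k in \<open>simp add: F_def kernel_eq_0\<close>)
  qed (simp add: F_def)
  have "(LINT X|lborel. (\<Sum>j. F j X)) = (\<Sum>j. LINT X|lborel. F j X)"
    by (rule integral_suminf) (use F_int F_summ summ in \<open>simp_all only: F_norm_int AE_I2\<close>)
  moreover have "(\<Sum>j. F j X) = indicator {c..} X * weight_lim n k t X * R' X" for X
    using F_sums by (rule sums_unique[symmetric])
  ultimately have lim_val: "(LINT X|lborel. indicator {c..} X * weight_lim n k t X * R' X) = (\<Sum>j. \<alpha> j * exp (- \<xi> j / t))"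
    by (simp only: F_val)
  have meas': "(\<lambda>X. indicator {c..} X * weight_lim n k t X * R' X) \<in> borel_measurable lborel"
    by (rule borel_measurable_LIMSEQ_metric[OF meas lim'])
  have "(\<lambda>i. LINT X|lborel. s i X) \<longlonglongrightarrow> (LINT X|lborel. indicator {c..} X * weight_lim n k t X * R' X)"
    by (rule integral_dominated_convergence[where w = "\<lambda>X. B * (indicator {c..} X * weight_bound n k t X)"])
       (use meas meas' W lim' dom in auto)
  then show ?thesis
    unfolding val lim_val by (rule LIMSEQ_offset)
qed

section \<open>The Mellin transform of a partial fraction expansion\<close>

text \<open>
  Expanding \<open>t\<^sup>m / \<Prod>(1 + t/v)\<close> instead of \<open>1 / \<Prod>(1 + t/v)\<close> moves the exponent of each term into the strip
  \<open>(0, 1)\<close>, where the single integrals converge. Integer \<open>Re z\<close> is excluded here and recovered by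
  continuity in the next lemma.
\<close>

lemma Mellin_partial_fractions_aux:
  fixes V :: "real set" and z :: complex
  assumes V: "finite V" "\<And>v. v \<in> V \<Longrightarrow> v > 0"
    and z: "real m < Re z" "Re z < real (Suc m)" "m < card V"
  defines "f \<equiv> \<lambda>t::real. of_real t powr (z - 1) / of_real (\<Prod>v\<in>V. 1 + t / v) :: complex"
  shows "set_integrable lborel {0<..} f"
    and "sin (of_real pi * z) * (LBINT t:{0<..}. f t) = of_real pi * (\<Sum>v\<in>V. of_real (pf_coeff V v) * of_real v powr z)"
proof -
  define w where "w = z - of_nat m"
  have w: "0 < Re w" "Re w < 1" using z by (auto simp: w_def)
  define h where "h v t = of_real (pf_coeff V v * (- v) ^ m) * (of_real t powr (w - 1) / of_real (1 + t / v) :: complex)" for v t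
  have eq: "f t = (\<Sum>v\<in>V. h v t)" if "t > 0" for t
  proof -
    have "of_real t powr (z - 1) = of_real t powr (w - 1) * (complex_of_real t powr of_nat m)"
      unfolding powr_add[symmetric] by (simp add: w_def)
    also have "complex_of_real t powr of_nat m = of_real (t ^ m)" using that by (simp add: powr_nat')
    finally have "f t = of_real t powr (w - 1) * of_real (t ^ m / (\<Prod>v\<in>V. 1 + t / v))"
      unfolding f_def of_real_divide by simp
    also have "t ^ m / (\<Prod>v\<in>V. 1 + t / v) = (\<Sum>v\<in>V. pf_coeff V v * (- v) ^ m / (1 + t / v))"
      by (rule partial_fraction_power) (use V z that in auto)
    finally show ?thesis
      unfolding h_def by (simp add: sum_distrib_left mult_ac)
  qed
  have ih: "set_integrable lborel {0<..} (h v)" if "v \<in> V" for v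
    unfolding h_def by (intro set_integrable_mult_right Mellin_inverse_1_plus_scaled w V that)
  have "set_integrable lborel {0<..} (\<lambda>t. \<Sum>v\<in>V. h v t)"
    unfolding set_integrable_def scaleR_sum_right
    by (intro Bochner_Integration.integrable_sum) (rule ih[unfolded set_integrable_def])
  also have "set_integrable lborel {0<..} (\<lambda>t. \<Sum>v\<in>V. h v t) = set_integrable lborel {0<..} f"
    by (rule set_integrable_cong) (auto simp: eq)
  finally show "set_integrable lborel {0<..} f" .
  have "(LBINT t:{0<..}. f t) = (LBINT t:{0<..}. \<Sum>v\<in>V. h v t)"
    by (rule set_lebesgue_integral_cong) (auto simp: eq)
  also have "\<dots> = (\<Sum>v\<in>V. LBINT t:{0<..}. h v t)"
    unfolding set_lebesgue_integral_def scaleR_sum_right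
    by (intro Bochner_Integration.integral_sum) (rule ih[unfolded set_integrable_def])
  also have "\<dots> = (\<Sum>v\<in>V. of_real (pf_coeff V v * (- v) ^ m) * (of_real v powr w * (of_real pi / sin (of_real pi * w))))"
    unfolding h_def
    by (intro sum.cong refl) (simp only: set_integral_mult_right Mellin_inverse_1_plus_scaled(2)[OF w V(2)])
  finally have *: "(LBINT t:{0<..}. f t) = \<dots>" .
  have snz: "sin (of_real pi * w) \<noteq> 0"
  proof
    assume "sin (of_real pi * w) = 0"
    then obtain n :: int where "of_real pi * w = of_real (real_of_int n * pi)"
      by (auto simp: sin_eq_0)
    then have "Re (of_real pi * w) = real_of_int n * pi" by (simp only: Re_complex_of_real)
    then have "Re w = of_int n" by simp
    then show False using w by auto
  qed
  \<comment> \<open>This sign cancels the one in \<open>(- v)^m\<close>, so the final formula has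
    the same shape for every \<open>m\<close>.\<close>
  have sz: "sin (of_real pi * z) = (- 1) ^ m * sin (of_real pi * w)"
  proof -
    have "of_real pi * z = of_real pi * w + of_real (real m * pi)" by (simp add: w_def algebra_simps)
    then have "sin (of_real pi * z) = sin (of_real pi * w) * cos (of_real (real m * pi)) + cos (of_real pi * w) * sin (of_real (real m * pi))"
      by (simp only: sin_add)
    also have "cos (of_real (real m * pi)) = (of_real (cos (real m * pi)) :: complex)" by (rule cos_of_real)
    also have "sin (of_real (real m * pi)) = (of_real (sin (real m * pi)) :: complex)" by (rule sin_of_real)
    finally show ?thesis by (simp add: cos_npi)
  qed
  have "sin (of_real pi * z) * (LBINT t:{0<..}. f t)
     = (\<Sum>v\<in>V. of_real pi * (of_real (pf_coeff V v) * ((- 1) ^ m * (- of_real v) ^ m * of_real v powr w)))"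
    unfolding * sz sum_distrib_left using snz by (intro sum.cong) auto
  also have "\<dots> = (\<Sum>v\<in>V. of_real pi * (of_real (pf_coeff V v) * of_real v powr z))"
  proof (intro sum.cong refl)
    fix v assume v: "v \<in> V"
    have "(- 1) ^ m * (- complex_of_real v) ^ m = of_real v ^ m" by (simp flip: power_mult_distrib)
    also have "\<dots> = of_real v powr of_nat m" using V(2)[OF v] by (simp add: powr_nat')
    finally have "(- 1) ^ m * (- of_real v) ^ m * of_real v powr w = complex_of_real v powr (of_nat m + w)"
      by (simp only: powr_add)
    then show "of_real pi * (of_real (pf_coeff V v) * ((- 1) ^ m * (- of_real v) ^ m * of_real v powr w))
       = of_real pi * (of_real (pf_coeff V v) * of_real v powr z)" by (simp add: w_def)
  qed
  finally show "sin (of_real pi * z) * (LBINT t:{0<..}. f t) = of_real pi * (\<Sum>v\<in>V. of_real (pf_coeff V v) * of_real v powr z)"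
    by (simp add: sum_distrib_left)
qed

text \<open>If \<open>Re z\<close> is an integer \<open>m\<close>, then \<open>m \<ge> 1\<close>,
  and the lines \<open>m - 1/2\<close> and \<open>m + 1/2\<close> both lie in strips already
  treated. Their integrands dominate those at points approaching \<open>z\<close> from the right.
  Keeping the sine as a factor on the left avoids dividing by zero at integers.\<close>

lemma Mellin_partial_fractions:
  fixes V :: "real set" and z :: complex
  assumes V: "finite V" "\<And>v. v \<in> V \<Longrightarrow> v > 0"
    and z: "0 < Re z" "Re z < real (card V)"
  defines "f \<equiv> \<lambda>z t. of_real t powr (z - 1) / of_real (\<Prod>v\<in>V. 1 + t / v) :: complex"
  shows "set_integrable lborel {0<..} (f z)"
    and "sin (of_real pi * z) * (LBINT t:{0<..}. f z t) = of_real pi * (\<Sum>v\<in>V. of_real (pf_coeff V v) * of_real v powr z)"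
proof -
  define m where "m = nat \<lfloor>Re z\<rfloor>"
  have m: "real m \<le> Re z" "Re z < real m + 1" using z by (auto simp: m_def)
  then have mV: "m < card V" using z by linarith
  have "set_integrable lborel {0<..} (f z) \<and>
    sin (of_real pi * z) * (LBINT t:{0<..}. f z t) = of_real pi * (\<Sum>v\<in>V. of_real (pf_coeff V v) * of_real v powr z)"
  proof (cases "Re z = real m")
    case False
    then have 1: "real m < Re z" "Re z < real (Suc m)" using m by auto
    show ?thesis
      using Mellin_partial_fractions_aux[OF V 1 mV] unfolding f_def by blast
  next
    case Rez: True
    then have m1: "m \<ge> 1" using z by (cases m) auto
    \<comment> \<open>The shifts start at 1/2, so every \<open>zn n\<close> lies strictly between
      the lines \<open>m\<close> and \<open>m + 1\<close> and is covered by the majorant for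
      \<open>m + 1/2\<close>.\<close>
    define zn where "zn n = z + of_real (inverse (real (Suc (Suc n))))" for n
    have zn_lim: "zn \<longlonglongrightarrow> z"
    proof -
      have "(\<lambda>n. z + of_real (inverse (real (Suc (Suc n))))) \<longlonglongrightarrow> z + of_real 0"
        by (intro tendsto_intros LIMSEQ_Suc[OF LIMSEQ_inverse_real_of_nat])
      then show ?thesis by (simp add: zn_def[abs_def])
    qed
    have Re_zn: "real m < Re (zn n)" "Re (zn n) \<le> Re z + 1 / 2" "Re (zn n) < real (Suc m)" for n
      using Rez by (auto simp: zn_def field_simps)
    have aux: "set_integrable lborel {0<..} (f (zn n))"
      "sin (of_real pi * zn n) * (LBINT t:{0<..}. f (zn n) t) = of_real pi * (\<Sum>v\<in>V. of_real (pf_coeff V v) * of_real v powr zn n)" for n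
      using Mellin_partial_fractions_aux[OF V Re_zn(1,3) mV, of n] unfolding f_def by blast+
    have i1: "set_integrable lborel {0<..} (f (of_real (Re z - 1 / 2)))"
      unfolding f_def
      by (rule Mellin_partial_fractions_aux[where m = "m - 1"]) (use Rez m1 mV V in \<open>auto simp: of_nat_diff\<close>)
    have i2: "set_integrable lborel {0<..} (f (of_real (Re z + 1 / 2)))"
      unfolding f_def
      by (rule Mellin_partial_fractions_aux[where m = m]) (use Rez mV V in auto)
    define W where "W t = norm (indicator {0<..} t *\<^sub>R f (of_real (Re z - 1 / 2)) t) + norm (indicator {0<..} t *\<^sub>R f (of_real (Re z + 1 / 2)) t)" for t
    have W: "integrable lborel W"
      unfolding W_def using i1 i2 unfolding set_integrable_def by (intro Bochner_Integration.integrable_add integrable_norm)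
    have P: "(\<Prod>v\<in>V. 1 + t / v) > 0" if "t > 0" for t
      using V that by (intro prod_pos) (auto intro!: add_pos_pos)
    have nf: "norm (f w t) = t powr (Re w - 1) / (\<Prod>v\<in>V. 1 + t / v)" if "t > 0" for w t
      using that P[OF that] unfolding f_def norm_divide norm_of_real
      by (simp add: norm_powr_real_powr)
    have dom: "norm (indicator {0<..} t *\<^sub>R f (zn n) t) \<le> W t" for n t
    proof (cases "t > 0")
      case True
      have "t powr (Re (zn n) - 1) \<le> t powr (Re z - 1 / 2 - 1) + t powr (Re z + 1 / 2 - 1)"
      proof (cases "t \<le> 1")
        case t1: True
        have "t powr (Re (zn n) - 1) \<le> t powr (Re z - 1 / 2 - 1)"
          using True t1 Re_zn[of n] Rez by (intro powr_mono') auto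
        then show ?thesis using powr_ge_zero[of t "Re z + 1 / 2 - 1"] by linarith
      next
        case False
        then have "t powr (Re (zn n) - 1) \<le> t powr (Re z + 1 / 2 - 1)"
          using Re_zn[of n] by (intro powr_mono) auto
        then show ?thesis using powr_ge_zero[of t "Re z - 1 / 2 - 1"] by linarith
      qed
      then have "t powr (Re (zn n) - 1) / (\<Prod>v\<in>V. 1 + t / v) \<le> (t powr (Re z - 1 / 2 - 1) + t powr (Re z + 1 / 2 - 1)) / (\<Prod>v\<in>V. 1 + t / v)"
        using P[OF True] by (intro divide_right_mono) auto
      then show ?thesis using True by (simp add: W_def nf add_divide_distrib)
    qed (simp add: W_def)
    have lim: "(\<lambda>n. indicator {0<..} t *\<^sub>R f (zn n) t) \<longlonglongrightarrow> indicator {0<..} t *\<^sub>R f z t" for t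
    proof (cases "t > 0")
      case True
      have "of_real (\<Prod>v\<in>V. 1 + t / v) \<noteq> (0 :: complex)"
        using P[OF True] of_real_eq_0_iff by (metis less_irrefl)
      then show ?thesis
        unfolding f_def using True by (intro tendsto_intros zn_lim) (simp_all del: of_real_prod)
    qed simp
    have meas: "(\<lambda>t. indicator {0<..} t *\<^sub>R f w t) \<in> borel_measurable lborel" for w
      unfolding f_def by measurable
    have int: "integrable lborel (\<lambda>t. indicator {0<..} t *\<^sub>R f z t)"
      by (rule integrable_dominated_convergence[where s = "\<lambda>n t. indicator {0<..} t *\<^sub>R f (zn n) t" and w = W])
         (use meas W lim dom in auto)
    have "(\<lambda>n. LINT t|lborel. indicator {0<..} t *\<^sub>R f (zn n) t) \<longlonglongrightarrow> (LINT t|lborel. indicator {0<..} t *\<^sub>R f z t)"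
      by (rule integral_dominated_convergence[where w = W]) (use meas W lim dom in auto)
    then have "(\<lambda>n. sin (of_real pi * zn n) * (LBINT t:{0<..}. f (zn n) t)) \<longlonglongrightarrow> sin (of_real pi * z) * (LBINT t:{0<..}. f z t)"
      unfolding set_lebesgue_integral_def by (intro tendsto_intros zn_lim)
    moreover have "(\<lambda>n. of_real pi * (\<Sum>v\<in>V. of_real (pf_coeff V v) * of_real v powr zn n)) \<longlonglongrightarrow> of_real pi * (\<Sum>v\<in>V. of_real (pf_coeff V v) * of_real v powr z)"
      by (intro tendsto_intros zn_lim) (use V(2) in force)
    ultimately have "sin (of_real pi * z) * (LBINT t:{0<..}. f z t) = of_real pi * (\<Sum>v\<in>V. of_real (pf_coeff V v) * of_real v powr z)"
      unfolding aux(2) by (rule LIMSEQ_unique)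
    then show ?thesis unfolding set_integrable_def by (rule conjI[OF int])
  qed
  then show "set_integrable lborel {0<..} (f z)"
    "sin (of_real pi * z) * (LBINT t:{0<..}. f z t) = of_real pi * (\<Sum>v\<in>V. of_real (pf_coeff V v) * of_real v powr z)"
    by auto
qed

section \<open>Substitution of the square and the bound on the coefficient sums\<close>

text \<open>Nonnegative substitution applied to the norm first yields integrability of
  \<open>f\<close> itself; only then does the substitution rule for the complex integrand
  apply.\<close>

lemma set_integral_square_substitution:
  fixes f :: "real \<Rightarrow> complex"
  assumes f: "continuous_on {0<..} f"
    and int: "set_integrable lborel {0<..} (\<lambda>y. f (sqrt y) / of_real (2 * sqrt y))"
  shows "(LBINT t:{0<..}. f t) = (LBINT y:{0<..}. f (sqrt y) / of_real (2 * sqrt y))"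
proof -
  have ei: "einterval 0 \<infinity> = {0<..}" by (auto simp: einterval_def)
  have cont: "isCont f x" if "x > 0" for x
    using f that by (simp add: continuous_on_eq_continuous_at)
  have A: "((ereal \<circ> sqrt \<circ> real_of_ereal) \<longlongrightarrow> 0) (at_right 0)"
  proof -
    have "((\<lambda>x. ereal (sqrt x)) \<longlongrightarrow> ereal (sqrt 0)) (at_right 0)" by (intro tendsto_intros)
    then have "(((ereal \<circ> sqrt) \<circ> real_of_ereal) \<longlongrightarrow> ereal 0) (at_right (ereal 0))"
      unfolding ereal_tendsto_simps by (simp add: o_def)
    then show ?thesis by (simp only: zero_ereal_def)
  qed
  have B: "((ereal \<circ> sqrt \<circ> real_of_ereal) \<longlongrightarrow> \<infinity>) (at_left \<infinity>)"
    unfolding ereal_tendsto_simps using sqrt_at_top by (simp add: o_def tendsto_PInfty_eq_at_top)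
  have d: "DERIV sqrt x :> 1 / (2 * sqrt x)" if "0 < ereal x" for x
    using that by (auto intro!: derivative_eq_intros simp: field_simps)
  have c': "isCont (\<lambda>x. 1 / (2 * sqrt x)) x" if "0 < ereal x" for x
    using that by (intro continuous_intros) auto
  have ni: "set_integrable lborel {0<..} (\<lambda>y. norm (f (sqrt y)) * (1 / (2 * sqrt y)))"
  proof -
    have "set_integrable lborel {0<..} (\<lambda>y. norm (f (sqrt y) / of_real (2 * sqrt y)))"
      using int by (rule set_integrable_norm)
    then show ?thesis by (rule set_integrable_cong[THEN iffD1, rotated -1]) (auto simp: norm_divide)
  qed
  have meas: "set_borel_measurable lborel {0<..} f"
    using f by (simp add: set_borel_measurable_def borel_measurable_continuous_on_indicator)
  have "set_integrable lborel (einterval 0 \<infinity>) (\<lambda>x. norm (f x))"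
    by (rule interval_integral_substitution_nonneg(1)[where g = sqrt and g' = "\<lambda>x. 1 / (2 * sqrt x)" and a = 0 and b = "\<infinity>"])
       (use d c' A B ni cont in \<open>auto simp: ei intro!: continuous_intros\<close>)
  then have fi: "set_integrable lborel {0<..} f"
  proof -
    assume "set_integrable lborel (einterval 0 \<infinity>) (\<lambda>x. norm (f x))"
    then have s: "integrable lborel (\<lambda>x. indicator {0<..} x *\<^sub>R norm (f x))"
      unfolding ei set_integrable_def .
    define g where "g = (\<lambda>x. indicator {0<..} x *\<^sub>R f x)"
    have "(\<lambda>x. norm (g x)) = (\<lambda>x. indicator {0<..} x *\<^sub>R norm (f x))"
      by (auto simp: g_def fun_eq_iff)
    with s have n: "integrable lborel (\<lambda>x. norm (g x))" by (simp only:)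
    have "g \<in> borel_measurable lborel"
      using meas unfolding set_borel_measurable_def g_def .
    then have "integrable lborel g" using n by (subst (asm) integrable_norm_iff)
    then show ?thesis by (simp only: set_integrable_def g_def)
  qed
  have e: "(1 / (2 * sqrt x)) *\<^sub>R f (sqrt x) = f (sqrt x) / of_real (2 * sqrt x)" for x
    by (simp add: scaleR_conv_of_real)
  have "(LBINT x=0..\<infinity>. f x) = (LBINT x=0..\<infinity>. (1 / (2 * sqrt x)) *\<^sub>R f (sqrt x))"
  proof (rule interval_integral_substitution_integrable[where g = sqrt and g' = "\<lambda>x. 1 / (2 * sqrt x)"])
    show "set_integrable lborel (einterval 0 \<infinity>) (\<lambda>x. (1 / (2 * sqrt x)) *\<^sub>R f (sqrt x))"
      unfolding e ei by (rule int)
    show "set_integrable lborel (einterval 0 \<infinity>) (\<lambda>x. f x)"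
      unfolding ei by (rule fi)
  qed (use d c' A B cont in auto)
  then show ?thesis
    unfolding e by (simp only: interval_lebesgue_integral_def ei) simp
qed

lemma cmod_sin_le_exp: "cmod (sin z) \<le> exp \<bar>Im z\<bar>"
proof -
  have "cmod (sin z) = cmod (exp (\<i> * z) - exp (- (\<i> * z))) / 2"
    by (simp add: sin_exp_eq norm_divide norm_mult)
  also have "\<dots> \<le> (cmod (exp (\<i> * z)) + cmod (exp (- (\<i> * z)))) / 2"
    by (intro divide_right_mono norm_triangle_ineq4) auto
  also have "\<dots> = (exp (- Im z) + exp (Im z)) / 2" by simp
  also have "\<dots> \<le> (exp \<bar>Im z\<bar> + exp \<bar>Im z\<bar>) / 2"
    by (intro divide_right_mono add_mono) auto
  finally show ?thesis by simp
qed

lemma of_real_powr_exp: "x > 0 \<Longrightarrow> complex_of_real x powr w = exp (w * of_real (ln x))"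
  by (simp add: powr_def Ln_of_real)

lemma pf_coeff_scale:
  assumes "c > 0"
  shows "pf_coeff ((*) c ` V) (c * v) = pf_coeff V v"
proof -
  have "(*) c ` V - {c * v} = (*) c ` (V - {v})" using assms by auto
  moreover have "inj_on ((*) c) (V - {v})" using assms by (auto simp: inj_on_def)
  ultimately show ?thesis using assms by (simp add: pf_coeff_def prod.reindex)
qed

text \<open>The substitution \<open>y = t^2\<close> halves \<open>s\<close>, so
  \<open>Mellin_partial_fractions\<close> expresses the coefficient sum as
  \<open>(2/pi) sin (pi s/2)\<close> times the integral in \<open>M\<close>. The growth of the sine
  cancels the exponential decay, \<open>2/pi \<le> 1\<close> is dropped, and scaling the knots by
  \<open>b^2\<close> produces the factor \<open>b powr Re s\<close>.\<close>

lemma scaled_pf_sum_bound: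
  fixes V :: "real set" and s :: complex
  assumes V: "finite V" "\<And>v. v \<in> V \<Longrightarrow> v > 0" "0 < Re s" "Re s < 2 * real (card V)"
    and b: "b > 0"
    and M: "b powr Re s * cmod (LBINT t:{0<..}. of_real t powr (s - 1) / of_real (\<Prod>v\<in>V. 1 + t ^ 2 / v))
              \<le> K * exp (- (pi / 2) * \<bar>Im s\<bar>)"
  shows "cmod (\<Sum>v\<in>(*) (b ^ 2) ` V. of_real (pf_coeff ((*) (b ^ 2) ` V) v) * of_real v powr (s / 2)) \<le> K"
proof -
  define F where "F t = complex_of_real t powr (s - 1) / of_real (\<Prod>v\<in>V. 1 + t ^ 2 / v)" for t
  define G where "G y = complex_of_real y powr (s / 2 - 1) / of_real (\<Prod>v\<in>V. 1 + y / v)" for y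
  have s2: "0 < Re (s / 2)" "Re (s / 2) < real (card V)" using V by auto
  have P: "(\<Prod>v\<in>V. 1 + t ^ 2 / v) > 0" for t :: real
    using V by (intro prod_pos ballI add_pos_nonneg divide_nonneg_nonneg) (auto simp: less_imp_le)
  have FG: "F (sqrt y) / of_real (2 * sqrt y) = 1 / 2 * G y" if "y > 0" for y
  proof -
    have "complex_of_real (sqrt y) powr (s - 1) / of_real (sqrt y) = exp ((s - 1) * of_real (ln (sqrt y)) - of_real (ln (sqrt y)))"
    proof -
      have "of_real (sqrt y) = exp (complex_of_real (ln (sqrt y)))" using that by (simp add: exp_of_real)
      moreover have "complex_of_real (sqrt y) powr (s - 1) = exp ((s - 1) * of_real (ln (sqrt y)))"
        using that by (intro of_real_powr_exp) auto
      ultimately show ?thesis by (simp only: exp_diff)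
    qed
    also have "(s - 1) * of_real (ln (sqrt y)) - of_real (ln (sqrt y)) = (s / 2 - 1) * complex_of_real (ln y)"
      using that by (simp add: ln_sqrt algebra_simps diff_divide_distrib)
    finally have "complex_of_real (sqrt y) powr (s - 1) / of_real (sqrt y) = of_real y powr (s / 2 - 1)"
      using that by (simp add: of_real_powr_exp)
    moreover have "F (sqrt y) / of_real (2 * sqrt y) = 1 / 2 * ((complex_of_real (sqrt y) powr (s - 1) / of_real (sqrt y)) / of_real (\<Prod>v\<in>V. 1 + y / v))"
      using that by (simp add: F_def)
    ultimately show ?thesis by (simp only: G_def)
  qed
  have cont: "continuous_on {0<..} F"
  proof -
    have "complex_of_real (\<Prod>v\<in>V. 1 + t ^ 2 / v) \<noteq> 0" for t :: real using P[of t] of_real_eq_0_iff by (metis less_irrefl)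
    then show ?thesis using V(2) unfolding F_def by (intro continuous_intros) force+
  qed
  have "set_integrable lborel {0<..} (\<lambda>y. 1 / 2 * G y)"
    unfolding G_def using Mellin_partial_fractions(1)[OF V(1,2) s2] by (intro set_integrable_mult_right)
  also have "set_integrable lborel {0<..} (\<lambda>y. 1 / 2 * G y) = set_integrable lborel {0<..} (\<lambda>y. F (sqrt y) / of_real (2 * sqrt y))"
    by (rule set_integrable_cong) (simp_all only: FG greaterThan_iff)
  finally have "(LBINT t:{0<..}. F t) = (LBINT y:{0<..}. F (sqrt y) / of_real (2 * sqrt y))"
    by (rule set_integral_square_substitution[OF cont])
  also have "\<dots> = (LBINT y:{0<..}. 1 / 2 * G y)"
    by (rule set_lebesgue_integral_cong) (simp, intro allI impI, simp only: FG greaterThan_iff)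
  also have "\<dots> = 1 / 2 * (LBINT y:{0<..}. G y)" by (rule set_integral_mult_right)
  finally have FG': "(LBINT y:{0<..}. G y) = 2 * (LBINT t:{0<..}. F t)"
    by (simp add: mult.commute)
  define D where "D = (\<Sum>v\<in>V. of_real (pf_coeff V v) * of_real v powr (s / 2))"
  have D: "of_real pi * D = sin (of_real pi * (s / 2)) * (2 * (LBINT t:{0<..}. F t))"
    unfolding D_def FG'[symmetric] G_def
    by (rule Mellin_partial_fractions(2)[OF V(1,2) s2, symmetric])
  have sin: "cmod (sin (of_real pi * (s / 2))) \<le> exp (pi / 2 * \<bar>Im s\<bar>)"
    using cmod_sin_le_exp[of "of_real pi * (s / 2)"] by (simp add: abs_mult)
  have M': "b powr Re s * cmod (LBINT t:{0<..}. F t) \<le> K * exp (- (pi / 2) * \<bar>Im s\<bar>)"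
    using M unfolding F_def .
  have "b powr Re s * (pi * cmod D) = b powr Re s * cmod (of_real pi * D)" by (simp add: norm_mult)
  also have "\<dots> = 2 * (cmod (sin (of_real pi * (s / 2))) * (b powr Re s * cmod (LBINT t:{0<..}. F t)))"
    unfolding D norm_mult by simp
  also have "\<dots> \<le> 2 * (exp (pi / 2 * \<bar>Im s\<bar>) * (K * exp (- (pi / 2) * \<bar>Im s\<bar>)))"
    by (intro mult_left_mono[OF mult_mono[OF sin M']]) auto
  also have "\<dots> = 2 * K"
  proof -
    have "exp (pi / 2 * \<bar>Im s\<bar>) * exp (- (pi / 2) * \<bar>Im s\<bar>) = 1" by (simp flip: exp_add)
    then show ?thesis by (metis mult.left_commute mult.right_neutral)
  qed
  finally have "b powr Re s * cmod D * pi \<le> 2 * K" by (simp add: mult_ac)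
  moreover have "b powr Re s * cmod D * 2 \<le> b powr Re s * cmod D * pi"
    using pi_ge_two by (intro mult_left_mono) auto
  ultimately have DK: "b powr Re s * cmod D \<le> K" by linarith
  have inj: "inj_on ((*) (b ^ 2)) V" using b by (auto simp: inj_on_def)
  have b2: "b ^ 2 > 0" using b by simp
  have "(\<Sum>v\<in>(*) (b ^ 2) ` V. of_real (pf_coeff ((*) (b ^ 2) ` V) v) * of_real v powr (s / 2))
     = (\<Sum>v\<in>V. of_real (pf_coeff V v) * complex_of_real (b ^ 2 * v) powr (s / 2))"
    using b2 by (simp add: sum.reindex[OF inj] pf_coeff_scale)
  also have "\<dots> = complex_of_real (b ^ 2) powr (s / 2) * D"
    unfolding D_def sum_distrib_left
  proof (rule sum.cong[OF refl])
    fix v assume "v \<in> V"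
    then have "complex_of_real (b ^ 2 * v) powr (s / 2) = complex_of_real (b ^ 2) powr (s / 2) * of_real v powr (s / 2)"
      unfolding of_real_mult using b2 V(2) by (intro powr_times_real) (auto simp: less_imp_le)
    then show "of_real (pf_coeff V v) * complex_of_real (b ^ 2 * v) powr (s / 2) = complex_of_real (b ^ 2) powr (s / 2) * (of_real (pf_coeff V v) * of_real v powr (s / 2))"
      by simp
  qed
  also have "cmod \<dots> = b powr Re s * cmod D"
  proof -
    have "cmod (complex_of_real (b ^ 2) powr (s / 2)) = (b ^ 2) powr (Re s / 2)"
      using b2 by (subst norm_powr_real_powr) auto
    also have "\<dots> = (b powr 2) powr (Re s / 2)" using b by (simp add: powr_numeral)
    also have "\<dots> = b powr Re s" by (simp add: powr_powr)
    finally show ?thesis by (simp add: norm_mult)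
  qed
  finally show ?thesis using DK by simp
qed

section \<open>Zeros of the rescaled polynomials\<close>

text \<open>Here \<open>y\<close> are the rescaled positive zeros, \<open>U\<close> is the rescaled
  square of the extra knot, and \<open>\<epsilon>\<close> stands for a multiple of
  \<open>\<delta>\<close>. The error bound uses \<open>cosh\<close> for both parities; the factor
  \<open>min (|z|^2) 1\<close> is kept because it excludes spurious zeros near 0 when
  \<open>d = 1\<close>.\<close>

locale scaled_zeros =
  fixes d :: nat and y :: "nat \<Rightarrow> nat \<Rightarrow> real" and U \<gamma> \<epsilon> :: "nat \<Rightarrow> real"
  assumes d: "d \<in> {0, 1}"
    and y_pos: "\<And>N k. N \<ge> 1 \<Longrightarrow> k \<in> {1..N} \<Longrightarrow> y N k > 0"
    and y_inj: "\<And>N. N \<ge> 1 \<Longrightarrow> inj_on (y N) {1..N}"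
    and \<gamma>: "filterlim \<gamma> at_top sequentially"
    and \<epsilon>: "\<epsilon> \<longlonglongrightarrow> 0"
    and close: "\<And>N z. N \<ge> 1 \<Longrightarrow> cmod z \<le> \<gamma> N \<Longrightarrow>
      cmod (z ^ d * (\<Prod>k=1..N. 1 - z\<^sup>2 / of_real ((y N k)\<^sup>2)) - cos (z - of_real (real d * pi / 2)))
        \<le> \<epsilon> N * min ((cmod z)\<^sup>2) 1 * cosh (cmod z)"
    and U_pos: "\<And>N. N \<ge> 1 \<Longrightarrow> U N > 0"
    and U: "filterlim U at_top sequentially"
    and U_notin: "\<And>N. N \<ge> 1 \<Longrightarrow> U N \<notin> (\<lambda>k. (y N k)\<^sup>2) ` {1..N}"
begin

definition hc :: "nat \<Rightarrow> complex \<Rightarrow> complex" where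
  "hc N z = z ^ d * (\<Prod>k=1..N. 1 - z\<^sup>2 / of_real ((y N k)\<^sup>2))"

definition h :: "nat \<Rightarrow> real \<Rightarrow> real" where
  "h N t = t ^ d * (\<Prod>k=1..N. 1 - t\<^sup>2 / (y N k)\<^sup>2)"

definition S :: "nat \<Rightarrow> real set" where
  "S N = insert (U N) ((\<lambda>k. (y N k)\<^sup>2) ` {1..N})"

text \<open>The positive zeros of \<open>cos (t - d pi/2)\<close>: odd multiples of
  \<open>pi/2\<close> for \<open>d = 0\<close>, positive multiples of \<open>pi\<close> for
  \<open>d = 1\<close>.\<close>

definition \<xi> :: "nat \<Rightarrow> real" where
  "\<xi> j = (2 * real j + 1 + real d) * pi / 2"

text \<open>The coefficients of the principal parts of \<open>1 / cos z\<close> or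
  \<open>z / sin z\<close>, written as \<open>A / (1 - z^2 / \<xi>^2)\<close>. They are
  \<open>2 (-1)^j / \<xi> j\<close> for \<open>d = 0\<close> and \<open>2 (-1)^j\<close> for
  \<open>d = 1\<close>.\<close>

definition \<alpha> :: "nat \<Rightarrow> real" where
  "\<alpha> j = 2 * (- 1) ^ j * \<xi> j ^ d / \<xi> j"

definition cs :: "real \<Rightarrow> real" where "cs t = cos (t - real d * pi / 2)"

lemma hc_of_real: "hc N (of_real t) = of_real (h N t)"
  by (simp add: hc_def h_def)

lemma hc_holomorphic: "hc N holomorphic_on A"
proof -
  have "hc N = (\<lambda>z. z ^ d * (\<Prod>k=1..N. 1 - z\<^sup>2 * of_real (1 / (y N k)\<^sup>2)))"
    by (simp add: hc_def[abs_def])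
  then show ?thesis by (auto intro!: holomorphic_intros)
qed

lemma h_has_derivative: "(h N has_real_derivative deriv (h N) t) (at t)"
proof -
  define p where "p = monom 1 d * (\<Prod>k=1..N. [:1, 0, - 1 / (y N k)\<^sup>2:])"
  have "h N = poly p"
    by (auto simp: fun_eq_iff h_def p_def poly_monom poly_prod power2_eq_square)
  then have "(h N has_real_derivative poly (pderiv p) t) (at t)" using poly_DERIV[of p t] by simp
  then show ?thesis using DERIV_imp_deriv by fastforce
qed

lemma deriv_hc_of_real: "deriv (hc N) (of_real t) = of_real (deriv (h N) t)"
proof -
  have "(hc N has_field_derivative deriv (hc N) (of_real t)) (at (of_real t))"
    using hc_holomorphic[of N UNIV] by (auto intro: holomorphic_derivI)
  from has_vector_derivative_real_field[OF this]
  have "((\<lambda>t. hc N (of_real t)) has_vector_derivative deriv (hc N) (of_real t)) (at t)" .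
  moreover have "((\<lambda>t. hc N (of_real t)) has_vector_derivative of_real (deriv (h N) t)) (at t)"
    unfolding hc_of_real using h_has_derivative[of N t]
    by (intro has_vector_derivative_of_real) (simp add: has_real_derivative_iff_has_vector_derivative)
  ultimately show ?thesis by (rule vector_derivative_unique_at)
qed

lemma deriv_cos_shift: "deriv (\<lambda>z. cos (z - c)) w = - sin (w - c)" for w :: complex
  by (rule DERIV_imp_deriv) (auto intro!: derivative_eq_intros)

text \<open>Closeness on the disc of radius \<open>|L| + 1\<close> passes to the derivative by
  Cauchy's inequality on unit circles around real points.\<close>

lemma uniformly_close:
  assumes "e > 0"
  shows "\<forall>\<^sub>F N in sequentially. \<forall>t. \<bar>t\<bar> \<le> L \<longrightarrow>
    \<bar>h N t - cs t\<bar> < e \<and> \<bar>deriv (h N) t + sin (t - real d * pi / 2)\<bar> < e"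
proof -
  define M where "M = \<bar>L\<bar> + 1"
  have "(\<lambda>N. \<bar>\<epsilon> N\<bar> * cosh M) \<longlonglongrightarrow> 0 * cosh M" by (intro tendsto_intros tendsto_rabs_zero \<epsilon>)
  then have "\<forall>\<^sub>F N in sequentially. \<bar>\<epsilon> N\<bar> * cosh M < e"
    using assms by (intro order_tendstoD) auto
  moreover have "\<forall>\<^sub>F N in sequentially. \<gamma> N \<ge> M" using \<gamma> by (simp add: filterlim_at_top)
  ultimately show ?thesis using eventually_ge_at_top[of 1]
  proof eventually_elim
    case (elim N)
    define g where "g z = hc N z - cos (z - of_real (real d * pi / 2))" for z
    have g: "cmod (g z) \<le> \<bar>\<epsilon> N\<bar> * cosh M" if "cmod z \<le> M" for z
    proof -
      have "cmod (g z) \<le> \<epsilon> N * min ((cmod z)\<^sup>2) 1 * cosh (cmod z)"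
        unfolding g_def hc_def using elim that by (intro close) auto
      also have "\<dots> \<le> \<bar>\<epsilon> N\<bar> * 1 * cosh (cmod z)"
        by (intro mult_right_mono mult_mono) auto
      also have "\<dots> \<le> \<bar>\<epsilon> N\<bar> * cosh M"
        using that
        by (simp only: mult_1_right, intro mult_left_mono) (auto simp: cosh_real_nonneg_le_iff M_def)
      finally show ?thesis .
    qed
    have ghol: "g holomorphic_on A" for A
      unfolding g_def by (intro holomorphic_intros hc_holomorphic)
    show ?case
    proof (intro allI impI)
      fix t assume t: "\<bar>t\<bar> \<le> L"
      have "of_real (cs t) = cos (complex_of_real t - of_real (real d * pi / 2))"
        by (simp only: cs_def cos_of_real[symmetric] of_real_diff)
      then have "g (of_real t) = of_real (h N t - cs t)"
        by (simp add: g_def hc_of_real)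
      then have "\<bar>h N t - cs t\<bar> = cmod (g (of_real t))" by (simp only: norm_of_real)
      also have "\<dots> \<le> \<bar>\<epsilon> N\<bar> * cosh M" using t by (intro g) (auto simp: M_def)
      finally have 1: "\<bar>h N t - cs t\<bar> < e" using elim by simp
      have "cmod ((deriv ^^ 1) g (of_real t)) \<le> fact 1 * (\<bar>\<epsilon> N\<bar> * cosh M) / 1 ^ 1"
      proof (rule Cauchy_inequality)
        show "g holomorphic_on ball (complex_of_real t) 1" by (rule ghol)
        show "continuous_on (cball (complex_of_real t) 1) g" by (intro holomorphic_on_imp_continuous_on ghol)
        fix z assume "cmod (complex_of_real t - z) = 1"
        moreover have "cmod z \<le> cmod (complex_of_real t) + cmod (complex_of_real t - z)"
          using norm_triangle_sub[of z "complex_of_real t"] by (simp add: norm_minus_commute)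
        ultimately have "cmod z \<le> M" using t by (simp add: M_def)
        then show "cmod (g z) \<le> \<bar>\<epsilon> N\<bar> * cosh M" by (rule g)
      qed simp
      moreover have "deriv g (of_real t) = of_real (deriv (h N) t + sin (t - real d * pi / 2))"
      proof -
        have "deriv g (of_real t) = deriv (hc N) (of_real t) - deriv (\<lambda>z. cos (z - of_real (real d * pi / 2))) (of_real t)"
          unfolding g_def
          by (rule deriv_diff; rule holomorphic_on_imp_differentiable_at[of _ UNIV])
             (auto intro!: hc_holomorphic holomorphic_intros)
        also have "deriv (\<lambda>z::complex. cos (z - of_real (real d * pi / 2))) (of_real t) = - of_real (sin (t - real d * pi / 2))"
          by (simp only: deriv_cos_shift sin_of_real[symmetric] of_real_diff)
        finally show ?thesis by (simp only: deriv_hc_of_real of_real_add diff_minus_eq_add)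
      qed
      ultimately have "cmod (of_real (deriv (h N) t + sin (t - real d * pi / 2))) \<le> \<bar>\<epsilon> N\<bar> * cosh M"
        by simp
      then have "\<bar>deriv (h N) t + sin (t - real d * pi / 2)\<bar> < e"
        unfolding norm_of_real using elim by simp
      with 1 show "\<bar>h N t - cs t\<bar> < e \<and> \<bar>deriv (h N) t + sin (t - real d * pi / 2)\<bar> < e" by blast
    qed
  qed
qed

section \<open>Localisation of the zeros\<close>

lemma h_eq_0_iff:
  assumes "N \<ge> 1" "t > 0"
  shows "h N t = 0 \<longleftrightarrow> t \<in> y N ` {1..N}"
proof -
  have "1 - t\<^sup>2 / (y N k)\<^sup>2 = 0 \<longleftrightarrow> t = y N k" if "k \<in> {1..N}" for k
  proof -
    have yk: "y N k > 0" by (rule y_pos[OF assms(1) that])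
    then have "1 - t\<^sup>2 / (y N k)\<^sup>2 = 0 \<longleftrightarrow> t\<^sup>2 = (y N k)\<^sup>2" by auto
    also have "\<dots> \<longleftrightarrow> t = y N k" using yk assms(2) by (simp add: power2_eq_iff_nonneg)
    finally show ?thesis .
  qed
  then show ?thesis using assms by (auto simp: h_def)
qed

lemma \<xi>_gt: "\<xi> j \<ge> pi / 2" "\<xi> j > 0"
proof -
  have "1 * (pi / 2) \<le> (2 * real j + 1 + real d) * (pi / 2)" by (intro mult_right_mono) auto
  then show "\<xi> j \<ge> pi / 2" by (simp add: \<xi>_def)
  then show "\<xi> j > 0" using pi_gt_zero by linarith
qed

lemma cs_cell: "cs t = (- 1) ^ Suc j * sin (t - \<xi> j)"
  and sin_cell: "- sin (t - real d * pi / 2) = (- 1) ^ Suc j * cos (t - \<xi> j)"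
proof -
  have eq: "t - real d * pi / 2 = (t - \<xi> j + pi / 2) + real j * pi" by (simp add: \<xi>_def field_simps)
  have c: "cos (x + real j * pi) = (- 1) ^ j * cos x" and s: "sin (x + real j * pi) = (- 1) ^ j * sin x" for x
    by (simp_all add: cos_add sin_add cos_npi sin_npi)
  show "cs t = (- 1) ^ Suc j * sin (t - \<xi> j)" unfolding cs_def eq c by (simp add: cos_add)
  show "- sin (t - real d * pi / 2) = (- 1) ^ Suc j * cos (t - \<xi> j)" unfolding eq s by (simp add: sin_add)
qed

lemma sin_abs_lower:
  assumes "e \<le> \<bar>x\<bar>" "\<bar>x\<bar> \<le> pi / 2" "e > 0"
  shows "sin e \<le> \<bar>sin x\<bar>"
proof -
  have "sin e \<le> sin \<bar>x\<bar>" using assms by (intro sin_monotone_2pi_le) auto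
  also have "\<dots> \<le> \<bar>sin x\<bar>" by (auto simp: abs_if)
  finally show ?thesis .
qed

text \<open>On the cell of radius \<open>pi/2\<close> around \<open>\<xi> j\<close> the limit
  function is a signed sine of \<open>t - \<xi> j\<close>. The intermediate value theorem gives a
  zero, and Rolle's theorem excludes a second one.\<close>

lemma cell_zero:
  assumes e: "0 < e" "e < pi / 2"
  shows "\<forall>\<^sub>F N in sequentially. (\<exists>!t. \<bar>t - \<xi> j\<bar> \<le> pi / 2 \<and> h N t = 0) \<and>
           (\<forall>t. \<bar>t - \<xi> j\<bar> \<le> pi / 2 \<and> h N t = 0 \<longrightarrow> \<bar>t - \<xi> j\<bar> < e)"
proof -
  \<comment> \<open>Error below \<open>sin e\<close> keeps zeros within \<open>e\<close> of
    \<open>\<xi> j\<close>; error below \<open>cos e\<close> in the derivative excludes critical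
    points there; \<open>m \<le> 1\<close> preserves the signs at the ends of the cell.\<close>
  define m where "m = min (sin e) (cos e)"
  have m: "m > 0" "m \<le> sin e" "m \<le> cos e" "m \<le> 1"
    using e sin_gt_zero2[of e] cos_gt_zero[of e] by (auto simp: m_def intro: min.coboundedI1)
  define L where "L = \<xi> j + pi / 2"
  have L: "\<bar>t\<bar> \<le> L" if "\<bar>t - \<xi> j\<bar> \<le> pi / 2" for t
    using that \<xi>_gt(1)[of j] by (auto simp: L_def abs_if split: if_splits)
  show ?thesis using uniformly_close[OF m(1), of L]
  proof eventually_elim
    case (elim N)
    have c1: "\<bar>h N t - (- 1) ^ Suc j * sin (t - \<xi> j)\<bar> < m" if "\<bar>t - \<xi> j\<bar> \<le> pi / 2" for t
    proof -
      have "\<bar>h N t - cs t\<bar> < m" using elim L[OF that] by blast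
      then show ?thesis by (simp only: cs_cell[of t j])
    qed
    have c2: "\<bar>deriv (h N) t - (- 1) ^ Suc j * cos (t - \<xi> j)\<bar> < m" if "\<bar>t - \<xi> j\<bar> \<le> pi / 2" for t
    proof -
      have "\<bar>deriv (h N) t - - sin (t - real d * pi / 2)\<bar> < m"
        unfolding diff_minus_eq_add using elim L[OF that] by blast
      then show ?thesis by (simp only: sin_cell[of t j])
    qed
    have near: "\<bar>t - \<xi> j\<bar> < e" if t: "\<bar>t - \<xi> j\<bar> \<le> pi / 2" "h N t = 0" for t
    proof (rule ccontr)
      assume "\<not> \<bar>t - \<xi> j\<bar> < e"
      then have "sin e \<le> \<bar>sin (t - \<xi> j)\<bar>" using t e by (intro sin_abs_lower) auto
      moreover have "\<bar>sin (t - \<xi> j)\<bar> < m" using c1[OF t(1)] t(2) by (simp add: abs_mult)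
      ultimately show False using m by linarith
    qed
    have ex: "\<exists>t. \<bar>t - \<xi> j\<bar> \<le> pi / 2 \<and> h N t = 0"
    proof -
      define f where "f t = (- 1) ^ Suc j * h N t" for t
      have sgn: "(- 1) ^ Suc j * ((- 1) ^ Suc j * z) = z" for z :: real
        by (cases "even j") auto
      have f: "\<bar>f t - sin (t - \<xi> j)\<bar> < m" if "\<bar>t - \<xi> j\<bar> \<le> pi / 2" for t
      proof -
        have "f t - sin (t - \<xi> j) = (- 1) ^ Suc j * (h N t - (- 1) ^ Suc j * sin (t - \<xi> j))"
          unfolding right_diff_distrib sgn f_def ..
        then have "\<bar>f t - sin (t - \<xi> j)\<bar> = \<bar>h N t - (- 1) ^ Suc j * sin (t - \<xi> j)\<bar>"
          by (simp only: abs_mult power_abs) simp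
        then show ?thesis using c1[OF that] by simp
      qed
      have "f (\<xi> j - pi / 2) \<le> 0" using f[of "\<xi> j - pi / 2"] m by (simp add: abs_less_iff)
      moreover have "f (\<xi> j + pi / 2) \<ge> 0" using f[of "\<xi> j + pi / 2"] m by (simp add: abs_less_iff)
      moreover have "\<forall>t. \<xi> j - pi / 2 \<le> t \<and> t \<le> \<xi> j + pi / 2 \<longrightarrow> isCont f t"
        unfolding f_def using h_has_derivative[THEN DERIV_isCont] by (auto intro!: continuous_intros)
      ultimately obtain t where "\<xi> j - pi / 2 \<le> t" "t \<le> \<xi> j + pi / 2" "f t = 0"
        using IVT[of f "\<xi> j - pi / 2" 0 "\<xi> j + pi / 2"] by auto
      then have "\<bar>t - \<xi> j\<bar> \<le> pi / 2" "h N t = 0" by (simp_all only: abs_le_iff, simp_all add: f_def)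
      then show ?thesis by blast
    qed
    have uniq: False if t: "h N t1 = 0" "h N t2 = 0" "t1 < t2" "\<bar>t1 - \<xi> j\<bar> \<le> pi / 2" "\<bar>t2 - \<xi> j\<bar> \<le> pi / 2" for t1 t2
    proof -
      have "continuous_on {t1..t2} (h N)"
        by (intro continuous_at_imp_continuous_on ballI DERIV_isCont[OF h_has_derivative])
      moreover have "h N differentiable (at x)" for x
        using h_has_derivative[of N x] unfolding real_differentiable_def by blast
      moreover have "h N t1 = h N t2" using t by simp
      ultimately obtain z where z: "t1 < z" "z < t2" "DERIV (h N) z :> 0"
        using Rolle[OF t(3)] by blast
      have z3: "deriv (h N) z = 0" by (rule DERIV_imp_deriv[OF z(3)])
      have ze: "\<bar>z - \<xi> j\<bar> < e" using near[OF t(4,1)] near[OF t(5,2)] z(1,2) by (simp add: abs_less_iff)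
      then have "\<bar>cos (z - \<xi> j)\<bar> < m" using c2[of z] e by (simp add: abs_mult z3)
      moreover have "cos e \<le> cos \<bar>z - \<xi> j\<bar>" using ze e by (intro cos_monotone_0_pi_le) auto
      ultimately show False using m by simp
    qed
    obtain t0 where t0: "\<bar>t0 - \<xi> j\<bar> \<le> pi / 2" "h N t0 = 0" using ex by blast
    have "\<exists>!t. \<bar>t - \<xi> j\<bar> \<le> pi / 2 \<and> h N t = 0"
    proof (rule ex1I[of _ t0])
      fix t assume t: "\<bar>t - \<xi> j\<bar> \<le> pi / 2 \<and> h N t = 0"
      show "t = t0"
      proof (rule linorder_cases[of t t0])
        assume "t < t0" then show ?thesis using uniq[of t t0] t t0 by blast
      next
        assume "t0 < t" then show ?thesis using uniq[of t0 t] t t0 by blast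
      qed
    qed (use t0 in blast)
    then show ?case using near by blast
  qed
qed


text \<open>For \<open>d = 1\<close> the interval up to \<open>pi/2\<close> belongs to no cell, and
  uniform closeness does not suffice because \<open>sin\<close> tends to 0 there. The error is at
  most a small multiple of \<open>min (t^2) 1 \<le> t\<close>, hence eventually below
  \<open>t/2 \<le> sin t\<close>.\<close>

lemma no_small_zeros: "\<forall>\<^sub>F N in sequentially. \<forall>t. 0 < t \<and> t \<le> \<xi> 0 - pi / 2 \<longrightarrow> h N t \<noteq> 0"
proof (cases "d = 0")
  case True
  have x0: "\<xi> 0 - pi / 2 = 0" unfolding \<xi>_def using True by simp
  show ?thesis unfolding x0 by auto
next
  case False
  then have d1: "d = 1" using d by auto
  have x0: "\<xi> 0 - pi / 2 = pi / 2" unfolding \<xi>_def using d1 by simp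
  have "(\<lambda>N. \<bar>\<epsilon> N\<bar> * cosh (pi / 2)) \<longlonglongrightarrow> 0 * cosh (pi / 2)" by (intro tendsto_intros tendsto_rabs_zero \<epsilon>)
  then have "\<forall>\<^sub>F N in sequentially. \<bar>\<epsilon> N\<bar> * cosh (pi / 2) < 1 / 2"
    by (rule order_tendstoD(2)) simp
  moreover have "\<forall>\<^sub>F N in sequentially. \<gamma> N \<ge> pi / 2" using \<gamma> unfolding filterlim_at_top by blast
  ultimately show ?thesis using eventually_ge_at_top[of 1]
  proof eventually_elim
    case (elim N)
    show ?case
    proof (intro allI impI)
      fix t assume "0 < t \<and> t \<le> \<xi> 0 - pi / 2"
      then have t: "0 < t" "t \<le> pi / 2" using x0 by auto
      have "cs t = sin t" unfolding cs_def using d1 by (simp add: cos_diff)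
      have "of_real (cs t) = cos (complex_of_real t - of_real (real d * pi / 2))"
        by (simp only: cs_def cos_of_real[symmetric] of_real_diff)
      then have "hc N (of_real t) - cos (complex_of_real t - of_real (real d * pi / 2)) = of_real (h N t - cs t)"
        by (simp only: hc_of_real of_real_diff)
      then have "\<bar>h N t - cs t\<bar> = cmod (hc N (of_real t) - cos (complex_of_real t - of_real (real d * pi / 2)))"
        by (simp only: norm_of_real)
      also have "\<dots> \<le> \<epsilon> N * min ((cmod (of_real t))\<^sup>2) 1 * cosh (cmod (of_real t))"
        unfolding hc_def using elim t by (intro close) auto
      also have "\<dots> = \<epsilon> N * min (t\<^sup>2) 1 * cosh t" using t by simp
      also have "\<dots> \<le> \<bar>\<epsilon> N\<bar> * t * cosh (pi / 2)"
      proof (intro mult_mono)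
        show "min (t\<^sup>2) 1 \<le> t"
        proof (cases "t \<le> 1")
          case True
          then have "t\<^sup>2 \<le> t" using t by (simp add: power2_eq_square mult_left_le)
          then show ?thesis by simp
        qed auto
        show "cosh t \<le> cosh (pi / 2)" using t by (subst cosh_real_nonneg_le_iff) auto
      qed (use t in auto)
      also have "\<dots> = t * (\<bar>\<epsilon> N\<bar> * cosh (pi / 2))" by simp
      also have "\<dots> < t * (1 / 2)" using elim t by (intro mult_strict_left_mono) auto
      also have "\<dots> \<le> sin t" using sin_ge_half[of t] t by simp
      finally show "h N t \<noteq> 0" using \<open>cs t = sin t\<close> by (auto simp: abs_if split: if_splits)
    qed
  qed
qed

text \<open>The description is known to be unique only for all large \<open>N\<close>; for the
  remaining \<open>N\<close> nothing is claimed about the value.\<close>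

definition \<eta> :: "nat \<Rightarrow> nat \<Rightarrow> real" where
  "\<eta> j N = (THE t. \<bar>t - \<xi> j\<bar> \<le> pi / 2 \<and> h N t = 0)"

lemma \<eta>_eventually:
  assumes "0 < e" "e < pi / 2"
  shows "\<forall>\<^sub>F N in sequentially. h N (\<eta> j N) = 0 \<and> \<bar>\<eta> j N - \<xi> j\<bar> < e \<and>
           (\<forall>t. \<bar>t - \<xi> j\<bar> \<le> pi / 2 \<and> h N t = 0 \<longrightarrow> t = \<eta> j N)"
  using cell_zero[OF assms, of j]
proof eventually_elim
  case (elim N)
  then have u: "\<exists>!t. \<bar>t - \<xi> j\<bar> \<le> pi / 2 \<and> h N t = 0" by blast
  have p: "\<bar>\<eta> j N - \<xi> j\<bar> \<le> pi / 2 \<and> h N (\<eta> j N) = 0"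
    unfolding \<eta>_def by (rule theI'[OF u])
  then show ?case using elim u by blast
qed

lemma \<eta>_tendsto: "(\<lambda>N. \<eta> j N) \<longlonglongrightarrow> \<xi> j"
proof (rule tendstoI)
  fix e :: real assume e: "e > 0"
  have "0 < min e 1" "min e 1 < pi / 2" using e pi_gt3 by auto
  from \<eta>_eventually[OF this, of j] show "\<forall>\<^sub>F N in sequentially. dist (\<eta> j N) (\<xi> j) < e"
    by eventually_elim (auto simp: dist_real_def)
qed

lemma \<xi>_add: "\<xi> j = \<xi> 0 + real j * pi"
  by (simp add: \<xi>_def field_simps)

text \<open>The cells tile the half-line starting at \<open>\<xi> 0 - pi/2\<close>, and no positive
  zero lies below it. Hence each zero under the bound is the single zero of one of the first
  \<open>J\<close> cells.\<close>

lemma zeros_below: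
  "\<forall>\<^sub>F N in sequentially. {t \<in> y N ` {1..N}. t < \<xi> J - pi / 2} = (\<lambda>j. \<eta> j N) ` {..<J} \<and>
     inj_on (\<lambda>j. \<eta> j N) {..<J} \<and> (\<forall>j<J. \<bar>\<eta> j N - \<xi> j\<bar> < pi / 4)"
proof -
  have "\<forall>\<^sub>F N in sequentially. \<forall>j\<in>{..<J}. h N (\<eta> j N) = 0 \<and> \<bar>\<eta> j N - \<xi> j\<bar> < pi / 4 \<and>
           (\<forall>t. \<bar>t - \<xi> j\<bar> \<le> pi / 2 \<and> h N t = 0 \<longrightarrow> t = \<eta> j N)"
    by (intro eventually_ball_finite ballI \<eta>_eventually) auto
  then show ?thesis using no_small_zeros eventually_ge_at_top[of 1]
  proof eventually_elim
    case (elim N)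
    have near: "\<bar>\<eta> j N - \<xi> j\<bar> < pi / 4" "h N (\<eta> j N) = 0"
      and uniq: "\<And>t. \<bar>t - \<xi> j\<bar> \<le> pi / 2 \<Longrightarrow> h N t = 0 \<Longrightarrow> t = \<eta> j N" if "j < J" for j
      using elim(1) that by blast+
    have step: "\<xi> i + pi \<le> \<xi> j" if "i < j" for i j
    proof -
      have "(real i + 1) * pi \<le> real j * pi" using that by (intro mult_right_mono) auto
      then show ?thesis unfolding \<xi>_add[of i] \<xi>_add[of j] by (simp add: algebra_simps)
    qed
    have "(\<lambda>j. \<eta> j N) ` {..<J} \<subseteq> {t \<in> y N ` {1..N}. t < \<xi> J - pi / 2}"
    proof
      fix t assume "t \<in> (\<lambda>j. \<eta> j N) ` {..<J}"
      then obtain j where j: "j < J" "t = \<eta> j N" by auto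
      have "t > 0" using near(1)[OF j(1)] \<xi>_gt(1)[of j] j(2) pi_gt_zero by linarith
      then have "t \<in> y N ` {1..N}" using near(2)[OF j(1)] j(2) h_eq_0_iff[OF elim(3)] by blast
      moreover have "t < \<xi> J - pi / 2" using near(1)[OF j(1)] step[OF j(1)] j(2) pi_gt_zero by linarith
      ultimately show "t \<in> {t \<in> y N ` {1..N}. t < \<xi> J - pi / 2}" by blast
    qed
    moreover have "{t \<in> y N ` {1..N}. t < \<xi> J - pi / 2} \<subseteq> (\<lambda>j. \<eta> j N) ` {..<J}"
    proof
      fix t assume "t \<in> {t \<in> y N ` {1..N}. t < \<xi> J - pi / 2}"
      then have t: "t \<in> y N ` {1..N}" "t < \<xi> J - pi / 2" by auto
      then have t0: "t > 0" using y_pos[OF elim(3)] by auto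
      then have ht: "h N t = 0" using t h_eq_0_iff[OF elim(3)] by blast
      then have tl: "\<xi> 0 - pi / 2 < t" using elim(2) t0 by (meson not_le)
      \<comment> \<open>The integer part of \<open>q\<close> is the index of the cell that contains
        \<open>t\<close>.\<close>
      define q where "q = (t - (\<xi> 0 - pi / 2)) / pi"
      define j where "j = nat \<lfloor>q\<rfloor>"
      have "q > 0" using tl by (simp add: q_def)
      then have jq: "real j \<le> q" "q < real j + 1" by (auto simp: j_def)
      have tq: "t = \<xi> 0 - pi / 2 + q * pi" by (simp add: q_def)
      have "real j * pi \<le> q * pi" "q * pi \<le> (real j + 1) * pi"
        using jq by (intro mult_right_mono; simp)+
      moreover have "t - \<xi> j = q * pi - real j * pi - pi / 2" unfolding tq \<xi>_add[of j] by simp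
      moreover have "(real j + 1) * pi = real j * pi + pi" by (simp add: algebra_simps)
      ultimately have tj: "\<bar>t - \<xi> j\<bar> \<le> pi / 2" by (simp only: abs_le_iff) linarith
      have "q * pi < real J * pi" using t(2) tq unfolding \<xi>_add[of J] by simp
      then have "q < real J" by simp
      then have "j < J" using jq by linarith
      then show "t \<in> (\<lambda>j. \<eta> j N) ` {..<J}" using uniq[OF _ tj ht] by blast
    qed
    moreover have "inj_on (\<lambda>j. \<eta> j N) {..<J}"
    proof (rule inj_onI)
      fix i j assume ij: "i \<in> {..<J}" "j \<in> {..<J}" "\<eta> i N = \<eta> j N"
      then have n: "\<bar>\<eta> i N - \<xi> i\<bar> < pi / 4" "\<bar>\<eta> i N - \<xi> j\<bar> < pi / 4" using near(1)[of i] near(1)[of j] by auto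
      show "i = j"
      proof (rule linorder_cases[of i j])
        assume "i < j" then show ?thesis using step[of i j] n pi_gt_zero by linarith
      next
        assume "j < i" then show ?thesis using step[of j i] n pi_gt_zero by linarith
      qed
    qed
    ultimately show ?case using near(1) by blast
  qed
qed


section \<open>Limits of the coefficients and of the kernel sums\<close>

text \<open>Splitting off the factor \<open>1 - s^2 / t^2\<close>, which vanishes at
  \<open>s = t\<close> with slope \<open>- 2 / t\<close>, makes the derivative of \<open>h N\<close>
  at \<open>t\<close> equal to \<open>- 2 / t\<close> times \<open>t^d\<close> times the product of
  the other factors. That product, with the factor for \<open>U N\<close>, is the denominator of
  \<open>pf_coeff\<close>.\<close>

lemma pf_coeff_zero:
  assumes N: "N \<ge> 1" and k: "k \<in> {1..N}"
  shows "pf_coeff (S N) ((y N k)\<^sup>2) =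
    - 2 * y N k ^ d / (y N k * deriv (h N) (y N k) * (1 - (y N k)\<^sup>2 / U N))"
proof -
  define t where "t = y N k"
  define q where "q = (\<Prod>j\<in>{1..N} - {k}. 1 - t\<^sup>2 / (y N j)\<^sup>2)"
  have t: "t > 0" unfolding t_def by (rule y_pos[OF N k])
  have sq_inj: "inj_on (\<lambda>j. (y N j)\<^sup>2) {1..N}"
  proof (rule inj_onI)
    fix i j assume ij: "i \<in> {1..N}" "j \<in> {1..N}" "(y N i)\<^sup>2 = (y N j)\<^sup>2"
    have "y N i = y N j"
      by (rule power2_eq_imp_eq[OF ij(3)]) (use y_pos[OF N ij(1)] y_pos[OF N ij(2)] in simp_all)
    then show "i = j" by (rule inj_onD[OF y_inj[OF N] _ ij(1,2)])
  qed
  have "deriv (h N) t = - 2 / t * (t ^ d * q)"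
  proof (rule DERIV_imp_deriv)
    define p where "p = monom 1 d * (\<Prod>j\<in>{1..N} - {k}. [:1, 0, - 1 / (y N j)\<^sup>2:])"
    have p: "poly p s = s ^ d * (\<Prod>j\<in>{1..N} - {k}. 1 - s\<^sup>2 / (y N j)\<^sup>2)" for s
      by (auto simp: p_def poly_monom poly_prod power2_eq_square)
    have "h N = (\<lambda>s. (1 - s\<^sup>2 / t\<^sup>2) * poly p s)"
    proof
      fix s
      have "(\<Prod>j=1..N. 1 - s\<^sup>2 / (y N j)\<^sup>2) = (1 - s\<^sup>2 / t\<^sup>2) * (\<Prod>j\<in>{1..N} - {k}. 1 - s\<^sup>2 / (y N j)\<^sup>2)"
        unfolding t_def by (rule prod.remove[OF _ k]) simp
      then show "h N s = (1 - s\<^sup>2 / t\<^sup>2) * poly p s" by (simp add: h_def p)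
    qed
    moreover have "((\<lambda>s. (1 - s\<^sup>2 / t\<^sup>2) * poly p s) has_real_derivative - 2 / t * poly p t) (at t)"
    proof -
      have "((\<lambda>s. 1 - s\<^sup>2 / t\<^sup>2) has_real_derivative - 2 / t) (at t)"
        using t by (auto intro!: derivative_eq_intros simp: power2_eq_square)
      from DERIV_mult[OF this poly_DERIV[of p t]] show ?thesis using t by simp
    qed
    ultimately show "(h N has_real_derivative - 2 / t * (t ^ d * q)) (at t)"
      by (simp add: p q_def)
  qed
  moreover have "pf_coeff (S N) (t\<^sup>2) = 1 / ((1 - t\<^sup>2 / U N) * q)"
  proof -
    define I where "I = (\<lambda>j. (y N j)\<^sup>2) ` ({1..N} - {k})"
    have U1: "U N \<noteq> t\<^sup>2" using U_notin[OF N] k unfolding t_def by blast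
    have U2: "U N \<notin> I" using U_notin[OF N] unfolding I_def by blast
    have "I = (\<lambda>j. (y N j)\<^sup>2) ` {1..N} - (\<lambda>j. (y N j)\<^sup>2) ` {k}"
      unfolding I_def by (rule inj_on_image_set_diff[OF sq_inj]) (use k in auto)
    then have I: "I = (\<lambda>j. (y N j)\<^sup>2) ` {1..N} - {t\<^sup>2}" by (simp only: t_def image_insert image_empty)
    have SN: "S N - {t\<^sup>2} = insert (U N) I" unfolding S_def I insert_Diff_if using U1 by simp
    have inj: "inj_on (\<lambda>j. (y N j)\<^sup>2) ({1..N} - {k})" by (rule inj_on_subset[OF sq_inj]) blast
    have "(\<Prod>w\<in>I. 1 - t\<^sup>2 / w) = q" unfolding I_def q_def prod.reindex[OF inj] o_def ..
    moreover have "(\<Prod>w\<in>insert (U N) I. 1 - t\<^sup>2 / w) = (1 - t\<^sup>2 / U N) * (\<Prod>w\<in>I. 1 - t\<^sup>2 / w)"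
      by (rule prod.insert[OF _ U2]) (simp add: I_def)
    ultimately show ?thesis by (simp only: pf_coeff_def SN)
  qed
  moreover have "t * (- 2 / t * (t ^ d * q)) * (1 - t\<^sup>2 / U N) = (- 2 * t ^ d) * ((1 - t\<^sup>2 / U N) * q)"
    using t by simp
  moreover have "- 2 * t ^ d / ((- 2 * t ^ d) * ((1 - t\<^sup>2 / U N) * q)) = 1 / ((1 - t\<^sup>2 / U N) * q)"
  proof -
    have "(- 2 * t ^ d * 1) / ((- 2 * t ^ d) * ((1 - t\<^sup>2 / U N) * q)) = 1 / ((1 - t\<^sup>2 / U N) * q)"
      by (rule nonzero_mult_divide_mult_cancel_left) (use t in simp)
    then show ?thesis by (simp only: mult_1_right)
  qed
  ultimately show ?thesis by (simp only: t_def)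
qed

lemma pf_coeff_tendsto: "(\<lambda>N. pf_coeff (S N) ((\<eta> j N)\<^sup>2)) \<longlonglongrightarrow> \<alpha> j"
proof -
  define L where "L = \<xi> j + pi"
  have ev: "\<forall>\<^sub>F N in sequentially. \<bar>\<eta> j N\<bar> \<le> L \<and> \<eta> j N \<in> y N ` {1..N} \<and> N \<ge> 1"
  proof -
    have e: "0 < pi / 4" "pi / 4 < pi / 2" by auto
    show ?thesis using \<eta>_eventually[OF e, of j] eventually_ge_at_top[of 1]
    proof eventually_elim
      case (elim N)
      then have "\<bar>\<eta> j N - \<xi> j\<bar> < pi / 4" by blast
      then have "\<eta> j N > 0" "\<bar>\<eta> j N\<bar> \<le> L" using \<xi>_gt(1)[of j] pi_gt_zero unfolding L_def by linarith+
      then show ?case using elim h_eq_0_iff[of N "\<eta> j N"] by blast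
    qed
  qed
  \<comment> \<open>The point of evaluation moves with \<open>N\<close>, so uniform closeness of the
    derivatives on a bounded interval is used.\<close>
  have "(\<lambda>N. deriv (h N) (\<eta> j N) + sin (\<eta> j N - real d * pi / 2)) \<longlonglongrightarrow> 0"
  proof (rule tendstoI)
    fix e :: real assume "e > 0"
    from uniformly_close[OF this, of L] ev
    show "\<forall>\<^sub>F N in sequentially. dist (deriv (h N) (\<eta> j N) + sin (\<eta> j N - real d * pi / 2)) 0 < e"
      by eventually_elim (auto simp: dist_real_def)
  qed
  moreover have "(\<lambda>N. - sin (\<eta> j N - real d * pi / 2)) \<longlonglongrightarrow> - sin (\<xi> j - real d * pi / 2)"
    by (intro tendsto_intros \<eta>_tendsto)
  ultimately have "(\<lambda>N. deriv (h N) (\<eta> j N) + sin (\<eta> j N - real d * pi / 2) + - sin (\<eta> j N - real d * pi / 2)) \<longlonglongrightarrow> 0 + - sin (\<xi> j - real d * pi / 2)"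
    by (rule tendsto_add)
  then have D: "(\<lambda>N. deriv (h N) (\<eta> j N)) \<longlonglongrightarrow> (- 1) ^ Suc j"
    unfolding sin_cell[of "\<xi> j" j] by simp
  have q: "(\<lambda>N. (\<eta> j N)\<^sup>2 / U N) \<longlonglongrightarrow> 0"
    by (rule tendsto_divide_0[OF tendsto_power[OF \<eta>_tendsto] filterlim_at_top_imp_at_infinity[OF U]])
  have "(\<lambda>N. - 2 * \<eta> j N ^ d / (\<eta> j N * deriv (h N) (\<eta> j N) * (1 - (\<eta> j N)\<^sup>2 / U N)))
      \<longlonglongrightarrow> - 2 * \<xi> j ^ d / (\<xi> j * (- 1) ^ Suc j * (1 - 0))"
    using \<xi>_gt(2)[of j] by (intro tendsto_intros D q \<eta>_tendsto) auto
  also have "- 2 * \<xi> j ^ d / (\<xi> j * (- 1) ^ Suc j * (1 - 0)) = \<alpha> j"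
    by (cases "even j") (simp_all add: \<alpha>_def)
  finally show ?thesis
  proof (rule Lim_transform_eventually)
    show "\<forall>\<^sub>F N in sequentially. - 2 * \<eta> j N ^ d / (\<eta> j N * deriv (h N) (\<eta> j N) * (1 - (\<eta> j N)\<^sup>2 / U N)) = pf_coeff (S N) ((\<eta> j N)\<^sup>2)"
      using ev by eventually_elim (auto simp: pf_coeff_zero)
  qed
qed

lemma \<xi>_ge: "real j + 1 \<le> \<xi> j"
proof -
  have "(2 * real j + 1) * 1 \<le> (2 * real j + 1 + real d) * (pi / 2)"
    using pi_ge_two by (intro mult_mono) auto
  moreover have "pi / 2 * (1 + real j) \<le> (2 * real j + 1 + real d) * (pi / 2)"
    by (subst mult.commute, intro mult_right_mono) auto
  moreover have "1 * (1 + real j) \<le> pi / 2 * (1 + real j)" using pi_ge_two by (intro mult_right_mono) auto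
  ultimately show ?thesis unfolding \<xi>_def by (simp add: algebra_simps)
qed

lemma \<xi>_sq_ge: "real j + 1 \<le> (\<xi> j)\<^sup>2"
proof -
  have "1 * \<xi> j \<le> \<xi> j * \<xi> j" using \<xi>_ge[of j] by (intro mult_right_mono) auto
  then show ?thesis using \<xi>_ge[of j] unfolding power2_eq_square by linarith
qed

lemma kernel_sum_tendsto:
  fixes \<kappa> :: "real \<Rightarrow> real"
  assumes X: "X > 0" and \<kappa>: "\<And>x. isCont \<kappa> x" "\<And>x. x \<ge> 1 \<Longrightarrow> \<kappa> x = 0"
  shows "(\<lambda>N. \<Sum>v\<in>S N. pf_coeff (S N) v * \<kappa> (v / X)) \<longlonglongrightarrow> (\<Sum>j. \<alpha> j * \<kappa> ((\<xi> j)\<^sup>2 / X))"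
proof -
  \<comment> \<open>The summand \<open>sqrt X + 2\<close> puts \<open>sqrt X\<close> below the last
    cell boundary, as \<open>pi/2 < 2\<close>; the summand \<open>X\<close> makes
    \<open>\<xi> j\<close> squared exceed \<open>X\<close> for \<open>j \<ge> J\<close>. Beyond
    \<open>J\<close> the kernel vanishes on both sides.\<close>
  define J where "J = nat \<lceil>X + sqrt X + 2\<rceil>"
  have J: "real J \<ge> X + sqrt X + 2" using X unfolding J_def by linarith
  have JL: "sqrt X \<le> \<xi> J - pi / 2"
    using J \<xi>_ge[of J] X pi_less_4 by linarith
  have "(\<Sum>j. \<alpha> j * \<kappa> ((\<xi> j)\<^sup>2 / X)) = (\<Sum>j<J. \<alpha> j * \<kappa> ((\<xi> j)\<^sup>2 / X))"
  proof (rule suminf_finite)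
    fix j assume "j \<notin> {..<J}"
    then have "real J \<le> real j" by simp
    then have "X \<le> (\<xi> j)\<^sup>2" using J \<xi>_sq_ge[of j] real_sqrt_ge_zero[of X] X by linarith
    then show "\<alpha> j * \<kappa> ((\<xi> j)\<^sup>2 / X) = 0" using X by (simp add: \<kappa>(2))
  qed simp
  moreover have "(\<lambda>N. \<Sum>j<J. pf_coeff (S N) ((\<eta> j N)\<^sup>2) * \<kappa> ((\<eta> j N)\<^sup>2 / X)) \<longlonglongrightarrow> (\<Sum>j<J. \<alpha> j * \<kappa> ((\<xi> j)\<^sup>2 / X))"
    using X by (intro tendsto_intros pf_coeff_tendsto isCont_tendsto_compose[OF \<kappa>(1)] \<eta>_tendsto) auto
  moreover have "\<forall>\<^sub>F N in sequentially. (\<Sum>j<J. pf_coeff (S N) ((\<eta> j N)\<^sup>2) * \<kappa> ((\<eta> j N)\<^sup>2 / X)) = (\<Sum>v\<in>S N. pf_coeff (S N) v * \<kappa> (v / X))"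
  proof -
    have "\<forall>\<^sub>F N in sequentially. U N \<ge> X" using U by (simp add: filterlim_at_top)
    with zeros_below[of J] eventually_ge_at_top[of 1] show ?thesis
    proof eventually_elim
      case (elim N)
      let ?f = "\<lambda>v. pf_coeff (S N) v * \<kappa> (v / X)"
      have zb: "{t \<in> y N ` {1..N}. t < \<xi> J - pi / 2} = (\<lambda>j. \<eta> j N) ` {..<J}"
        and inj: "inj_on (\<lambda>j. \<eta> j N) {..<J}" using elim(1) by blast+
      have \<eta>y: "\<eta> j N \<in> y N ` {1..N}" if "j < J" for j
      proof -
        have "\<eta> j N \<in> (\<lambda>j. \<eta> j N) ` {..<J}" using that by (intro imageI) simp
        then show ?thesis unfolding zb[symmetric] by simp
      qed
      have \<eta>pos: "\<eta> j N > 0" if "j < J" for j using \<eta>y[OF that] y_pos[OF elim(2)] by auto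
      have inj2: "inj_on (\<lambda>j. (\<eta> j N)\<^sup>2) {..<J}"
      proof (rule inj_onI)
        fix i j assume ij: "i \<in> {..<J}" "j \<in> {..<J}" "(\<eta> i N)\<^sup>2 = (\<eta> j N)\<^sup>2"
        have "\<eta> i N = \<eta> j N"
          by (rule power2_eq_imp_eq[OF ij(3)]) (use \<eta>pos[of i] \<eta>pos[of j] ij in simp_all)
        then show "i = j" by (rule inj_onD[OF inj _ ij(1,2)])
      qed
      have "(\<Sum>v\<in>S N. ?f v) = (\<Sum>v\<in>(\<lambda>j. (\<eta> j N)\<^sup>2) ` {..<J}. ?f v)"
      proof (rule sum.mono_neutral_right)
        show "finite (S N)" by (simp add: S_def)
        show "(\<lambda>j. (\<eta> j N)\<^sup>2) ` {..<J} \<subseteq> S N" 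
        proof (rule image_subsetI)
          fix j assume "j \<in> {..<J}"
          then obtain k where "k \<in> {1..N}" "\<eta> j N = y N k" using \<eta>y[of j] by auto
          then show "(\<eta> j N)\<^sup>2 \<in> S N" by (simp add: S_def)
        qed
        show "\<forall>v\<in>S N - (\<lambda>j. (\<eta> j N)\<^sup>2) ` {..<J}. ?f v = 0"
        proof
          fix v assume v: "v \<in> S N - (\<lambda>j. (\<eta> j N)\<^sup>2) ` {..<J}"
          have "X \<le> v"
          proof (cases "v = U N")
            case False
            then obtain k where k: "k \<in> {1..N}" "v = (y N k)\<^sup>2" using v by (auto simp: S_def)
            have "\<xi> J - pi / 2 \<le> y N k"
            proof (rule ccontr)
              assume "\<not> \<xi> J - pi / 2 \<le> y N k"
              then have "y N k \<in> {t \<in> y N ` {1..N}. t < \<xi> J - pi / 2}" using k(1) by simp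
              then obtain j where "j < J" "y N k = \<eta> j N" unfolding zb by auto
              then show False using v k(2) by simp
            qed
            then have "sqrt X \<le> y N k" using JL by linarith
            then have "(sqrt X)\<^sup>2 \<le> (y N k)\<^sup>2" using X by (intro power_mono) auto
            then show ?thesis using X k(2) by simp
          qed (use elim in simp)
          then show "?f v = 0" using X by (simp add: \<kappa>(2))
        qed
      qed
      then show ?case by (simp add: sum.reindex[OF inj2])
    qed
  qed
  ultimately show ?thesis by (simp only:) (rule Lim_transform_eventually)
qed

text \<open>A zero is either in the first cell, within \<open>pi/4\<close> of
  \<open>\<xi> 0 \<ge> pi/2\<close>, or beyond that cell; the extra knot tends to infinity.\<close>

lemma S_lower_bound: "\<forall>\<^sub>F N in sequentially. \<forall>v\<in>S N. (pi / 4)\<^sup>2 \<le> v"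
proof -
  have "\<forall>\<^sub>F N in sequentially. U N \<ge> (pi / 4)\<^sup>2" using U by (simp add: filterlim_at_top)
  with zeros_below[of 1] show ?thesis
  proof eventually_elim
    case (elim N)
    show ?case
    proof
      fix v assume "v \<in> S N"
      then consider "v = U N" | k where "k \<in> {1..N}" "v = (y N k)\<^sup>2" by (auto simp: S_def)
      then show "(pi / 4)\<^sup>2 \<le> v"
      proof cases
        case 2
        have "pi / 4 \<le> y N k"
        proof (cases "y N k < \<xi> 1 - pi / 2")
          case True
          then have "y N k \<in> {t \<in> y N ` {1..N}. t < \<xi> 1 - pi / 2}" using 2(1) by simp
          also have "\<dots> = (\<lambda>j. \<eta> j N) ` {..<1}" by (rule conjunct1[OF elim(1)])
          finally have "y N k \<in> (\<lambda>j. \<eta> j N) ` {..<1}" .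
          then have "y N k = \<eta> 0 N" by auto
          moreover have "\<bar>\<eta> 0 N - \<xi> 0\<bar> < pi / 4" using elim(1) by simp
          ultimately show ?thesis using \<xi>_gt(1)[of 0] by linarith
        next
          case False
          moreover have "\<xi> 1 = \<xi> 0 + pi" using \<xi>_add[of 1] by simp
          ultimately show ?thesis using \<xi>_gt(1)[of 0] pi_gt_zero by linarith
        qed
        then show ?thesis using 2 by (auto intro!: power_mono)
      qed (use elim in simp)
    qed
  qed
qed

section \<open>The limit series and the theta-like functions\<close>

lemma abs_\<alpha>_le: "\<bar>\<alpha> j\<bar> \<le> 2"
proof -
  have "\<xi> j \<ge> 1" using \<xi>_ge[of j] by simp
  then have "\<xi> j ^ d / \<xi> j \<le> 1" "0 \<le> \<xi> j ^ d / \<xi> j" using d by auto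
  moreover have "\<bar>\<alpha> j\<bar> = 2 * \<bar>\<xi> j ^ d / \<xi> j\<bar>" by (simp add: \<alpha>_def abs_mult power_abs)
  ultimately show ?thesis by simp
qed

lemma abs_\<alpha>_exp_le:
  assumes "t > 0"
  shows "\<bar>\<alpha> j\<bar> * exp (- (\<xi> j)\<^sup>2 / t) \<le> 2 * exp (- 1 / t) * exp (- 1 / t) ^ j"
proof -
  have "exp (- (\<xi> j)\<^sup>2 / t) \<le> exp (real (Suc j) * (- 1 / t))"
    using divide_right_mono[OF \<xi>_sq_ge[of j], of t] assms by (simp add: add.commute)
  also have "\<dots> = exp (- 1 / t) ^ Suc j" by (rule exp_of_nat_mult)
  finally have "\<bar>\<alpha> j\<bar> * exp (- (\<xi> j)\<^sup>2 / t) \<le> 2 * exp (- 1 / t) ^ Suc j"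
    by (intro mult_mono abs_\<alpha>_le) auto
  then show ?thesis by (simp only: power_Suc mult.assoc)
qed

lemma summable_abs_\<alpha>_exp:
  assumes "t > 0"
  shows "summable (\<lambda>j. \<bar>\<alpha> j\<bar> * exp (- (\<xi> j)\<^sup>2 / t))"
proof (rule summable_comparison_test')
  have "norm (exp (- 1 / t)) < 1" using assms by simp
  then show "summable (\<lambda>j. 2 * exp (- 1 / t) * exp (- 1 / t) ^ j)"
    by (intro summable_mult summable_geometric)
  show "norm (\<bar>\<alpha> j\<bar> * exp (- (\<xi> j)\<^sup>2 / t)) \<le> 2 * exp (- 1 / t) * exp (- 1 / t) ^ j" if "j \<ge> 0" for j
    using abs_\<alpha>_exp_le[OF assms, of j] by (simp only: real_norm_def abs_mult abs_abs abs_exp_cancel)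
qed

lemma summable_\<alpha>_exp:
  assumes "t > 0"
  shows "summable (\<lambda>j. \<alpha> j * exp (- (\<xi> j)\<^sup>2 / t))"
  by (rule summable_norm_cancel) (use summable_abs_\<alpha>_exp[OF assms] in \<open>simp only: real_norm_def abs_mult abs_exp_cancel\<close>)

lemma theta_pos_eq:
  assumes "t > 0"
  shows "theta_pos d t = 1 - (\<Sum>j. \<alpha> j * exp (- (\<xi> j)\<^sup>2 / t))"
proof (cases "d = 0")
  case True
  have a: "\<alpha> j * exp (- (\<xi> j)\<^sup>2 / t) = 4 / pi * ((- 1) ^ j * exp (- (pi\<^sup>2 / 4) * (2 * real j + 1)\<^sup>2 * inverse t) / (2 * real j + 1))" for j
  proof -
    have x: "\<xi> j = (2 * real j + 1) * pi / 2" unfolding \<xi>_def using True by simp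
    have e: "- (\<xi> j)\<^sup>2 / t = - (pi\<^sup>2 / 4) * (2 * real j + 1)\<^sup>2 * inverse t"
    proof -
      have "(\<xi> j)\<^sup>2 = pi\<^sup>2 / 4 * (2 * real j + 1)\<^sup>2" unfolding x by (simp add: power_mult_distrib power_divide)
      then show ?thesis by (simp only: divide_inverse[of _ t] mult_minus_left)
    qed
    have "\<alpha> j = 2 * (- 1) ^ j / \<xi> j" unfolding \<alpha>_def using True by simp
    also have "\<dots> = 4 / pi * ((- 1) ^ j / (2 * real j + 1))" unfolding x by simp
    finally show ?thesis unfolding e by simp
  qed
  have s: "summable (\<lambda>j. (- 1) ^ j * exp (- (pi\<^sup>2 / 4) * (2 * real j + 1)\<^sup>2 * inverse t) / (2 * real j + 1))"
    using summable_\<alpha>_exp[OF assms] unfolding a by (subst (asm) summable_cmult_iff) simp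
  show ?thesis unfolding a suminf_mult[OF s] using True by (simp add: theta_pos_def)
next
  case False
  then have d1: "d = 1" using d by auto
  have a: "\<alpha> j * exp (- (\<xi> j)\<^sup>2 / t) = - 2 * ((- 1) ^ Suc j * exp (- (pi * real (Suc j))\<^sup>2 * inverse t))" for j
  proof -
    have x: "\<xi> j = pi * real (Suc j)" unfolding \<xi>_def using d1 by (simp add: algebra_simps)
    have "\<alpha> j = 2 * (- 1) ^ j" unfolding \<alpha>_def using d1 \<xi>_gt(2)[of j] by simp
    then show ?thesis unfolding x divide_inverse by simp
  qed
  have s: "summable (\<lambda>j. (- 1) ^ Suc j * exp (- (pi * real (Suc j))\<^sup>2 * inverse t))"
    using summable_\<alpha>_exp[OF assms] unfolding a by (subst (asm) summable_cmult_iff) simp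
  show ?thesis unfolding a suminf_mult[OF s] using d1 by (simp add: theta_pos_def)
qed

lemma theta_like_eq:
  assumes "t > 0"
  shows "theta_like d t = 1 - (\<Sum>j. \<alpha> j * exp (- (\<xi> j)\<^sup>2 / t))"
  using assms theta_pos_eq by (simp add: theta_like_def)

text \<open>With \<open>q = exp (- 1/t)\<close> the series is dominated by the geometric value
  \<open>2 q / (1 - q)\<close>, which tends to 0 as \<open>t\<close> decreases to 0.\<close>

lemma theta_like_0: "theta_like d 0 = 1"
proof -
  have "((\<lambda>t. \<Sum>j. \<alpha> j * exp (- (\<xi> j)\<^sup>2 / t)) \<longlongrightarrow> 0) (at_right 0)"
  proof (rule Lim_null_comparison)
    show "\<forall>\<^sub>F t in at_right 0. norm (\<Sum>j. \<alpha> j * exp (- (\<xi> j)\<^sup>2 / t)) \<le> 2 * exp (- 1 / t) * (1 / (1 - exp (- 1 / t)))"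
      using eventually_at_right_less[of 0]
    proof eventually_elim
      case (elim t)
      have q: "norm (exp (- 1 / t)) < 1" using elim by simp
      have "norm (\<Sum>j. \<alpha> j * exp (- (\<xi> j)\<^sup>2 / t)) \<le> (\<Sum>j. 2 * exp (- 1 / t) * exp (- 1 / t) ^ j)"
      proof (rule norm_suminf_le)
        show "norm (\<alpha> j * exp (- (\<xi> j)\<^sup>2 / t)) \<le> 2 * exp (- 1 / t) * exp (- 1 / t) ^ j" for j
          using abs_\<alpha>_exp_le[OF elim, of j] by (simp only: real_norm_def abs_mult abs_exp_cancel)
        show "summable (\<lambda>j. 2 * exp (- 1 / t) * exp (- 1 / t) ^ j)"
          by (intro summable_mult summable_geometric q)
      qed
      also have "\<dots> = 2 * exp (- 1 / t) * (1 / (1 - exp (- 1 / t)))"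
        by (simp only: suminf_mult[OF summable_geometric[OF q]] suminf_geometric[OF q])
      finally show ?case .
    qed
    show "((\<lambda>t. 2 * exp (- 1 / t) * (1 / (1 - exp (- 1 / t)))) \<longlongrightarrow> 0) (at_right (0::real))"
      by real_asymp
  qed
  then have "((\<lambda>t. 1 - (\<Sum>j. \<alpha> j * exp (- (\<xi> j)\<^sup>2 / t))) \<longlongrightarrow> 1 - 0) (at_right 0)"
    by (intro tendsto_intros)
  then have "(theta_pos d \<longlongrightarrow> 1 - 0) (at_right 0)"
  proof (rule Lim_transform_eventually)
    show "\<forall>\<^sub>F t in at_right 0. 1 - (\<Sum>j. \<alpha> j * exp (- (\<xi> j)\<^sup>2 / t)) = theta_pos d t"
      using eventually_at_right_less[of 0] by eventually_elim (simp only: theta_pos_eq)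
  qed
  then have "Lim (at_right 0) (theta_pos d) = 1 - 0" by (intro tendsto_Lim) auto
  then show ?thesis by (simp add: theta_like_def)
qed

end

section \<open>Factorisation of the polynomials and the main theorem\<close>

lemma cpoly_add: "cpoly (p + q) z = cpoly p z + cpoly q z"
  by (induction p q rule: poly_induct2) (simp_all add: map_poly_pCons algebra_simps)

lemma cpoly_smult: "cpoly (smult a p) z = of_real a * cpoly p z"
  by (simp add: map_poly_smult)

lemma cpoly_mult: "cpoly (p * q) z = cpoly p z * cpoly q z"
proof (induction p)
  case (pCons a p)
  have "cpoly (pCons a p * q) z = of_real a * cpoly q z + z * cpoly (p * q) z"
    by (simp add: mult_pCons_left cpoly_add map_poly_smult map_poly_pCons)
  then show ?case using pCons by (simp add: map_poly_pCons algebra_simps)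
qed simp

lemma cpoly_prod: "cpoly (\<Prod>k\<in>A. p k) z = (\<Prod>k\<in>A. cpoly (p k) z)"
  by (induction A rule: infinite_finite_induct) (simp_all add: cpoly_mult map_poly_1')

text \<open>Both polynomials are monic of degree \<open>2 N + d\<close>, so agreement at
  \<open>2 N + d\<close> points is enough: the zeros, their negatives, and 0 for
  \<open>d = 1\<close>, where oddness forces the value 0.\<close>

lemma poly_eq_prod_zeros:
  fixes p :: "real poly"
  assumes d: "d \<in> {0, 1::nat}" and deg: "degree p = 2 * N + d" "lead_coeff p = 1"
    and sym: "\<And>t. poly p (- t) = (- 1) ^ d * poly p t"
    and x: "bij_betw x {1..N} {t. 0 < t \<and> poly p t = 0}"
  shows "p = monom 1 d * (\<Prod>k=1..N. [:- (x k)\<^sup>2, 0, 1:])"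
proof -
  define X where "X = {t. 0 < t \<and> poly p t = 0}"
  define Z where "Z = (if d = 1 then {0::real} else {})"
  have X: "X = x ` {1..N}" "inj_on x {1..N}" using x by (auto simp: bij_betw_def X_def)
  have cX: "finite X" "card X = N" using X by (auto simp: card_image)
  let ?q = "monom 1 d * (\<Prod>k=1..N. [:- (x k)\<^sup>2, 0, 1:])"
  have degq: "degree ?q = 2 * N + d"
  proof -
    have "degree (\<Prod>k=1..N. [:- (x k)\<^sup>2, 0, 1:]) = (\<Sum>k=1..N. degree [:- (x k)\<^sup>2, 0, 1:])"
      by (rule degree_prod_eq_sum_degree) auto
    also have "\<dots> = 2 * N" by simp
    finally have 1: "degree (\<Prod>k=1..N. [:- (x k)\<^sup>2, 0, 1:]) = 2 * N" .
    have 2: "degree (monom (1::real) d) = d" by (rule degree_monom_eq) simp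
    have "degree ?q = degree (monom (1::real) d) + degree (\<Prod>k=1..N. [:- (x k)\<^sup>2, 0, 1:])"
      by (rule degree_mult_eq) (auto simp: monom_eq_0_iff)
    then show ?thesis unfolding 1 2 by simp
  qed
  have leadq: "lead_coeff ?q = 1"
    by (simp add: lead_coeff_mult lead_coeff_prod degree_monom_eq)
  have Znn: "uminus ` X \<inter> X = {}" "Z \<inter> (X \<union> uminus ` X) = {}" "finite Z" "card Z = d"
    using d by (auto simp: X_def Z_def)
  show ?thesis
  proof (rule poly_eqI_degree_lead_coeff[of _ "2 * N + d" _ "Z \<union> (X \<union> uminus ` X)"])
    have "card (X \<union> uminus ` X) = N + N"
      using cX Znn(1) by (subst card_Un_disjoint) (auto simp: card_image)
    then have "card (Z \<union> (X \<union> uminus ` X)) = d + (N + N)"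
      using cX Znn by (subst card_Un_disjoint) auto
    then show "2 * N + d \<le> card (Z \<union> (X \<union> uminus ` X))" by simp
    show "coeff p (2 * N + d) = coeff ?q (2 * N + d)"
      using deg leadq degq by metis
    fix t assume t: "t \<in> Z \<union> (X \<union> uminus ` X)"
    have "poly p t = 0"
    proof (cases "t \<in> Z")
      case True
      then have "t = 0" "d = 1" by (auto simp: Z_def split: if_splits)
      then show ?thesis using sym[of 0] by simp
    next
      case False
      then consider "t \<in> X" | s where "s \<in> X" "t = - s" using t by auto
      then show ?thesis by cases (auto simp: X_def sym)
    qed
    moreover have "poly ?q t = 0"
    proof (cases "t \<in> Z")
      case True
      then have "t = 0" "d = 1" by (auto simp: Z_def split: if_splits)
      then show ?thesis by (simp add: poly_monom)
    next
      case False
      then obtain s where s: "s \<in> X" "t = s \<or> t = - s" using t by auto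
      then obtain k where "k \<in> {1..N}" "s = x k" using X by auto
      then have "\<exists>k\<in>{1..N}. poly [:- (x k)\<^sup>2, 0, 1:] t = 0"
        using s by (intro bexI[of _ k]) (auto simp: power2_eq_square)
      then have "(\<Prod>k=1..N. poly [:- (x k)\<^sup>2, 0, 1:] t) = 0"
        by (intro prod_zero) auto
      then show ?thesis by (simp only: poly_mult poly_prod mult_zero_right)
    qed
    ultimately show "poly p t = poly ?q t" by simp
  qed (use deg degq in simp_all)
qed

lemma derivative_at_0_monom_mult:
  fixes q :: "real poly"
  assumes "d \<in> {0, 1::nat}"
  shows "poly ((pderiv ^^ d) (monom 1 d * q)) 0 = poly q 0"
  using assms by (auto simp: pderiv_mult pderiv_monom poly_monom)

lemma tendsto_1_plus_inverse: "(\<lambda>N. real (N + 1) / real N) \<longlonglongrightarrow> 1"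
proof -
  have "(\<lambda>N. 1 + inverse (real N)) \<longlonglongrightarrow> 1 + 0"
    by (intro tendsto_intros tendsto_inverse_0_at_top filterlim_real_sequentially)
  then have "(\<lambda>N. 1 + inverse (real N)) \<longlonglongrightarrow> 1" by simp
  then show ?thesis
  proof (rule Lim_transform_eventually)
    show "\<forall>\<^sub>F N in sequentially. 1 + inverse (real N) = real (N + 1) / real N"
      using eventually_ge_at_top[of 1] by eventually_elim (simp add: field_simps)
  qed
qed

theorem theorem6p2:
  fixes d :: nat and r :: real
    and P :: "nat \<Rightarrow> real poly"
    and \<beta> \<gamma> \<delta> u :: "nat \<Rightarrow> real"
    and x :: "nat \<Rightarrow> nat \<Rightarrow> real"
    and \<Omega> :: "nat \<Rightarrow> real set"
  assumes "d \<in> {0, 1}"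
    and "class_P d \<beta> \<gamma> \<delta> P"
    and "\<And>N. N \<ge> 1 \<Longrightarrow> bij_betw (x N) {1..N} {y. 0 < y \<and> poly (P N) y = 0}"
    and "\<And>N. N \<ge> 1 \<Longrightarrow> u N > 0"
    and "\<And>N. N \<ge> 1 \<Longrightarrow> u N \<notin> x N ` {1..N}"
    and "filterlim (\<lambda>N. \<beta> N * u N) at_top sequentially"
    and "\<And>N. N \<ge> 1 \<Longrightarrow> \<Omega> N = {0, (u N)\<^sup>2} \<union> (\<lambda>k. (x N k)\<^sup>2) ` {1..N}"
    and "r > 0"
    and "rbeta_condition r \<beta> u
           (\<lambda>N. smult (1 / poly ((pderiv ^^ d) (P N)) 0) (P N div monom 1 d))"
  shows "\<forall>t\<ge>0. (\<lambda>N. (u N)\<^sup>2 * (\<Prod>k=1..N. (x N k)\<^sup>2) / real N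
             * assoc_bspline N (real N / (\<beta> N)\<^sup>2 * t) (\<Omega> N))
           \<longlonglongrightarrow> theta_like d t"
proof (intro allI impI)
  fix t :: real assume t: "t \<ge> 0"
  note d = assms(1)
  have \<beta>_pos: "\<beta> N > 0" if "N \<ge> 1" for N
    using assms(2) that unfolding class_P_def by blast
  have \<delta>_pos: "\<delta> N > 0" if "N \<ge> 1" for N
    using assms(2) that unfolding class_P_def by blast
  have \<gamma>_lim: "filterlim \<gamma> at_top sequentially"
    and \<delta>_lim: "filterlim (\<lambda>N. inverse (\<delta> N)) at_top sequentially"
    using assms(2) unfolding class_P_def by blast+
  have P: "degree (P N) = 2 * N + d" "lead_coeff (P N) = 1"
    "\<And>s. poly (P N) (- s) = (- 1) ^ d * poly (P N) s" if "N \<ge> 1" for N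
    using assms(2) that unfolding class_P_def by blast+
  obtain C where C: "\<And>N z. N \<ge> 1 \<Longrightarrow> cmod z \<le> \<gamma> N \<Longrightarrow>
      cmod (of_real (\<beta> N) ^ d * cpoly (P N) (z / of_real (\<beta> N)) / of_real (poly ((pderiv ^^ d) (P N)) 0)
              - cos (z - of_real (real d * pi / 2)))
        \<le> C * \<delta> N * min ((cmod z)\<^sup>2) 1 * hyp d (cmod z)"
    using assms(2) unfolding class_P_def by blast
  have x_inj: "inj_on (x N) {1..N}" and x_pos: "\<And>k. k \<in> {1..N} \<Longrightarrow> x N k > 0" if "N \<ge> 1" for N
    using assms(3)[OF that] by (auto simp: bij_betw_def)
  define Q where "Q N = (\<Prod>k=1..N. [:- (x N k)\<^sup>2, 0, 1:])" for N
  define c where "c N = (\<Prod>k=1..N. - (x N k)\<^sup>2)" for N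
  have PQ: "P N = monom 1 d * Q N" if "N \<ge> 1" for N
    unfolding Q_def by (rule poly_eq_prod_zeros[OF d P[OF that] assms(3)[OF that]])
  have c: "poly ((pderiv ^^ d) (P N)) 0 = c N" if "N \<ge> 1" for N
    unfolding PQ[OF that] derivative_at_0_monom_mult[OF d] by (simp add: Q_def c_def poly_prod)
  have c0: "c N \<noteq> 0" if "N \<ge> 1" for N
    using x_pos[OF that] by (force simp: c_def)
  have Q_cpoly: "cpoly (Q N) z / of_real (c N) = (\<Prod>k=1..N. 1 - z\<^sup>2 / of_real ((x N k)\<^sup>2))" if "N \<ge> 1" for N z
  proof -
    have "cpoly (Q N) z / of_real (c N) = (\<Prod>k=1..N. cpoly [:- (x N k)\<^sup>2, 0, 1:] z / of_real (- (x N k)\<^sup>2))"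
      unfolding Q_def c_def cpoly_prod prod_dividef of_real_prod ..
    also have "\<dots> = (\<Prod>k=1..N. 1 - z\<^sup>2 / of_real ((x N k)\<^sup>2))"
    proof (rule prod.cong[OF refl])
      fix k assume "k \<in> {1..N}"
      then have "x N k \<noteq> 0" using x_pos[OF that, of k] by simp
      then show "cpoly [:- (x N k)\<^sup>2, 0, 1:] z / of_real (- (x N k)\<^sup>2) = 1 - z\<^sup>2 / of_real ((x N k)\<^sup>2)"
        by (simp add: map_poly_pCons power2_eq_square field_simps)
    qed
    finally show ?thesis .
  qed
  define y where "y N k = \<beta> N * x N k" for N k
  define U where "U N = (\<beta> N * u N)\<^sup>2" for N
  \<comment> \<open>The constant \<open>C\<close> may be negative, hence the absolute value;
    \<open>hyp d\<close> is bounded by \<open>cosh\<close> for both parities.\<close>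
  interpret scaled_zeros d y U \<gamma> "\<lambda>N. \<bar>C\<bar> * \<delta> N"
  proof
    show "d \<in> {0, 1}" by (rule d)
    show "y N k > 0" if "N \<ge> 1" "k \<in> {1..N}" for N k
      unfolding y_def using \<beta>_pos x_pos that by (intro mult_pos_pos)
    show "inj_on (y N) {1..N}" if "N \<ge> 1" for N
    proof (rule inj_onI)
      fix i j assume ij: "i \<in> {1..N}" "j \<in> {1..N}" "y N i = y N j"
      then have "x N i = x N j" using \<beta>_pos[OF that] by (simp add: y_def)
      then show "i = j" by (rule inj_onD[OF x_inj[OF that] _ ij(1,2)])
    qed
    show "filterlim \<gamma> at_top sequentially" by (rule \<gamma>_lim)
    show "(\<lambda>N. \<bar>C\<bar> * \<delta> N) \<longlonglongrightarrow> 0"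
      using tendsto_mult_right_zero[OF tendsto_inverse_0_at_top[OF \<delta>_lim], of "\<bar>C\<bar>"] by simp
    show "cmod (z ^ d * (\<Prod>k=1..N. 1 - z\<^sup>2 / of_real ((y N k)\<^sup>2)) - cos (z - of_real (real d * pi / 2)))
        \<le> \<bar>C\<bar> * \<delta> N * min ((cmod z)\<^sup>2) 1 * cosh (cmod z)" if N: "N \<ge> 1" and z: "cmod z \<le> \<gamma> N" for N z
    proof -
      have b: "\<beta> N \<noteq> 0" using \<beta>_pos[OF N] by simp
      have "of_real (\<beta> N) ^ d * cpoly (P N) (z / of_real (\<beta> N)) / of_real (poly ((pderiv ^^ d) (P N)) 0)
         = of_real (\<beta> N) ^ d * (z / of_real (\<beta> N)) ^ d * (cpoly (Q N) (z / of_real (\<beta> N)) / of_real (c N))"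
        unfolding c[OF N] unfolding PQ[OF N] cpoly_mult by (simp add: map_poly_monom poly_monom)
      also have "of_real (\<beta> N) ^ d * (z / of_real (\<beta> N)) ^ d = z ^ d"
      proof -
        have "of_real (\<beta> N) * (z / of_real (\<beta> N)) = z" using b by simp
        then show ?thesis by (simp only: power_mult_distrib[symmetric])
      qed
      also have "cpoly (Q N) (z / of_real (\<beta> N)) / of_real (c N) = (\<Prod>k=1..N. 1 - z\<^sup>2 / of_real ((y N k)\<^sup>2))"
        unfolding Q_cpoly[OF N]
      proof (rule prod.cong[OF refl])
        fix k
        show "1 - (z / of_real (\<beta> N))\<^sup>2 / of_real ((x N k)\<^sup>2) = 1 - z\<^sup>2 / complex_of_real ((y N k)\<^sup>2)"
          by (simp only: y_def power_divide power_mult_distrib of_real_mult of_real_power divide_divide_eq_left)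
      qed
      finally have eq: "of_real (\<beta> N) ^ d * cpoly (P N) (z / of_real (\<beta> N)) / of_real (poly ((pderiv ^^ d) (P N)) 0)
         = z ^ d * (\<Prod>k=1..N. 1 - z\<^sup>2 / of_real ((y N k)\<^sup>2))" .
      have h: "0 \<le> hyp d (cmod z)" "hyp d (cmod z) \<le> cosh (cmod z)"
        by (auto simp: hyp_def sinh_le_cosh_real)
      have "C * \<delta> N * min ((cmod z)\<^sup>2) 1 * hyp d (cmod z) \<le> \<bar>C\<bar> * \<delta> N * min ((cmod z)\<^sup>2) 1 * cosh (cmod z)"
        using \<delta>_pos[OF N] h by (intro mult_mono) auto
      then show ?thesis using C[OF N z] unfolding eq by linarith
    qed
    show "U N > 0" if "N \<ge> 1" for N
      unfolding U_def using \<beta>_pos[OF that] assms(4)[OF that] by simp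
    show "filterlim U at_top sequentially"
      unfolding U_def by (rule filterlim_pow_at_top[OF _ assms(6)]) simp
    show "U N \<notin> (\<lambda>k. (y N k)\<^sup>2) ` {1..N}" if N: "N \<ge> 1" for N
    proof
      assume "U N \<in> (\<lambda>k. (y N k)\<^sup>2) ` {1..N}"
      then obtain k where k: "k \<in> {1..N}" "(\<beta> N * u N)\<^sup>2 = (\<beta> N * x N k)\<^sup>2" by (auto simp: U_def y_def)
      have "\<beta> N * u N = \<beta> N * x N k"
        by (rule power2_eq_imp_eq[OF k(2)]) (use \<beta>_pos[OF N] assms(4)[OF N] x_pos[OF N k(1)] in simp_all)
      then have "u N = x N k" using \<beta>_pos[OF N] by simp
      then show False using assms(5)[OF N] k(1) by blast
    qed
  qed
  define V where "V N = insert ((u N)\<^sup>2) ((\<lambda>k. (x N k)\<^sup>2) ` {1..N})" for N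
  have sq_inj: "inj_on (\<lambda>k. (x N k)\<^sup>2) {1..N}" if "N \<ge> 1" for N
  proof (rule inj_onI)
    fix i j assume ij: "i \<in> {1..N}" "j \<in> {1..N}" "(x N i)\<^sup>2 = (x N j)\<^sup>2"
    have "x N i = x N j"
      by (rule power2_eq_imp_eq[OF ij(3)]) (use x_pos[OF that ij(1)] x_pos[OF that ij(2)] in simp_all)
    then show "i = j" by (rule inj_onD[OF x_inj[OF that] _ ij(1,2)])
  qed
  have u_notin: "(u N)\<^sup>2 \<notin> (\<lambda>k. (x N k)\<^sup>2) ` {1..N}" if N: "N \<ge> 1" for N
  proof
    assume "(u N)\<^sup>2 \<in> (\<lambda>k. (x N k)\<^sup>2) ` {1..N}"
    then obtain k where k: "k \<in> {1..N}" "(u N)\<^sup>2 = (x N k)\<^sup>2" by auto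
    have "u N = x N k"
      by (rule power2_eq_imp_eq[OF k(2)]) (use assms(4)[OF N] x_pos[OF N k(1)] in simp_all)
    then show False using assms(5)[OF N] k(1) by blast
  qed
  have V_fin: "finite (V N)" for N by (simp add: V_def)
  have V_prod: "(\<Prod>v\<in>V N. f v) = f ((u N)\<^sup>2) * (\<Prod>k=1..N. f ((x N k)\<^sup>2))" if "N \<ge> 1" for N and f :: "real \<Rightarrow> real"
    unfolding V_def prod.insert[OF finite_imageI[OF finite_atLeastAtMost] u_notin[OF that]]
      prod.reindex[OF sq_inj[OF that]] o_def ..
  have V_card: "card (V N) = Suc N" if N: "N \<ge> 1" for N
  proof -
    have "card (V N) = Suc (card ((\<lambda>k. (x N k)\<^sup>2) ` {1..N}))"
      unfolding V_def by (rule card_insert_disjoint[OF _ u_notin[OF N]]) (rule finite_imageI, rule finite_atLeastAtMost)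
    also have "card ((\<lambda>k. (x N k)\<^sup>2) ` {1..N}) = card {1..N}" by (rule card_image[OF sq_inj[OF N]])
    also have "card {1..N} = N" by (rule card_atLeastAtMost[THEN trans]) simp
    finally show ?thesis .
  qed
  have V_pos: "v > 0" if N: "N \<ge> 1" and v: "v \<in> V N" for N v
  proof (cases "v = (u N)\<^sup>2")
    case True
    then show ?thesis using assms(4)[OF N] by simp
  next
    case False
    then obtain k where k: "k \<in> {1..N}" "v = (x N k)\<^sup>2" using v unfolding V_def by blast
    then show ?thesis using x_pos[OF N k(1)] by simp
  qed
  have \<Omega>V: "\<Omega> N = insert 0 (V N)" if "N \<ge> 1" for N
    unfolding assms(7)[OF that] V_def by blast
  have SV: "S N = (*) ((\<beta> N)\<^sup>2) ` V N" for N
    unfolding S_def V_def U_def y_def by (simp add: power_mult_distrib image_image)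
  \<comment> \<open>Half of \<open>r\<close>, since the knots are squares of zeros; \<open>n\<close>
    is an integer at least \<open>a + 1\<close>, so the poles of the kernel's transform keep
    distance at least 1 from the line.\<close>
  define a where "a = r / 2"
  define n where "n = nat \<lceil>a\<rceil> + 1"
  have a: "a \<ge> 0" "a + 1 \<le> real n" using assms(8) by (auto simp: a_def n_def)
  define G where "G N = smult (1 / poly ((pderiv ^^ d) (P N)) 0) (P N div monom 1 d)" for N
  obtain N0 \<mu> K where N0: "N0 \<ge> 1" and K: "\<And>s N. Re s = r \<Longrightarrow> N \<ge> N0 \<Longrightarrow>
        \<beta> N powr r *
          cmod (LBINT t:{0<..}. of_real t powr (s - 1)
                  / (of_real (1 + (t / u N)\<^sup>2) * cpoly (G N) (\<i> * of_real t)))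
        \<le> K * (1 + \<bar>Im s\<bar>) powr \<mu> * exp (- (pi / 2) * \<bar>Im s\<bar>)"
    using assms(9) unfolding rbeta_condition_def G_def by blast
  define p where "p = nat \<lceil>\<bar>\<mu>\<bar>\<rceil>"
  \<comment> \<open>The condition \<open>real N \<ge> r\<close> ensures
    \<open>r < 2 (N + 1)\<close>, the range in which the Mellin integral with \<open>N + 1\<close>
    knots converges.\<close>
  have bound: "cmod (\<Sum>v\<in>S N. of_real (pf_coeff (S N) v) * of_real v powr (of_real a + \<i> * of_real \<tau>)) \<le> \<bar>K\<bar> * 2 ^ p * (1 + \<bar>\<tau>\<bar>) ^ p"
    if N: "N \<ge> N0" "real N \<ge> r" for N \<tau>
  proof -
    have N1: "N \<ge> 1" using N N0 by simp
    define s where "s = of_real r + \<i> * of_real (2 * \<tau>)"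
    have s: "Re s = r" "Im s = 2 * \<tau>" "s / 2 = of_real a + \<i> * of_real \<tau>"
      by (auto simp: s_def a_def complex_eq_iff)
    \<comment> \<open>On the imaginary axis each factor \<open>1 - z^2 / x^2\<close> becomes
      \<open>1 + \<sigma>^2 / x^2\<close>, so the extra factor in the condition is just the one for
      the knot \<open>u^2\<close>.\<close>
    have "cpoly (G N) (\<i> * of_real \<sigma>) = of_real (\<Prod>k=1..N. 1 + \<sigma>\<^sup>2 / (x N k)\<^sup>2)" for \<sigma>
    proof -
      have "P N div monom 1 d = Q N" unfolding PQ[OF N1] by (rule nonzero_mult_div_cancel_left) (simp add: monom_eq_0_iff)
      then have "cpoly (G N) (\<i> * of_real \<sigma>) = cpoly (Q N) (\<i> * of_real \<sigma>) / of_real (c N)"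
        by (simp add: G_def cpoly_smult c[OF N1])
      also have "\<dots> = of_real (\<Prod>k=1..N. 1 + \<sigma>\<^sup>2 / (x N k)\<^sup>2)"
        unfolding Q_cpoly[OF N1] by (simp add: power_mult_distrib)
      finally show ?thesis .
    qed
    then have F: "of_real (1 + (\<sigma> / u N)\<^sup>2) * cpoly (G N) (\<i> * of_real \<sigma>)
         = of_real (\<Prod>v\<in>V N. 1 + \<sigma>\<^sup>2 / v)" for \<sigma>
      unfolding V_prod[OF N1] by (simp only: of_real_mult power_divide)
    have M: "\<beta> N powr Re s * cmod (LBINT t:{0<..}. of_real t powr (s - 1) / of_real (\<Prod>v\<in>V N. 1 + t\<^sup>2 / v))
        \<le> K * (1 + \<bar>Im s\<bar>) powr \<mu> * exp (- (pi / 2) * \<bar>Im s\<bar>)"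
      using K[OF s(1) N(1)] unfolding F s(1) .
    have "cmod (\<Sum>v\<in>(*) ((\<beta> N)\<^sup>2) ` V N. of_real (pf_coeff ((*) ((\<beta> N)\<^sup>2) ` V N) v) * of_real v powr (s / 2)) \<le> K * (1 + \<bar>Im s\<bar>) powr \<mu>"
      by (rule scaled_pf_sum_bound[OF V_fin V_pos[OF N1] _ _ \<beta>_pos[OF N1] M])
         (use s(1) assms(8) N V_card[OF N1] in auto)
    then have "cmod (\<Sum>v\<in>S N. of_real (pf_coeff (S N) v) * of_real v powr (of_real a + \<i> * of_real \<tau>)) \<le> K * (1 + \<bar>Im s\<bar>) powr \<mu>"
      unfolding SV s(3) .
    \<comment> \<open>Here \<open>Im s = 2 \<tau>\<close>, and
      \<open>1 + 2 |\<tau>| \<le> 2 (1 + |\<tau>|)\<close> explains the factor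
      \<open>2 ^ p\<close>.\<close>
    also have "\<dots> \<le> \<bar>K\<bar> * ((2 * (1 + \<bar>\<tau>\<bar>)) ^ p)"
    proof (intro mult_mono)
      have "(1 + \<bar>Im s\<bar>) powr \<mu> \<le> (1 + \<bar>Im s\<bar>) powr (real p)"
      proof (rule powr_mono)
        show "\<mu> \<le> real p" unfolding p_def by linarith
      qed simp
      also have "\<dots> = (1 + \<bar>Im s\<bar>) ^ p" by (intro powr_realpow) auto
      also have "\<dots> \<le> (2 * (1 + \<bar>\<tau>\<bar>)) ^ p" by (intro power_mono) (auto simp: s(2))
      finally show "(1 + \<bar>Im s\<bar>) powr \<mu> \<le> (2 * (1 + \<bar>\<tau>\<bar>)) ^ p" .
    qed auto
    finally show ?thesis by (simp only: power_mult_distrib mult.assoc)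
  qed
  show "(\<lambda>N. (u N)\<^sup>2 * (\<Prod>k=1..N. (x N k)\<^sup>2) / real N * assoc_bspline N (real N / (\<beta> N)\<^sup>2 * t) (\<Omega> N)) \<longlonglongrightarrow> theta_like d t"
  proof (cases "t = 0")
    case True
    show ?thesis unfolding True theta_like_0
    proof (rule Lim_transform_eventually[OF tendsto_1_plus_inverse])
      show "\<forall>\<^sub>F N in sequentially. real (N + 1) / real N = (u N)\<^sup>2 * (\<Prod>k=1..N. (x N k)\<^sup>2) / real N * assoc_bspline N (real N / (\<beta> N)\<^sup>2 * 0) (\<Omega> N)"
        using eventually_ge_at_top[of 1]
      proof eventually_elim
        case (elim N)
        have "(\<Prod>(V N)) * assoc_bspline N 0 (insert 0 (V N)) = real (N + 1)"
          by (rule assoc_bspline_0[OF V_fin V_card[OF elim] V_pos[OF elim] elim])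
        then show ?case unfolding V_prod[OF elim] \<Omega>V[OF elim] by simp
      qed
    qed
  next
    case False
    then have t0: "t > 0" using t by simp
    have "(\<lambda>N. \<Sum>v\<in>S N. pf_coeff (S N) v * max (1 - v / (real N * t)) 0 ^ N) \<longlonglongrightarrow> (\<Sum>j. \<alpha> j * exp (- (\<xi> j)\<^sup>2 / t))"
    proof (rule truncated_power_sum_tendsto[where A = "\<lambda>N. pf_coeff (S N)" and \<xi> = "\<lambda>j. (\<xi> j)\<^sup>2" and c = "(pi / 4)\<^sup>2" and a = a and n = n and p = p and C = "\<bar>K\<bar> * 2 ^ p"])
      show "0 < t" "0 < (pi / 4)\<^sup>2" "0 \<le> a" "a + 1 \<le> real n" using t0 a by auto
      show "\<forall>\<^sub>F N in sequentially. finite (S N) \<and> (\<forall>v\<in>S N. (pi / 4)\<^sup>2 \<le> v)"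
        using S_lower_bound by eventually_elim (simp add: S_def)
      show "\<forall>\<^sub>F N in sequentially. \<forall>\<tau>. cmod (\<Sum>v\<in>S N. of_real (pf_coeff (S N) v) * of_real v powr (of_real a + \<i> * of_real \<tau>)) \<le> \<bar>K\<bar> * 2 ^ p * (1 + \<bar>\<tau>\<bar>) ^ p"
      proof -
        have "\<forall>\<^sub>F N in sequentially. real N \<ge> r" using filterlim_real_sequentially unfolding filterlim_at_top by blast
        then show ?thesis using eventually_ge_at_top[of N0] by eventually_elim (use bound in blast)
      qed
      show "(\<lambda>N. \<Sum>v\<in>S N. pf_coeff (S N) v * kernel n (Suc p) (v / X)) \<longlonglongrightarrow> (\<Sum>j. \<alpha> j * kernel n (Suc p) ((\<xi> j)\<^sup>2 / X))" if "X > 0" for X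
        by (rule kernel_sum_tendsto[OF that isCont_kernel]) (simp add: kernel_eq_0)
      show "(pi / 4)\<^sup>2 \<le> (\<xi> j)\<^sup>2" for j
      proof (rule power_mono)
        show "pi / 4 \<le> \<xi> j" using \<xi>_gt(1)[of j] pi_gt_zero by linarith
      qed simp
      show "finite {j. (\<xi> j)\<^sup>2 < X}" for X
      proof (rule finite_subset)
        show "{j. (\<xi> j)\<^sup>2 < X} \<subseteq> {..<nat \<lceil>X\<rceil>}"
        proof
          fix j assume "j \<in> {j. (\<xi> j)\<^sup>2 < X}"
          then have "real j < X" using \<xi>_sq_ge[of j] by simp
          then show "j \<in> {..<nat \<lceil>X\<rceil>}" by (simp add: less_ceiling_iff zless_nat_eq_int_zless)
        qed
      qed simp
      show "summable (\<lambda>j. \<bar>\<alpha> j\<bar> * exp (- (\<xi> j)\<^sup>2 / t))" by (rule summable_abs_\<alpha>_exp[OF t0])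
    qed
    then have "(\<lambda>N. real (N + 1) / real N * (1 - (\<Sum>v\<in>S N. pf_coeff (S N) v * max (1 - v / (real N * t)) 0 ^ N)))
       \<longlonglongrightarrow> 1 * (1 - (\<Sum>j. \<alpha> j * exp (- (\<xi> j)\<^sup>2 / t)))"
      by (intro tendsto_mult tendsto_diff tendsto_const tendsto_1_plus_inverse)
    then have "(\<lambda>N. real (N + 1) / real N * (1 - (\<Sum>v\<in>S N. pf_coeff (S N) v * max (1 - v / (real N * t)) 0 ^ N)))
       \<longlonglongrightarrow> theta_like d t"
      by (simp only: theta_like_eq[OF t0] mult_1_left)
    then show ?thesis
    proof (rule Lim_transform_eventually)
      show "\<forall>\<^sub>F N in sequentially. real (N + 1) / real N * (1 - (\<Sum>v\<in>S N. pf_coeff (S N) v * max (1 - v / (real N * t)) 0 ^ N))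
         = (u N)\<^sup>2 * (\<Prod>k=1..N. (x N k)\<^sup>2) / real N * assoc_bspline N (real N / (\<beta> N)\<^sup>2 * t) (\<Omega> N)"
        using eventually_ge_at_top[of 1]
      proof eventually_elim
        case (elim N)
        define \<tau> where "\<tau> = real N / (\<beta> N)\<^sup>2 * t"
        have b: "(\<beta> N)\<^sup>2 > 0" using \<beta>_pos[OF elim] by simp
        have \<tau>: "\<tau> > 0" unfolding \<tau>_def using b t0 elim by (intro mult_pos_pos divide_pos_pos) auto
        have inj: "inj_on ((*) ((\<beta> N)\<^sup>2)) (V N)" using b by (auto simp: inj_on_def)
        \<comment> \<open>The coefficients depend only on ratios of knots, so undoing the scaling by
          the square of \<open>\<beta> N\<close> merely replaces \<open>N t\<close> by
          \<open>\<tau>\<close>.\<close>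
        have "(\<Sum>v\<in>S N. pf_coeff (S N) v * max (1 - v / (real N * t)) 0 ^ N)
           = (\<Sum>v\<in>V N. pf_coeff (V N) v * max (1 - v / \<tau>) 0 ^ N)"
          unfolding SV sum.reindex[OF inj] o_def pf_coeff_scale[OF b]
          by (intro sum.cong refl) (simp add: \<tau>_def mult.commute)
        then have "real (N + 1) * (1 - (\<Sum>v\<in>S N. pf_coeff (S N) v * max (1 - v / (real N * t)) 0 ^ N))
           = (\<Prod>(V N)) * (bspline N \<tau> (insert 0 (V N)) / \<tau> ^ N)"
          using bspline_eq_pf_sum[OF V_fin V_card[OF elim] V_pos[OF elim] \<tau> elim] by simp
        also have "bspline N \<tau> (insert 0 (V N)) / \<tau> ^ N = assoc_bspline N \<tau> (\<Omega> N)"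
          using \<tau> by (simp add: assoc_bspline_def \<Omega>V[OF elim])
        also have "\<Prod>(V N) = (u N)\<^sup>2 * (\<Prod>k=1..N. (x N k)\<^sup>2)" by (rule V_prod[OF elim])
        finally show ?case unfolding \<tau>_def by simp
      qed
    qed
  qed
qed

end
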